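(* Let $D$ be a distributive lattice with zero. Let $\langle K,\lambda\rangle$, $\langle P,\mu\rangle$, and $\langle Q,\nu\rangle$ be $D$-measured partial lattices, with $K$ a finite lattice and with $\langle P,\mu\rangle$ and $\langle Q,\nu\rangle$ balanced. Let $f\colon\langle K,\lambda\rangle\to\langle P,\mu\rangle$ and $g\colon\langle K,\lambda\rangle\to\langle Q,\nu\rangle$ be homomorphisms. Then there exists a proper $D$-measured lattice $\langle L,\varphi\rangle$, together with homomorphisms $\overline f\colon\langle P,\mu\rangle\to\langle L,\varphi\rangle$ and $\overline g\colon\langle Q,\nu\rangle\to\langle L,\varphi\rangle$, such that $\overline f\circ f=\overline g\circ g$ and $L$ is generated, as a lattice, by $\overline f[P]\cup\overline g[Q]$.
   Context: **Partial lattices.** $[X]^{<\omega}_*$ is the set of nonempty finite subsets of $X$. For a preordering $\le$ on $P$, "$a=\sup X$" means that $x\le a$ for all $x\in X$ and that $a\le b$ whenever $x\le b$ for all $x\in X$; $\inf$ is dual. A *partial prelattice* is $\langle P,\le,\bigvee,\bigwedge\rangle$ with $P$ a nonempty set, $\le$ a preordering on $P$, and $\bigvee,\bigwedge$ partial functions from $[P]^{<\omega}_*$ to $P$ such that $a=\bigvee X$ implies $a=\sup X$ and $a=\bigwedge X$ implies $a=\inf X$. It is a *partial lattice* if $\le$ is antisymmetric. Lattices are identified with partial lattices in which $\bigvee,\bigwedge$ are defined on all of $[P]^{<\omega}_*$. A *homomorphism* of partial lattices is an order-preserving map $f$ such that $a=\bigvee X$ implies $f(a)=\bigvee f[X]$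 and $a=\bigwedge X$ implies $f(a)=\bigwedge f[X]$. **Congruences.** A *congruence* of a partial lattice $P$ is a preordering $\preceq$ of $P$ containing $\le$ such that $\langle P,\preceq,\bigvee,\bigwedge\rangle$ is a partial prelattice. Ordered by inclusion the congruences form an algebraic lattice; $\mathrm{Con}_c\,P$ is the $\{\vee,0\}$-semilattice of its compact elements, with zero $\mathbf 0_P$ (the ordering of $P$). $\Theta_P^+(a,b)$ is the least congruence containing $\langle a,b\rangle$. For a homomorphism $f\colon P\to Q$, $\mathrm{Con}_c f$ sends $\alpha\in\mathrm{Con}_cP$ to the congruence of $Q$ generated by all $\langle f(x),f(y)\rangle$ with $\langle x,y\rangle\in\alpha$. **Measured and comeasured partial lattices.** A *$D$-measured partial lattice* is a pair $\langle P,\varphi\rangle$ with $P$ a partial lattice and $\varphi\colon\mathrm{Con}_cP\to D$ a $\{\vee,0\}$-homomorphism; it is a *$D$-measured lattice* if $P$ is a lattice, and *proper* if $\varphi(\theta)=0$ implies $\theta=\mathbf 0_P$. A homomorphism $\langle P,\mu\rangle\to\langle Q,\nu\rangle$ is a homomorphism $f\colon P\to Q$ of partial lattices with $\nu\circ\mathrm{Con}_cf=\mu$. Let $E=D^{\mathrm d}$ be the dual lattice of $D$ (with unit $1_E=0_D$), and put $\|x\le y\|=\varphi(\Theta_P^+(x,y))\in E$. All lattice operations on values $\|\cdot\|$ below are computed in $E$. This makes $P$ an *$E$-comeasured partial lattice*: $\|x\le y\|=1$ if $x\le y$; $\|x\le y\|\wedge\|y\le z\|\le\|x\le z\|$; $a=\bigvee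 X$ implies $\|a\le b\|=\bigwedge_{x\in X}\|x\le b\|$; and $a=\bigwedge X$ implies $\|b\le a\|=\bigwedge_{x\in X}\|b\le x\|$. **Balanced.** Let $P$ be an $E$-comeasured partial lattice. Put $\|a=b\|=\|a\le b\|\wedge\|b\le a\|$; for $X,Y\in[P]^{<\omega}_*$ put $\|X\subseteq Y\|=\bigwedge_{x\in X}\bigvee_{y\in Y}\|x=y\|$ and $\|X=Y\|=\|X\subseteq Y\|\wedge\|Y\subseteq X\|$. For $\mathcal D\subseteq[P]^{<\omega}_*$, a *$\mathcal D$-cover* of $X\in[P]^{<\omega}_*$ is a nonempty finite $\mathcal D'\subseteq\mathcal D$ such that $\|X=Y\|\le\bigvee_{Z\in\mathcal D'}\|X=Z\|$ for all $Y\in\mathcal D$. $P$ is *finitely covering* if every $X\in[P]^{<\omega}_*$ has a $\mathrm{dom}\bigvee$-cover and a $\mathrm{dom}\bigwedge$-cover. In that case put $\|a=\bigvee X\|=\bigvee_{i<n}\|a=a_i\|\wedge\|X=X_i\|$, where $\{X_i\mid i<n\}$ is any $\mathrm{dom}\bigvee$-cover of $X$ and $a_i=\bigvee X_i$ (the value does not depend on the cover); define $\|a=\bigwedge X\|$ dually using $\mathrm{dom}\bigwedge$-covers. A *join-sample* of $X$ is a nonempty finite $U\subseteq P$ with $\|x=\bigvee X\|\le\bigvee_{u\in U}\|u=\bigvee X\|$ for all $x\in P$; meet-samples are defined dually (these exist when $P$ is finitely covering). Put $\|a\le\bigvee X\|=\bigvee_{u\in U}\|a\le u\|\wedge\|u=\bigvee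 X\|$ for any join-sample $U$ of $X$, and $\|\bigwedge X\le a\|=\bigvee_{u\in U}\|u\le a\|\wedge\|u=\bigwedge X\|$ for any meet-sample $U$ of $X$ (independent of $U$). For $X,U\in[P]^{<\omega}_*$ put $\|a\in\mathrm{Id}_0(X,U)\|=\bigvee_{x\in X}\|a\le x\|$ and $$\|a\in\mathrm{Id}_{n+1}(X,U)\|=\|a\in\mathrm{Id}_n(X,U)\|\vee\bigvee_{\varnothing\ne Z\subseteq U}\Bigl(\|a\le\textstyle\bigvee Z\|\wedge\bigwedge_{z\in Z}\|z\in\mathrm{Id}_n(X,U)\|\Bigr);$$ $\|a\in\mathrm{Fil}_n(X,U)\|$ is defined dually, starting with $\bigvee_{x\in X}\|x\le a\|$ and using $\|\bigwedge Z\le a\|$. A finitely covering $P$ has: - $(\mathrm{Id}\cap)$ if for all $a,b\in P$ there is $U\in[P]^{<\omega}_*$ with $\|x\le a\|\wedge\|x\le b\|=\bigvee_{u\in U}\|x\le u\|\wedge\|u\le a\|\wedge\|u\le b\|$ for all $x\in P$; - $(\mathrm{Fil}\cap)$ if the dual holds: for all $a,b$ there is $U$ with $\|a\le x\|\wedge\|b\le x\|=\bigvee_{u\in U}\|u\le x\|\wedge\|a\le u\|\wedge\|b\le u\|$ for all $x$; - $(\mathrm{Id}\vee)$ if for every $X\in[P]^{<\omega}_*$ there are $U\in[P]^{<\omega}_*$ and $n<\omega$ with $\|a\in\mathrm{Id}_n(X,U)\|=\|a\in\mathrm{Id}_{n+1}(X,Y)\|$ for all $a\in P$ and all finite $Y\supseteq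 U$; - $(\mathrm{Fil}\vee)$ if the same holds with $\mathrm{Fil}$ in place of $\mathrm{Id}$. $P$ is *balanced* if it is finitely covering and has $(\mathrm{Id}\cap)$, $(\mathrm{Id}\vee)$, $(\mathrm{Fil}\cap)$, $(\mathrm{Fil}\vee)$. A $D$-measured partial lattice is *balanced* if the associated $D^{\mathrm d}$-comeasured partial lattice is balanced. *)

theory Defs
  imports "HOL-Library.FuncSet" "HOL-Library.Dual_Ordered_Lattice"
begin

section \<open>Partial lattices\<close>

text \<open>The partial operations are \<open>option\<close>-valued; \<open>pjoin P X = None\<close> means that the join of \<open>X\<close>
  is undefined. Orderings are sets of pairs, contained in \<open>pcarrier P \<times> pcarrier P\<close>.\<close>

record 'a partial_lattice =
  pcarrier :: "'a set"
  ple :: "'a rel"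
  pjoin :: "'a set \<Rightarrow> 'a option"
  pmeet :: "'a set \<Rightarrow> 'a option"

definition nfin :: "'a set \<Rightarrow> 'a set set" where
  "nfin A = {X. X \<subseteq> A \<and> finite X \<and> X \<noteq> {}}"

definition is_sup :: "'a set \<Rightarrow> 'a rel \<Rightarrow> 'a set \<Rightarrow> 'a \<Rightarrow> bool" where
  "is_sup A r X a \<longleftrightarrow>
     a \<in> A \<and> (\<forall>x\<in>X. (x, a) \<in> r) \<and> (\<forall>b\<in>A. (\<forall>x\<in>X. (x, b) \<in> r) \<longrightarrow> (a, b) \<in> r)"

definition is_inf :: "'a set \<Rightarrow> 'a rel \<Rightarrow> 'a set \<Rightarrow> 'a \<Rightarrow> bool" where
  "is_inf A r X a \<longleftrightarrow>
     a \<in> A \<and> (\<forall>x\<in>X. (a, x) \<in> r) \<and> (\<forall>b\<in>A. (\<forall>x\<in>X. (b, x) \<in> r) \<longrightarrow> (b, a) \<in> r)"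

definition partial_prelattice :: "'a partial_lattice \<Rightarrow> bool" where
  "partial_prelattice P \<longleftrightarrow>
     pcarrier P \<noteq> {} \<and> preorder_on (pcarrier P) (ple P) \<and>
     (\<forall>X a. pjoin P X = Some a \<longrightarrow> X \<in> nfin (pcarrier P) \<and> is_sup (pcarrier P) (ple P) X a) \<and>
     (\<forall>X a. pmeet P X = Some a \<longrightarrow> X \<in> nfin (pcarrier P) \<and> is_inf (pcarrier P) (ple P) X a)"

definition is_partial_lattice :: "'a partial_lattice \<Rightarrow> bool" where
  "is_partial_lattice P \<longleftrightarrow> partial_prelattice P \<and> antisym (ple P)"

definition is_lattice :: "'a partial_lattice \<Rightarrow> bool" where
  "is_lattice P \<longleftrightarrow> is_partial_lattice P \<and>
     dom (pjoin P) = nfin (pcarrier P) \<and> dom (pmeet P) = nfin (pcarrier P)"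

definition pl_hom :: "'a partial_lattice \<Rightarrow> 'b partial_lattice \<Rightarrow> ('a \<Rightarrow> 'b) \<Rightarrow> bool" where
  "pl_hom P Q f \<longleftrightarrow>
     f \<in> pcarrier P \<rightarrow> pcarrier Q \<and>
     (\<forall>x y. (x, y) \<in> ple P \<longrightarrow> (f x, f y) \<in> ple Q) \<and>
     (\<forall>X a. pjoin P X = Some a \<longrightarrow> pjoin Q (f ` X) = Some (f a)) \<and>
     (\<forall>X a. pmeet P X = Some a \<longrightarrow> pmeet Q (f ` X) = Some (f a))"

definition is_sublattice :: "'a partial_lattice \<Rightarrow> 'a set \<Rightarrow> bool" where
  "is_sublattice L S \<longleftrightarrow> S \<subseteq> pcarrier L \<and>
     (\<forall>X a. X \<in> nfin S \<longrightarrow> pjoin L X = Some a \<longrightarrow> a \<in> S) \<and>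
     (\<forall>X a. X \<in> nfin S \<longrightarrow> pmeet L X = Some a \<longrightarrow> a \<in> S)"

definition lattice_span :: "'a partial_lattice \<Rightarrow> 'a set \<Rightarrow> 'a set" where
  "lattice_span L A = \<Inter>{S. is_sublattice L S \<and> A \<subseteq> S}"


section \<open>Congruences\<close>

definition Con :: "'a partial_lattice \<Rightarrow> 'a rel set" where
  "Con P = {\<theta>. ple P \<subseteq> \<theta> \<and> partial_prelattice (P\<lparr>ple := \<theta>\<rparr>)}"

text \<open>The congruence generated by \<open>R\<close>; in particular \<open>cg P (\<Union>S)\<close> is the join of \<open>S\<close> in \<open>Con P\<close>.\<close>

definition cg :: "'a partial_lattice \<Rightarrow> 'a rel \<Rightarrow> 'a rel" where
  "cg P R = \<Inter>{\<theta> \<in> Con P. R \<subseteq> \<theta>}"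

abbreviation Theta_plus :: "'a partial_lattice \<Rightarrow> 'a \<Rightarrow> 'a \<Rightarrow> 'a rel" where
  "Theta_plus P a b \<equiv> cg P {(a, b)}"

definition Con_c :: "'a partial_lattice \<Rightarrow> 'a rel set" where
  "Con_c P = {\<theta> \<in> Con P. \<forall>S \<subseteq> Con P. \<theta> \<subseteq> cg P (\<Union>S) \<longrightarrow>
                (\<exists>F \<subseteq> S. finite F \<and> \<theta> \<subseteq> cg P (\<Union>F))}"

definition Con_c_map :: "'b partial_lattice \<Rightarrow> ('a \<Rightarrow> 'b) \<Rightarrow> 'a rel \<Rightarrow> 'b rel" where
  "Con_c_map Q f \<alpha> = cg Q {(f x, f y) |x y. (x, y) \<in> \<alpha>}"


section \<open>Measured partial lattices\<close>

text \<open>Only the values of \<open>\<phi>\<close> on \<open>Con_c P\<close> are relevant.\<close>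

definition measured :: "'a partial_lattice \<Rightarrow> ('a rel \<Rightarrow> 'd::{distrib_lattice,order_bot}) \<Rightarrow> bool" where
  "measured P \<phi> \<longleftrightarrow> is_partial_lattice P \<and>
     \<phi> (ple P) = bot \<and>
     (\<forall>\<alpha>\<in>Con_c P. \<forall>\<beta>\<in>Con_c P. \<phi> (cg P (\<alpha> \<union> \<beta>)) = sup (\<phi> \<alpha>) (\<phi> \<beta>))"

definition measured_lattice :: "'a partial_lattice \<Rightarrow> ('a rel \<Rightarrow> 'd::{distrib_lattice,order_bot}) \<Rightarrow> bool" where
  "measured_lattice P \<phi> \<longleftrightarrow> measured P \<phi> \<and> is_lattice P"

definition proper :: "'a partial_lattice \<Rightarrow> ('a rel \<Rightarrow> 'd::{distrib_lattice,order_bot}) \<Rightarrow> bool" where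
  "proper P \<phi> \<longleftrightarrow> (\<forall>\<theta>\<in>Con_c P. \<phi> \<theta> = bot \<longrightarrow> \<theta> = ple P)"

definition measured_hom ::
  "'a partial_lattice \<Rightarrow> ('a rel \<Rightarrow> 'd::{distrib_lattice,order_bot}) \<Rightarrow>
   'b partial_lattice \<Rightarrow> ('b rel \<Rightarrow> 'd) \<Rightarrow> ('a \<Rightarrow> 'b) \<Rightarrow> bool" where
  "measured_hom P \<mu> Q \<nu> f \<longleftrightarrow>
     pl_hom P Q f \<and> (\<forall>\<alpha>\<in>Con_c P. \<nu> (Con_c_map Q f \<alpha>) = \<mu> \<alpha>)"


section \<open>Comeasured partial lattices\<close>

text \<open>In this section \<open>v x y\<close> stands for the value \<open>\<parallel>x \<le> y\<parallel>\<close> in the lattice \<open>E\<close>. Finite nonempty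
  meets and joins in \<open>E\<close> are \<^const>\<open>Inf_fin\<close> and \<^const>\<open>Sup_fin\<close>.\<close>

definition comeasure ::
  "'a partial_lattice \<Rightarrow> ('a rel \<Rightarrow> 'd) \<Rightarrow> 'a \<Rightarrow> 'a \<Rightarrow> 'd::{distrib_lattice,order_bot} dual" where
  "comeasure P \<phi> x y = dual (\<phi> (Theta_plus P x y))"

definition eq_val :: "('a \<Rightarrow> 'a \<Rightarrow> 'e::lattice) \<Rightarrow> 'a \<Rightarrow> 'a \<Rightarrow> 'e" where
  "eq_val v a b = inf (v a b) (v b a)"

definition subset_val :: "('a \<Rightarrow> 'a \<Rightarrow> 'e::lattice) \<Rightarrow> 'a set \<Rightarrow> 'a set \<Rightarrow> 'e" where
  "subset_val v X Y = Inf_fin ((\<lambda>x. Sup_fin ((\<lambda>y. eq_val v x y) ` Y)) ` X)"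

definition set_eq_val :: "('a \<Rightarrow> 'a \<Rightarrow> 'e::lattice) \<Rightarrow> 'a set \<Rightarrow> 'a set \<Rightarrow> 'e" where
  "set_eq_val v X Y = inf (subset_val v X Y) (subset_val v Y X)"

definition is_cover :: "('a \<Rightarrow> 'a \<Rightarrow> 'e::lattice) \<Rightarrow> 'a set set \<Rightarrow> 'a set \<Rightarrow> 'a set set \<Rightarrow> bool" where
  "is_cover v \<D> X \<C> \<longleftrightarrow> \<C> \<in> nfin \<D> \<and>
     (\<forall>Y\<in>\<D>. set_eq_val v X Y \<le> Sup_fin ((\<lambda>Z. set_eq_val v X Z) ` \<C>))"

definition finitely_covering :: "'a partial_lattice \<Rightarrow> ('a \<Rightarrow> 'a \<Rightarrow> 'e::lattice) \<Rightarrow> bool" where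
  "finitely_covering P v \<longleftrightarrow>
     (\<forall>X \<in> nfin (pcarrier P).
        (\<exists>\<C>. is_cover v (dom (pjoin P)) X \<C>) \<and> (\<exists>\<C>. is_cover v (dom (pmeet P)) X \<C>))"

text \<open>The value \<open>\<parallel>a = opr X\<parallel>\<close> for \<open>opr\<close> one of \<open>pjoin P\<close>, \<open>pmeet P\<close>; both cases have the same shape.
  In a finitely covering comeasured partial lattice the choice of the cover is immaterial, and so is
  that of the samples below.\<close>

definition eq_op_val :: "('a \<Rightarrow> 'a \<Rightarrow> 'e::lattice) \<Rightarrow> ('a set \<Rightarrow> 'a option) \<Rightarrow> 'a \<Rightarrow> 'a set \<Rightarrow> 'e" where
  "eq_op_val v opr a X =
     (let \<C> = (SOME \<C>. is_cover v (dom opr) X \<C>)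
      in Sup_fin ((\<lambda>Z. inf (eq_val v a (the (opr Z))) (set_eq_val v X Z)) ` \<C>))"

text \<open>Join-samples for \<open>opr = pjoin P\<close>, meet-samples for \<open>opr = pmeet P\<close>.\<close>

definition is_sample ::
  "'a partial_lattice \<Rightarrow> ('a \<Rightarrow> 'a \<Rightarrow> 'e::lattice) \<Rightarrow> ('a set \<Rightarrow> 'a option) \<Rightarrow> 'a set \<Rightarrow> 'a set \<Rightarrow> bool" where
  "is_sample P v opr X U \<longleftrightarrow> U \<in> nfin (pcarrier P) \<and>
     (\<forall>x \<in> pcarrier P. eq_op_val v opr x X \<le> Sup_fin ((\<lambda>u. eq_op_val v opr u X) ` U))"

definition le_join_val :: "'a partial_lattice \<Rightarrow> ('a \<Rightarrow> 'a \<Rightarrow> 'e::lattice) \<Rightarrow> 'a \<Rightarrow> 'a set \<Rightarrow> 'e" where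
  "le_join_val P v a X =
     (let U = (SOME U. is_sample P v (pjoin P) X U)
      in Sup_fin ((\<lambda>u. inf (v a u) (eq_op_val v (pjoin P) u X)) ` U))"

definition meet_le_val :: "'a partial_lattice \<Rightarrow> ('a \<Rightarrow> 'a \<Rightarrow> 'e::lattice) \<Rightarrow> 'a set \<Rightarrow> 'a \<Rightarrow> 'e" where
  "meet_le_val P v X a =
     (let U = (SOME U. is_sample P v (pmeet P) X U)
      in Sup_fin ((\<lambda>u. inf (v u a) (eq_op_val v (pmeet P) u X)) ` U))"

primrec Id_val ::
  "'a partial_lattice \<Rightarrow> ('a \<Rightarrow> 'a \<Rightarrow> 'e::lattice) \<Rightarrow> nat \<Rightarrow> 'a set \<Rightarrow> 'a set \<Rightarrow> 'a \<Rightarrow> 'e" where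
  "Id_val P v 0 X U a = Sup_fin ((\<lambda>x. v a x) ` X)"
| "Id_val P v (Suc n) X U a =
     sup (Id_val P v n X U a)
       (Sup_fin ((\<lambda>Z. inf (le_join_val P v a Z) (Inf_fin ((\<lambda>z. Id_val P v n X U z) ` Z)))
                 ` {Z. Z \<noteq> {} \<and> Z \<subseteq> U}))"

primrec Fil_val ::
  "'a partial_lattice \<Rightarrow> ('a \<Rightarrow> 'a \<Rightarrow> 'e::lattice) \<Rightarrow> nat \<Rightarrow> 'a set \<Rightarrow> 'a set \<Rightarrow> 'a \<Rightarrow> 'e" where
  "Fil_val P v 0 X U a = Sup_fin ((\<lambda>x. v x a) ` X)"
| "Fil_val P v (Suc n) X U a =
     sup (Fil_val P v n X U a)
       (Sup_fin ((\<lambda>Z. inf (meet_le_val P v Z a) (Inf_fin ((\<lambda>z. Fil_val P v n X U z) ` Z)))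
                 ` {Z. Z \<noteq> {} \<and> Z \<subseteq> U}))"

definition Id_cap :: "'a partial_lattice \<Rightarrow> ('a \<Rightarrow> 'a \<Rightarrow> 'e::lattice) \<Rightarrow> bool" where
  "Id_cap P v \<longleftrightarrow>
     (\<forall>a \<in> pcarrier P. \<forall>b \<in> pcarrier P. \<exists>U \<in> nfin (pcarrier P). \<forall>x \<in> pcarrier P.
        inf (v x a) (v x b) = Sup_fin ((\<lambda>u. inf (v x u) (inf (v u a) (v u b))) ` U))"

definition Fil_cap :: "'a partial_lattice \<Rightarrow> ('a \<Rightarrow> 'a \<Rightarrow> 'e::lattice) \<Rightarrow> bool" where
  "Fil_cap P v \<longleftrightarrow>
     (\<forall>a \<in> pcarrier P. \<forall>b \<in> pcarrier P. \<exists>U \<in> nfin (pcarrier P). \<forall>x \<in> pcarrier P.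
        inf (v a x) (v b x) = Sup_fin ((\<lambda>u. inf (v u x) (inf (v a u) (v b u))) ` U))"

definition Id_vee :: "'a partial_lattice \<Rightarrow> ('a \<Rightarrow> 'a \<Rightarrow> 'e::lattice) \<Rightarrow> bool" where
  "Id_vee P v \<longleftrightarrow>
     (\<forall>X \<in> nfin (pcarrier P). \<exists>U \<in> nfin (pcarrier P). \<exists>n.
        \<forall>a \<in> pcarrier P. \<forall>Y \<in> nfin (pcarrier P). U \<subseteq> Y \<longrightarrow>
          Id_val P v n X U a = Id_val P v (Suc n) X Y a)"

definition Fil_vee :: "'a partial_lattice \<Rightarrow> ('a \<Rightarrow> 'a \<Rightarrow> 'e::lattice) \<Rightarrow> bool" where
  "Fil_vee P v \<longleftrightarrow>
     (\<forall>X \<in> nfin (pcarrier P). \<exists>U \<in> nfin (pcarrier P). \<exists>n.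
        \<forall>a \<in> pcarrier P. \<forall>Y \<in> nfin (pcarrier P). U \<subseteq> Y \<longrightarrow>
          Fil_val P v n X U a = Fil_val P v (Suc n) X Y a)"

definition balanced :: "'a partial_lattice \<Rightarrow> ('a \<Rightarrow> 'a \<Rightarrow> 'e::lattice) \<Rightarrow> bool" where
  "balanced P v \<longleftrightarrow>
     finitely_covering P v \<and> Id_cap P v \<and> Id_vee P v \<and> Fil_cap P v \<and> Fil_vee P v"

definition balanced_measured :: "'a partial_lattice \<Rightarrow> ('a rel \<Rightarrow> 'd::{distrib_lattice,order_bot}) \<Rightarrow> bool" where
  "balanced_measured P \<phi> \<longleftrightarrow> measured P \<phi> \<and> balanced P (comeasure P \<phi>)"


section \<open>Lattice terms\<close>

text \<open>A lattice generated by the images of \<open>P\<close> and \<open>Q\<close> is a quotient of a set of lattice terms over the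
  disjoint sum of \<open>P\<close> and \<open>Q\<close>. Hence, up to isomorphism, it lives on sets of such terms, and
  asserting the existence of a lattice with carrier in \<open>('p + 'q) lterm set\<close> is no restriction.\<close>

datatype 'a lterm = Gen 'a | TJoin "'a lterm" "'a lterm" | TMeet "'a lterm" "'a lterm"

end

theory Submission
  imports Defs
begin

text \<open>A distributive lattice with zero embeds into the power set of its set of prime ideals, so every
  value in \<open>D\<close> is determined by the prime ideals containing it. A prime ideal \<open>H\<close> turns \<open>P\<close> and \<open>Q\<close>
  into partial prelattices, with \<open>x \<le> y\<close> iff \<open>\<mu> (\<Theta>\<^sup>+(x, y)) \<in> H\<close>, and they can be amalgamated over the
  finite lattice \<open>K\<close>. The free lattice over the amalgam is ordered by Whitman's conditions, where ideals
  and filters of the amalgam take care of the partial operations. Balancedness says that these ideals and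
  filters are finitely generated uniformly in \<open>H\<close>. Hence for terms \<open>s\<close> and \<open>t\<close> the set of all
  \<open>H\<close> with \<open>s \<le> t\<close> at \<open>H\<close> is represented by an element of \<open>D\<close>. The lattice sought is the set
  of terms modulo equivalence at all \<open>H\<close>, and \<open>\<phi> \<theta>\<close> is the element that lies in \<open>H\<close> iff \<open>\<theta>\<close> is
  contained in the ordering at \<open>H\<close>.\<close>

section \<open>Prime ideals of a distributive lattice with zero\<close>

text \<open>The obstacle is uniformity in \<open>H\<close>. At a single prime ideal, amalgamating
  and passing to a free lattice is classical; here one element of \<open>D\<close> must describe the
  outcome at all prime ideals together, so every quantifier over an infinite set has to be replaced
  by one over a finite set chosen before \<open>H\<close>. Finiteness of \<open>K\<close> serves
  this twice: mixed comparisons p <= f k, g k <= q range over finitely many interpolants k, and an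
  ideal of the amalgam is reached after at most \<open>card K\<close> exchanges between the two
  sides. That \<open>K\<close> has all joins and meets lets one interpolant replace several. Since
  \<open>f\<close> and \<open>g\<close> respect the measures, they induce the same ordering on
  \<open>K\<close> at each \<open>H\<close>, so going to the other side and back yields no new
  comparison. It is the test that tells the predicates represented by an element from the constant
  False: all comparisons of terms hold there.\<close>

definition prime_ideal :: "('d::{distrib_lattice,order_bot} \<Rightarrow> bool) \<Rightarrow> bool" where
  "prime_ideal H \<longleftrightarrow> H bot \<and> (\<forall>a b. H (sup a b) \<longleftrightarrow> H a \<and> H b) \<and> (\<forall>a b. H (inf a b) \<longleftrightarrow> H a \<or> H b)"

lemma prime_ideal_bot: "prime_ideal H \<Longrightarrow> H bot"
  and prime_ideal_sup: "prime_ideal H \<Longrightarrow> H (sup a b) \<longleftrightarrow> H a \<and> H b"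
  and prime_ideal_inf: "prime_ideal H \<Longrightarrow> H (inf a b) \<longleftrightarrow> H a \<or> H b"
  by (auto simp: prime_ideal_def)

lemma prime_ideal_mono: "prime_ideal H \<Longrightarrow> H b \<Longrightarrow> a \<le> b \<Longrightarrow> H a"
  by (metis prime_ideal_sup sup.absorb_iff2)

lemma prime_ideal_True: "prime_ideal (\<lambda>_. True)"
  by (simp add: prime_ideal_def)

text \<open>An ideal that is maximal among those containing \<open>b\<close> and omitting
  \<open>a\<close> is prime: by distributivity, two elements outside it whose meet is inside would
  force \<open>a\<close> into it.\<close>

lemma prime_ideal_separation:
  fixes a b :: "'d::{distrib_lattice,order_bot}"
  assumes "\<not> a \<le> b"
  obtains H where "prime_ideal H" "H b" "\<not> H a"
proof -
  \<comment> \<open>The equivalence for \<open>sup\<close> encodes closure under joins and downward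
    closure at once.\<close>
  define \<A> where "\<A> = {I. bot \<in> I \<and> (\<forall>x y. sup x y \<in> I \<longleftrightarrow> x \<in> I \<and> y \<in> I) \<and> b \<in> I \<and> a \<notin> I}"
  have "\<exists>M\<in>\<A>. \<forall>X\<in>\<A>. M \<subseteq> X \<longrightarrow> X = M"
  proof (rule subset_Zorn_nonempty)
    have "{x. x \<le> b} \<in> \<A>"
      using assms by (simp add: \<A>_def)
    then show "\<A> \<noteq> {}" by blast
  next
    fix \<C> assume \<C>: "\<C> \<noteq> {}" "subset.chain \<A> \<C>"
    then have 1: "\<And>I. I \<in> \<C> \<Longrightarrow> I \<in> \<A>" and 2: "\<And>I J. I \<in> \<C> \<Longrightarrow> J \<in> \<C> \<Longrightarrow> I \<subseteq> J \<or> J \<subseteq> I"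
      by (auto simp: subset_chain_def)
    have "sup x y \<in> \<Union>\<C>" if xy: "x \<in> \<Union>\<C>" "y \<in> \<Union>\<C>" for x y
    proof -
      obtain I J where IJ: "I \<in> \<C>" "J \<in> \<C>" "x \<in> I" "y \<in> J" using xy by blast
      with 2[of I J] show ?thesis
        using 1[of I] 1[of J] unfolding \<A>_def by blast
    qed
    moreover have "x \<in> \<Union>\<C> \<and> y \<in> \<Union>\<C>" if "sup x y \<in> \<Union>\<C>" for x y
      using that 1 unfolding \<A>_def by blast
    ultimately show "\<Union>\<C> \<in> \<A>"
      using 1 \<C>(1) unfolding \<A>_def by blast
  qed
  then obtain M where M: "M \<in> \<A>" and maxM: "\<And>X. X \<in> \<A> \<Longrightarrow> M \<subseteq> X \<Longrightarrow> X = M" by blast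
  have Msup: "\<And>x y. sup x y \<in> M \<longleftrightarrow> x \<in> M \<and> y \<in> M" and Mb: "bot \<in> M" "b \<in> M" "a \<notin> M"
    using M by (auto simp: \<A>_def)
  have Mle: "x \<in> M" if "x \<le> y" "y \<in> M" for x y
    using that Msup by (metis sup.absorb_iff2)
  have ext: "\<exists>m\<in>M. a \<le> sup m x" if x: "x \<notin> M" for x
  proof (rule ccontr)
    assume neg: "\<not> ?thesis"
    \<comment> \<open>The ideal generated by \<open>M\<close> and \<open>x\<close>; if it omitted
      \<open>a\<close>, it would contradict the maximality of \<open>M\<close>.\<close>
    define N where "N = {y. \<exists>m\<in>M. y \<le> sup m x}"
    have "sup y z \<in> N" if "y \<in> N" "z \<in> N" for y z
    proof -
      obtain m n where mn: "m \<in> M" "n \<in> M" "y \<le> sup m x" "z \<le> sup n x"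
        using \<open>y \<in> N\<close> \<open>z \<in> N\<close> unfolding N_def by blast
      then have "sup y z \<le> sup (sup m n) x"
        using order_trans[OF mn(3) sup_mono[OF sup_ge1 order_refl]]
          order_trans[OF mn(4) sup_mono[OF sup_ge2 order_refl]] by simp
      moreover have "sup m n \<in> M" using mn by (simp add: Msup)
      ultimately show ?thesis using N_def by blast
    qed
    moreover have "y \<in> N \<and> z \<in> N" if "sup y z \<in> N" for y z
      using that unfolding N_def by (auto simp: le_sup_iff)
    moreover have "bot \<in> N" "M \<subseteq> N" "x \<in> N" using Mb unfolding N_def by (auto intro: le_supI1)
    moreover have "a \<notin> N" using neg by (auto simp: N_def)
    ultimately have "N \<in> \<A>" using Mb unfolding \<A>_def by blast
    then show False using maxM \<open>M \<subseteq> N\<close> \<open>x \<in> N\<close> x by blast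
  qed
  have "x \<in> M \<or> y \<in> M" if xy: "inf x y \<in> M" for x y
  proof (rule ccontr)
    assume "\<not> ?thesis"
    then obtain m n where mn: "m \<in> M" "n \<in> M" "a \<le> sup m x" "a \<le> sup n y"
      using ext by blast
    then have "a \<le> sup (sup m n) x" "a \<le> sup (sup m n) y"
      using order_trans[OF mn(3) sup_mono[OF sup_ge1 order_refl]]
        order_trans[OF mn(4) sup_mono[OF sup_ge2 order_refl]] by blast+
    then have "a \<le> sup (sup m n) (inf x y)"
      by (simp add: sup_inf_distrib1)
    moreover have "sup (sup m n) (inf x y) \<in> M" using mn xy by (simp add: Msup)
    ultimately show False using Mb(3) Mle by blast
  qed
  then have "prime_ideal (\<lambda>x. x \<in> M)"
    using Mb Msup Mle inf_le1 inf_le2 unfolding prime_ideal_def by metis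
  then show thesis using that Mb by blast
qed

lemma prime_ideal_eqI:
  assumes "\<And>H. prime_ideal H \<Longrightarrow> H a \<longleftrightarrow> H b"
  shows "a = b"
  by (metis assms order.antisym prime_ideal_separation)

lemma prime_ideal_eq_botI:
  assumes "\<And>H. prime_ideal H \<Longrightarrow> H a"
  shows "a = bot"
  by (rule prime_ideal_eqI) (simp add: assms prime_ideal_bot)

text \<open>A predicate on prime ideals is definable if it is represented by an element of the lattice. The
  predicate \<open>False\<close> has to be added by hand, since the lattice need not have a unit.\<close>

definition definable :: "(('d::{distrib_lattice,order_bot} \<Rightarrow> bool) \<Rightarrow> bool) \<Rightarrow> bool" where
  "definable S \<longleftrightarrow> (\<forall>H. prime_ideal H \<longrightarrow> \<not> S H) \<or> (\<exists>d. \<forall>H. prime_ideal H \<longrightarrow> (S H \<longleftrightarrow> H d))"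

lemma definable_elem: "definable (\<lambda>H. H d)"
  by (auto simp: definable_def)

lemma definable_False: "definable (\<lambda>_. False)"
  by (simp add: definable_def)

lemma definable_True: "definable (\<lambda>_. True)"
  unfolding definable_def using prime_ideal_bot by blast

lemma definable_cong:
  assumes "\<And>H. prime_ideal H \<Longrightarrow> S H \<longleftrightarrow> T H"
  shows "definable S \<longleftrightarrow> definable T"
  using assms unfolding definable_def by auto

lemma definable_conj:
  assumes "definable S" "definable T"
  shows "definable (\<lambda>H. S H \<and> T H)"
  using assms unfolding definable_def by (metis prime_ideal_sup)

lemma definable_disj:
  assumes "definable S" "definable T"
  shows "definable (\<lambda>H. S H \<or> T H)"
  using assms unfolding definable_def by (metis prime_ideal_inf)

lemma definable_Bex:
  assumes "finite A" "\<And>a. a \<in> A \<Longrightarrow> definable (S a)"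
  shows "definable (\<lambda>H. \<exists>a\<in>A. S a H)"
  using assms by (induction A) (simp_all add: definable_False definable_disj)

lemma definable_Ball:
  assumes "finite A" "\<And>a. a \<in> A \<Longrightarrow> definable (S a)"
  shows "definable (\<lambda>H. \<forall>a\<in>A. S a H)"
  using assms by (induction A) (simp_all add: definable_True definable_conj)

text \<open>The improper ideal decides between the two disjuncts of \<open>definable\<close>: a
  predicate that is true there is not the constant False, hence is represented.\<close>

lemma definable_obtain:
  assumes "definable S" "S (\<lambda>_. True)"
  obtains d where "\<And>H. prime_ideal H \<Longrightarrow> S H \<longleftrightarrow> H d"
  using assms prime_ideal_True unfolding definable_def by blast


section \<open>Congruences of partial lattices\<close>

lemma preorder_on_iff:
  "preorder_on A r \<longleftrightarrow> r \<subseteq> A \<times> A \<and> (\<forall>x\<in>A. (x, x) \<in> r) \<and> (\<forall>x y z. (x, y) \<in> r \<longrightarrow> (y, z) \<in> r \<longrightarrow> (x, z) \<in> r)"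
  by (auto simp: preorder_on_def refl_on_def trans_def)

text \<open>A larger preordering keeps all upper and lower bounds, so only the extremality of the
  given joins and meets has to be checked again.\<close>

lemma Con_iff:
  assumes "partial_prelattice P"
  shows "\<theta> \<in> Con P \<longleftrightarrow> ple P \<subseteq> \<theta> \<and> preorder_on (pcarrier P) \<theta> \<and>
    (\<forall>X a b. pjoin P X = Some a \<longrightarrow> b \<in> pcarrier P \<longrightarrow> (\<forall>x\<in>X. (x, b) \<in> \<theta>) \<longrightarrow> (a, b) \<in> \<theta>) \<and>
    (\<forall>X a b. pmeet P X = Some a \<longrightarrow> b \<in> pcarrier P \<longrightarrow> (\<forall>x\<in>X. (b, x) \<in> \<theta>) \<longrightarrow> (b, a) \<in> \<theta>)"
proof -
  have J: "X \<in> nfin (pcarrier P) \<and> is_sup (pcarrier P) (ple P) X a" if "pjoin P X = Some a" for X a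
    using assms that by (simp add: partial_prelattice_def)
  have M: "X \<in> nfin (pcarrier P) \<and> is_inf (pcarrier P) (ple P) X a" if "pmeet P X = Some a" for X a
    using assms that by (simp add: partial_prelattice_def)
  have "pcarrier P \<noteq> {}" using assms by (simp add: partial_prelattice_def)
  moreover have "is_sup (pcarrier P) \<theta> X a \<longleftrightarrow>
      (\<forall>b. b \<in> pcarrier P \<longrightarrow> (\<forall>x\<in>X. (x, b) \<in> \<theta>) \<longrightarrow> (a, b) \<in> \<theta>)"
    if "ple P \<subseteq> \<theta>" "pjoin P X = Some a" for X a
    using J[OF that(2)] that(1) unfolding is_sup_def by blast
  moreover have "is_inf (pcarrier P) \<theta> X a \<longleftrightarrow>
      (\<forall>b. b \<in> pcarrier P \<longrightarrow> (\<forall>x\<in>X. (b, x) \<in> \<theta>) \<longrightarrow> (b, a) \<in> \<theta>)"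
    if "ple P \<subseteq> \<theta>" "pmeet P X = Some a" for X a
    using M[OF that(2)] that(1) unfolding is_inf_def by blast
  ultimately show ?thesis
    using J M unfolding Con_def partial_prelattice_def by auto
qed

lemma ConD:
  assumes "partial_prelattice P" "\<theta> \<in> Con P"
  shows Con_subset: "\<theta> \<subseteq> pcarrier P \<times> pcarrier P"
    and Con_ple: "ple P \<subseteq> \<theta>"
    and Con_refl: "x \<in> pcarrier P \<Longrightarrow> (x, x) \<in> \<theta>"
    and Con_trans: "(x, y) \<in> \<theta> \<Longrightarrow> (y, z) \<in> \<theta> \<Longrightarrow> (x, z) \<in> \<theta>"
    and Con_join: "pjoin P X = Some a \<Longrightarrow> b \<in> pcarrier P \<Longrightarrow> (\<And>x. x \<in> X \<Longrightarrow> (x, b) \<in> \<theta>) \<Longrightarrow> (a, b) \<in> \<theta>"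
    and Con_meet: "pmeet P X = Some a \<Longrightarrow> b \<in> pcarrier P \<Longrightarrow> (\<And>x. x \<in> X \<Longrightarrow> (b, x) \<in> \<theta>) \<Longrightarrow> (b, a) \<in> \<theta>"
  using assms(2) unfolding Con_iff[OF assms(1)] preorder_on_iff by blast+

lemma ConI:
  assumes P: "partial_prelattice P" and sub: "\<theta> \<subseteq> pcarrier P \<times> pcarrier P" and ple: "ple P \<subseteq> \<theta>"
    and "\<And>x y z. (x, y) \<in> \<theta> \<Longrightarrow> (y, z) \<in> \<theta> \<Longrightarrow> (x, z) \<in> \<theta>"
    and "\<And>X a b. pjoin P X = Some a \<Longrightarrow> b \<in> pcarrier P \<Longrightarrow> \<forall>x\<in>X. (x, b) \<in> \<theta> \<Longrightarrow> (a, b) \<in> \<theta>"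
    and "\<And>X a b. pmeet P X = Some a \<Longrightarrow> b \<in> pcarrier P \<Longrightarrow> \<forall>x\<in>X. (b, x) \<in> \<theta> \<Longrightarrow> (b, a) \<in> \<theta>"
  shows "\<theta> \<in> Con P"
proof -
  have "(x, x) \<in> \<theta>" if "x \<in> pcarrier P" for x
    using P ple that by (auto simp: partial_prelattice_def preorder_on_iff)
  then show ?thesis
    unfolding Con_iff[OF P] preorder_on_iff
    by (intro conjI ballI allI impI)
      ((rule sub | rule ple | assumption | erule (1) assms(4) | erule (2) assms(5) | erule (2) assms(6))+)
qed

lemma prelattice_preorder: "partial_prelattice P \<Longrightarrow> preorder_on (pcarrier P) (ple P)"
  by (simp add: partial_prelattice_def)

lemma prelattice_join:
  assumes "partial_prelattice P" "pjoin P X = Some a"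
  shows "X \<subseteq> pcarrier P" "finite X" "X \<noteq> {}" "a \<in> pcarrier P" "\<And>x. x \<in> X \<Longrightarrow> (x, a) \<in> ple P"
  using assms unfolding partial_prelattice_def nfin_def is_sup_def by blast+

lemma prelattice_meet:
  assumes "partial_prelattice P" "pmeet P X = Some a"
  shows "X \<subseteq> pcarrier P" "finite X" "X \<noteq> {}" "a \<in> pcarrier P" "\<And>x. x \<in> X \<Longrightarrow> (a, x) \<in> ple P"
  using assms unfolding partial_prelattice_def nfin_def is_inf_def by blast+

lemma ple_in_Con: "partial_prelattice P \<Longrightarrow> ple P \<in> Con P"
  by (simp add: Con_def)

lemma cg_least: "\<theta> \<in> Con P \<Longrightarrow> R \<subseteq> \<theta> \<Longrightarrow> cg P R \<subseteq> \<theta>"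
  by (auto simp: cg_def)

lemma cg_extensive: "R \<subseteq> cg P R"
  by (auto simp: cg_def)

section \<open>Generated congruences and compact congruences\<close>

lemma cg_in_Con:
  assumes P: "partial_prelattice P" and R: "R \<subseteq> pcarrier P \<times> pcarrier P"
  shows "cg P R \<in> Con P"
proof -
  have ple: "ple P \<subseteq> pcarrier P \<times> pcarrier P"
    using prelattice_preorder[OF P] by (simp add: preorder_on_iff)
  \<comment> \<open>The full relation is one of the congruences intersected in
    \<open>cg P R\<close>, which keeps the intersection inside the carrier.\<close>
  have "pcarrier P \<times> pcarrier P \<in> Con P"
    unfolding Con_iff[OF P] using ple prelattice_join(4)[OF P] prelattice_meet(4)[OF P]
    by (auto simp: preorder_on_iff)
  then have "cg P R \<subseteq> pcarrier P \<times> pcarrier P" using R by (rule cg_least)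
  then show ?thesis
  proof (rule ConI[OF P])
    show "ple P \<subseteq> cg P R" using Con_ple[OF P] by (auto simp: cg_def)
    show "(x, z) \<in> cg P R" if "(x, y) \<in> cg P R" "(y, z) \<in> cg P R" for x y z
      using Con_trans[OF P, of _ x y z] that by (simp add: cg_def)
    show "(a, b) \<in> cg P R"
      if "pjoin P X = Some a" "b \<in> pcarrier P" "\<forall>x\<in>X. (x, b) \<in> cg P R" for X a b
      using Con_join[OF P, of _ X a b] that by (simp add: cg_def)
    show "(b, a) \<in> cg P R"
      if "pmeet P X = Some a" "b \<in> pcarrier P" "\<forall>x\<in>X. (b, x) \<in> cg P R" for X a b
      using Con_meet[OF P, of _ X a b] that by (simp add: cg_def)
  qed
qed

lemma cg_subset_iff:
  assumes "partial_prelattice P" "\<theta> \<in> Con P"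
  shows "cg P R \<subseteq> \<theta> \<longleftrightarrow> R \<subseteq> \<theta>"
  using assms cg_least[of \<theta> P R] cg_extensive[of R P] by blast

lemma cg_Un:
  assumes P: "partial_prelattice P" and "R \<subseteq> pcarrier P \<times> pcarrier P" "S \<subseteq> pcarrier P \<times> pcarrier P"
  shows "cg P (cg P R \<union> cg P S) = cg P (R \<union> S)"
proof (rule subset_antisym)
  have "cg P (R \<union> S) \<in> Con P" using assms by (simp add: cg_in_Con)
  then show "cg P (cg P R \<union> cg P S) \<subseteq> cg P (R \<union> S)"
    using cg_subset_iff[OF P] cg_extensive[of "R \<union> S" P] by auto
  have "cg P R \<union> cg P S \<subseteq> pcarrier P \<times> pcarrier P"
    using assms by (simp add: Con_subset[OF P cg_in_Con[OF P]])
  then have "cg P (cg P R \<union> cg P S) \<in> Con P" by (rule cg_in_Con[OF P])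
  then show "cg P (R \<union> S) \<subseteq> cg P (cg P R \<union> cg P S)"
    using cg_extensive[of R P] cg_extensive[of S P] cg_extensive[of "cg P R \<union> cg P S" P]
    by (intro cg_least) auto
qed

lemma cg_Con: "\<theta> \<in> Con P \<Longrightarrow> cg P \<theta> = \<theta>"
  by (auto simp: cg_def)

lemma cg_empty: "partial_prelattice P \<Longrightarrow> cg P {} = ple P"
  by (rule subset_antisym) (auto intro!: cg_least ple_in_Con simp: cg_def Con_def)

lemma cg_mono: "R \<subseteq> S \<Longrightarrow> cg P R \<subseteq> cg P S"
  by (auto simp: cg_def)

text \<open>Every closure rule of congruences has finitely many premises, because partial operations
  apply to finite sets. So the pairs generated by finite subfamilies already form a congruence, and
  it contains every member of \<open>S\<close>.\<close>

lemma cg_Union_finite: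
  assumes P: "partial_prelattice P" and S: "S \<subseteq> Con P" and p: "p \<in> cg P (\<Union>S)"
  shows "\<exists>F \<subseteq> S. finite F \<and> p \<in> cg P (\<Union>F)"
proof -
  define \<theta> where "\<theta> = {q. \<exists>F. F \<subseteq> S \<and> finite F \<and> q \<in> cg P (\<Union>F)}"
  have \<theta>I: "q \<in> \<theta>" if "F \<subseteq> S" "finite F" "q \<in> cg P (\<Union>F)" for q F
    using that by (auto simp: \<theta>_def)
  have cgC: "cg P (\<Union>F) \<in> Con P" if "F \<subseteq> S" for F
  proof (rule cg_in_Con[OF P])
    show "\<Union>F \<subseteq> pcarrier P \<times> pcarrier P"
      using S that Con_subset[OF P] by (meson Sup_least subsetD)
  qed
  have fin: "\<exists>F. F \<subseteq> S \<and> finite F \<and> W \<subseteq> cg P (\<Union>F)" if "finite W" "W \<subseteq> \<theta>" for W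
    using that
  proof (induction W)
    case empty
    show ?case by (rule exI[of _ "{}"]) simp
  next
    case (insert w W)
    then obtain F where F: "F \<subseteq> S" "finite F" "W \<subseteq> cg P (\<Union>F)" by auto
    obtain G where G: "G \<subseteq> S" "finite G" "w \<in> cg P (\<Union>G)"
      using insert.prems by (auto simp: \<theta>_def)
    have "cg P (\<Union>F) \<subseteq> cg P (\<Union>(F \<union> G))" "cg P (\<Union>G) \<subseteq> cg P (\<Union>(F \<union> G))"
      by (rule cg_mono, simp)+
    then have "insert w W \<subseteq> cg P (\<Union>(F \<union> G))" using F(3) G(3) by blast
    then show ?case using F G by (intro exI[of _ "F \<union> G"]) simp
  qed
  have "\<theta> \<in> Con P"
  proof (rule ConI[OF P])
    show "ple P \<subseteq> \<theta>" using Con_ple[OF P cgC[of "{}"]] \<theta>I[of "{}"] by auto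
    show "\<theta> \<subseteq> pcarrier P \<times> pcarrier P"
    proof
      fix q assume "q \<in> \<theta>"
      then obtain F where "F \<subseteq> S" "q \<in> cg P (\<Union>F)" by (auto simp: \<theta>_def)
      then show "q \<in> pcarrier P \<times> pcarrier P" using Con_subset[OF P cgC] by blast
    qed
  next
    fix x y z assume "(x, y) \<in> \<theta>" "(y, z) \<in> \<theta>"
    then obtain F where F: "F \<subseteq> S" "finite F" "{(x, y), (y, z)} \<subseteq> cg P (\<Union>F)"
      using fin[of "{(x, y), (y, z)}"] by auto
    then have "(x, z) \<in> cg P (\<Union>F)" using Con_trans[OF P cgC[OF F(1)], of x y z] by simp
    then show "(x, z) \<in> \<theta>" using F \<theta>I by simp
  next
    fix X a b assume X: "pjoin P X = Some a" "b \<in> pcarrier P" "\<forall>x\<in>X. (x, b) \<in> \<theta>"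
    then obtain F where F: "F \<subseteq> S" "finite F" "(\<lambda>x. (x, b)) ` X \<subseteq> cg P (\<Union>F)"
      using fin[of "(\<lambda>x. (x, b)) ` X"] prelattice_join(2)[OF P X(1)] by auto
    then have "(a, b) \<in> cg P (\<Union>F)" using Con_join[OF P cgC[OF F(1)] X(1,2)] by auto
    then show "(a, b) \<in> \<theta>" using F \<theta>I by simp
  next
    fix X a b assume X: "pmeet P X = Some a" "b \<in> pcarrier P" "\<forall>x\<in>X. (b, x) \<in> \<theta>"
    then obtain F where F: "F \<subseteq> S" "finite F" "(\<lambda>x. (b, x)) ` X \<subseteq> cg P (\<Union>F)"
      using fin[of "(\<lambda>x. (b, x)) ` X"] prelattice_meet(2)[OF P X(1)] by auto
    then have "(b, a) \<in> cg P (\<Union>F)" using Con_meet[OF P cgC[OF F(1)] X(1,2)] by auto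
    then show "(b, a) \<in> \<theta>" using F \<theta>I by simp
  qed
  moreover have "\<Union>S \<subseteq> \<theta>"
  proof
    fix q assume "q \<in> \<Union>S"
    then obtain \<alpha> where "\<alpha> \<in> S" "q \<in> \<alpha>" by blast
    then show "q \<in> \<theta>" using \<theta>I[of "{\<alpha>}" q] cg_extensive[of \<alpha> P] by auto
  qed
  ultimately have "cg P (\<Union>S) \<subseteq> \<theta>" by (rule cg_least)
  then show ?thesis using p unfolding \<theta>_def by blast
qed

text \<open>Each of the finitely many generators needs only a finite part of \<open>S\<close>, by
  \<open>cg_Union_finite\<close>. Together with \<open>Con_c_finite\<close> this makes compact the
  same as finitely generated.\<close>

lemma cg_finite_in_Con_c:
  assumes P: "partial_prelattice P" and R: "finite R" "R \<subseteq> pcarrier P \<times> pcarrier P"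
  shows "cg P R \<in> Con_c P"
  unfolding Con_c_def
proof (intro CollectI conjI allI impI)
  show "cg P R \<in> Con P" using P R by (simp add: cg_in_Con)
  fix S assume S: "S \<subseteq> Con P" "cg P R \<subseteq> cg P (\<Union>S)"
  then have "\<exists>F \<subseteq> S. finite F \<and> p \<in> cg P (\<Union>F)" if "p \<in> R" for p
    using that cg_Union_finite[OF P S(1)] cg_extensive[of R P] by blast
  then obtain F where F: "\<And>p. p \<in> R \<Longrightarrow> F p \<subseteq> S \<and> finite (F p) \<and> p \<in> cg P (\<Union>(F p))"
    by metis
  define G where "G = (\<Union>p\<in>R. F p)"
  have G: "G \<subseteq> S" "finite G" using F R by (auto simp: G_def)
  have "R \<subseteq> cg P (\<Union>G)"
  proof
    fix p assume p: "p \<in> R"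
    then have "cg P (\<Union>(F p)) \<subseteq> cg P (\<Union>G)" by (intro cg_mono) (auto simp: G_def)
    then show "p \<in> cg P (\<Union>G)" using F p by blast
  qed
  moreover have "cg P (\<Union>G) \<in> Con P"
    using G S Con_subset[OF P] by (intro cg_in_Con[OF P] Union_least) blast
  ultimately have "cg P R \<subseteq> cg P (\<Union>G)" by (intro cg_least)
  then show "\<exists>F\<subseteq>S. finite F \<and> cg P R \<subseteq> cg P (\<Union>F)"
    using G by (intro exI[of _ G] conjI)
qed

text \<open>A congruence is the join of the principal congruences of its pairs; compactness leaves
  finitely many of them.\<close>

lemma Con_c_finite:
  assumes P: "partial_prelattice P" and \<theta>: "\<theta> \<in> Con_c P"
  obtains R where "finite R" "R \<subseteq> \<theta>" "\<theta> = cg P R"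
proof -
  have \<theta>C: "\<theta> \<in> Con P" using \<theta> by (simp add: Con_c_def)
  define S where "S = (\<lambda>p. cg P {p}) ` \<theta>"
  have S: "S \<subseteq> Con P"
    unfolding S_def using Con_subset[OF P \<theta>C] by (auto intro!: cg_in_Con[OF P])
  have "p \<in> cg P {p}" for p using cg_extensive[of "{p}" P] by simp
  then have "\<theta> \<subseteq> \<Union>S" unfolding S_def by blast
  then have "\<theta> \<subseteq> cg P (\<Union>S)" using cg_extensive by (rule subset_trans)
  then obtain F where F: "F \<subseteq> S" "finite F" "\<theta> \<subseteq> cg P (\<Union>F)"
    using \<theta> S unfolding Con_c_def by blast
  then obtain R where R: "R \<subseteq> \<theta>" "finite R" "F = (\<lambda>p. cg P {p}) ` R"
    unfolding S_def using finite_subset_image by metis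
  have RC: "cg P R \<in> Con P" using subset_trans[OF R(1) Con_subset[OF P \<theta>C]] by (rule cg_in_Con[OF P])
  have "cg P {p} \<subseteq> cg P R" if "p \<in> R" for p using that by (intro cg_mono) simp
  then have "\<Union>F \<subseteq> cg P R" unfolding R(3) by blast
  then have "\<theta> \<subseteq> cg P R" using subset_trans[OF F(3) cg_least[OF RC]] by simp
  then have "\<theta> = cg P R" using cg_least[OF \<theta>C R(1)] by (rule subset_antisym)
  then show thesis using that R(1,2) by simp
qed

section \<open>Measures\<close>

lemma measured_prelattice: "measured P \<mu> \<Longrightarrow> partial_prelattice P"
  by (simp add: measured_def is_partial_lattice_def)

text \<open>\<open>\<mu>\<close> preserves finite joins and \<open>H\<close> turns a join into a
  conjunction; the empty case is the clause on the zero congruence.\<close>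

lemma measured_cg_finite:
  assumes m: "measured P \<mu>" and H: "prime_ideal H"
    and "finite R" "R \<subseteq> pcarrier P \<times> pcarrier P"
  shows "H (\<mu> (cg P R)) \<longleftrightarrow> (\<forall>p\<in>R. H (\<mu> (cg P {p})))"
  using assms(3,4)
proof (induction R)
  case empty
  then show ?case
    using m H by (simp add: cg_empty measured_prelattice[OF m]) (simp add: measured_def prime_ideal_bot)
next
  case (insert p R)
  note P = measured_prelattice[OF m]
  have "cg P {p} \<in> Con_c P" "cg P R \<in> Con_c P"
    using insert by (auto intro: cg_finite_in_Con_c[OF P])
  then have "\<mu> (cg P (cg P {p} \<union> cg P R)) = sup (\<mu> (cg P {p})) (\<mu> (cg P R))"
    using m by (simp add: measured_def)
  moreover have "cg P (cg P {p} \<union> cg P R) = cg P (insert p R)"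
    using insert by (subst cg_Un[OF P]) auto
  ultimately show ?case using insert by (simp add: prime_ideal_sup[OF H])
qed

text \<open>For a measured \<open>P\<close>, the compact congruences with value in \<open>H\<close>
  form an ideal of \<open>Con_c P\<close>. Such ideals correspond to the elements of the algebraic
  lattice \<open>Con P\<close>, and this is the corresponding congruence.\<close>

definition kernel_at :: "'a partial_lattice \<Rightarrow> ('a rel \<Rightarrow> 'd) \<Rightarrow> ('d \<Rightarrow> bool) \<Rightarrow> 'a rel" where
  "kernel_at P \<mu> H = {(x, y). x \<in> pcarrier P \<and> y \<in> pcarrier P \<and> H (\<mu> (Theta_plus P x y))}"

lemma measured_mono:
  assumes m: "measured P \<mu>" and H: "prime_ideal H" and "\<alpha> \<in> Con_c P" "\<beta> \<in> Con_c P" "\<alpha> \<subseteq> \<beta>" "H (\<mu> \<beta>)"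
  shows "H (\<mu> \<alpha>)"
proof -
  have "\<alpha> \<union> \<beta> = \<beta>" "\<beta> \<in> Con P" using assms by (auto simp: Con_c_def)
  then have "\<mu> \<beta> = sup (\<mu> \<alpha>) (\<mu> \<beta>)" using m assms(3,4) cg_Con unfolding measured_def by metis
  then show ?thesis using assms(6) prime_ideal_sup[OF H] by metis
qed

text \<open>Handles all closure rules of congruences at once: \<open>H\<close> contains the value of
  \<open>cg P R\<close>, and \<open>Theta_plus P x y\<close> lies below
  \<open>cg P R\<close>.\<close>

lemma kernel_at_cg:
  assumes m: "measured P \<mu>" and H: "prime_ideal H"
    and R: "finite R" "R \<subseteq> kernel_at P \<mu> H" and xy: "(x, y) \<in> cg P R"
  shows "(x, y) \<in> kernel_at P \<mu> H"
proof -
  note P = measured_prelattice[OF m]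
  have RC: "R \<subseteq> pcarrier P \<times> pcarrier P" using R by (auto simp: kernel_at_def)
  have xyC: "x \<in> pcarrier P" "y \<in> pcarrier P"
    using Con_subset[OF P cg_in_Con[OF P RC]] xy by auto
  have "H (\<mu> (cg P R))" using R unfolding measured_cg_finite[OF m H R(1) RC] by (auto simp: kernel_at_def)
  then have "H (\<mu> (cg P {(x, y)}))"
    using xy xyC R RC by (intro measured_mono[OF m H _ _ _ \<open>H (\<mu> (cg P R))\<close>])
      (auto intro!: cg_finite_in_Con_c[OF P] cg_in_Con[OF P] intro: cg_least subsetD[OF cg_least])
  then show ?thesis using xyC by (simp add: kernel_at_def)
qed

lemma kernel_at_in_Con:
  assumes m: "measured P \<mu>" and H: "prime_ideal H"
  shows "kernel_at P \<mu> H \<in> Con P"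
proof -
  note P = measured_prelattice[OF m]
  let ?C = "pcarrier P"
  have sub: "kernel_at P \<mu> H \<subseteq> ?C \<times> ?C" by (auto simp: kernel_at_def)
  show ?thesis
  proof (rule ConI[OF P sub])
    show "ple P \<subseteq> kernel_at P \<mu> H"
      using kernel_at_cg[OF m H, of "{}"] by (auto simp: cg_empty[OF P])
  next
    fix x y z assume *: "(x, y) \<in> kernel_at P \<mu> H" "(y, z) \<in> kernel_at P \<mu> H"
    let ?R = "{(x, y), (y, z)}"
    have "cg P ?R \<in> Con P" using * sub by (intro cg_in_Con[OF P]) auto
    then have "(x, z) \<in> cg P ?R"
      using cg_extensive[of ?R P] by (intro Con_trans[OF P, of _ x y z]) auto
    then show "(x, z) \<in> kernel_at P \<mu> H"
      using * by (intro kernel_at_cg[OF m H, of ?R]) auto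
  next
    fix X a b assume X: "pjoin P X = Some a" "b \<in> ?C" "\<forall>x\<in>X. (x, b) \<in> kernel_at P \<mu> H"
    let ?R = "(\<lambda>x. (x, b)) ` X"
    have "cg P ?R \<in> Con P" using X sub by (intro cg_in_Con[OF P]) auto
    then have "(a, b) \<in> cg P ?R"
      using cg_extensive[of ?R P] by (intro Con_join[OF P _ X(1,2)]) auto
    then show "(a, b) \<in> kernel_at P \<mu> H"
      using prelattice_join(2)[OF P X(1)] X by (intro kernel_at_cg[OF m H, of ?R]) auto
  next
    fix X a b assume X: "pmeet P X = Some a" "b \<in> ?C" "\<forall>x\<in>X. (b, x) \<in> kernel_at P \<mu> H"
    let ?R = "(\<lambda>x. (b, x)) ` X"
    have "cg P ?R \<in> Con P" using X sub by (intro cg_in_Con[OF P]) auto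
    then have "(b, a) \<in> cg P ?R"
      using cg_extensive[of ?R P] by (intro Con_meet[OF P _ X(1,2)]) auto
    then show "(b, a) \<in> kernel_at P \<mu> H"
      using prelattice_meet(2)[OF P X(1)] X by (intro kernel_at_cg[OF m H, of ?R]) auto
  qed
qed

text \<open>Finitely many generators determine the value of \<open>\<alpha>\<close> at
  \<open>H\<close>. Hence \<open>\<mu>\<close> on compact congruences can be recovered from the
  orderings at all \<open>H\<close>.\<close>

lemma measure_iff_kernel_at:
  assumes m: "measured P \<mu>" and H: "prime_ideal H" and \<alpha>: "\<alpha> \<in> Con_c P"
  shows "H (\<mu> \<alpha>) \<longleftrightarrow> \<alpha> \<subseteq> kernel_at P \<mu> H"
proof -
  note P = measured_prelattice[OF m]
  obtain R where R: "finite R" "R \<subseteq> \<alpha>" "\<alpha> = cg P R" using Con_c_finite[OF P \<alpha>] .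
  have RC: "R \<subseteq> pcarrier P \<times> pcarrier P"
    using \<alpha> R Con_subset[OF P, of \<alpha>] unfolding Con_c_def by blast
  have "H (\<mu> \<alpha>) \<longleftrightarrow> R \<subseteq> kernel_at P \<mu> H"
    unfolding R(3) measured_cg_finite[OF m H R(1) RC] using RC by (auto simp: kernel_at_def)
  also have "\<dots> \<longleftrightarrow> \<alpha> \<subseteq> kernel_at P \<mu> H"
    unfolding R(3) by (simp add: cg_subset_iff[OF P kernel_at_in_Con[OF m H]])
  finally show ?thesis .
qed

section \<open>Congruences along homomorphisms\<close>

lemma Con_pullback:
  assumes P: "partial_prelattice P" and Q: "partial_prelattice Q" and h: "pl_hom P Q h" and \<theta>: "\<theta> \<in> Con Q"
  shows "{(x, y). x \<in> pcarrier P \<and> y \<in> pcarrier P \<and> (h x, h y) \<in> \<theta>} \<in> Con P"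
proof (rule ConI[OF P])
  have hC: "\<And>x. x \<in> pcarrier P \<Longrightarrow> h x \<in> pcarrier Q" using h by (auto simp: pl_hom_def)
  have "\<And>x y. (x, y) \<in> ple P \<Longrightarrow> (h x, h y) \<in> \<theta>"
    using h Con_ple[OF Q \<theta>] by (auto simp: pl_hom_def)
  then show "ple P \<subseteq> {(x, y). x \<in> pcarrier P \<and> y \<in> pcarrier P \<and> (h x, h y) \<in> \<theta>}"
    using Con_subset[OF P ple_in_Con[OF P]] by auto
  fix X a b
  show "(a, b) \<in> {(x, y). x \<in> pcarrier P \<and> y \<in> pcarrier P \<and> (h x, h y) \<in> \<theta>}"
    if "pjoin P X = Some a" "b \<in> pcarrier P"
      "\<forall>x\<in>X. (x, b) \<in> {(x, y). x \<in> pcarrier P \<and> y \<in> pcarrier P \<and> (h x, h y) \<in> \<theta>}"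
  proof -
    have "pjoin Q (h ` X) = Some (h a)" using h that(1) by (simp add: pl_hom_def)
    then have "(h a, h b) \<in> \<theta>"
      by (rule Con_join[OF Q \<theta> _ hC[OF that(2)]]) (use that(3) in auto)
    then show ?thesis using that(2) prelattice_join(4)[OF P that(1)] by simp
  qed
  show "(b, a) \<in> {(x, y). x \<in> pcarrier P \<and> y \<in> pcarrier P \<and> (h x, h y) \<in> \<theta>}"
    if "pmeet P X = Some a" "b \<in> pcarrier P"
      "\<forall>x\<in>X. (b, x) \<in> {(x, y). x \<in> pcarrier P \<and> y \<in> pcarrier P \<and> (h x, h y) \<in> \<theta>}"
  proof -
    have "pmeet Q (h ` X) = Some (h a)" using h that(1) by (simp add: pl_hom_def)
    then have "(h b, h a) \<in> \<theta>"
      by (rule Con_meet[OF Q \<theta> _ hC[OF that(2)]]) (use that(3) in auto)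
    then show ?thesis using that(2) prelattice_meet(4)[OF P that(1)] by simp
  qed
qed (use Con_trans[OF Q \<theta>] in auto)

text \<open>The pullback of the right-hand side is a congruence of \<open>P\<close> containing
  \<open>R\<close>, hence contains \<open>cg P R\<close>; so it is enough to map the
  generators.\<close>

lemma Con_c_map_cg:
  assumes P: "partial_prelattice P" and Q: "partial_prelattice Q" and h: "pl_hom P Q h"
    and R: "R \<subseteq> pcarrier P \<times> pcarrier P"
  shows "Con_c_map Q h (cg P R) = cg Q ((\<lambda>(x, y). (h x, h y)) ` R)"
proof (rule subset_antisym)
  let ?hR = "(\<lambda>(x, y). (h x, h y)) ` R"
  have "?hR \<subseteq> pcarrier Q \<times> pcarrier Q" using h R by (auto simp: pl_hom_def)
  then have C: "cg Q ?hR \<in> Con Q" by (rule cg_in_Con[OF Q])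
  have "R \<subseteq> {(x, y). x \<in> pcarrier P \<and> y \<in> pcarrier P \<and> (h x, h y) \<in> cg Q ?hR}"
    using R cg_extensive[of ?hR Q] by auto
  from cg_least[OF Con_pullback[OF P Q h C] this]
  show "Con_c_map Q h (cg P R) \<subseteq> cg Q ?hR"
    unfolding Con_c_map_def by (intro cg_least[OF C]) auto
  have "R \<subseteq> cg P R" by (rule cg_extensive)
  then show "cg Q ?hR \<subseteq> Con_c_map Q h (cg P R)"
    unfolding Con_c_map_def by (intro cg_mono) auto
qed

text \<open>Principal congruences go to principal congruences with the same value in
  \<open>D\<close>. Applied to \<open>f\<close> and \<open>g\<close>, this makes the two orderings
  induced on \<open>K\<close> at \<open>H\<close> equal.\<close>

lemma measured_hom_kernel_at:
  assumes mP: "measured P \<mu>" and mQ: "measured Q \<nu>" and h: "measured_hom P \<mu> Q \<nu> h"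
    and H: "prime_ideal H" and xy: "x \<in> pcarrier P" "y \<in> pcarrier P"
  shows "(h x, h y) \<in> kernel_at Q \<nu> H \<longleftrightarrow> (x, y) \<in> kernel_at P \<mu> H"
proof -
  note P = measured_prelattice[OF mP] and Q = measured_prelattice[OF mQ]
  have hom: "pl_hom P Q h" using h by (simp add: measured_hom_def)
  have "Theta_plus P x y \<in> Con_c P" using xy by (intro cg_finite_in_Con_c[OF P]) auto
  then have "\<nu> (Con_c_map Q h (Theta_plus P x y)) = \<mu> (Theta_plus P x y)"
    using h by (simp add: measured_hom_def)
  then have "\<nu> (Theta_plus Q (h x) (h y)) = \<mu> (Theta_plus P x y)"
    using xy Con_c_map_cg[OF P Q hom, of "{(x, y)}"] by simp
  then show ?thesis using hom xy by (auto simp: kernel_at_def pl_hom_def)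
qed


section \<open>Families of orderings indexed by prime ideals\<close>

text \<open>Empty ideals are allowed, since two elements may lack a common lower bound, and then no
  generator lies below the meet of their terms.\<close>

inductive_set ideal_span :: "'a set \<Rightarrow> ('a \<Rightarrow> 'a \<Rightarrow> bool) \<Rightarrow> ('a set \<Rightarrow> 'a option) \<Rightarrow> 'a set \<Rightarrow> 'a set"
  for C r J X where
  base: "x \<in> X \<Longrightarrow> x \<in> ideal_span C r J X"
| down: "y \<in> ideal_span C r J X \<Longrightarrow> x \<in> C \<Longrightarrow> r x y \<Longrightarrow> x \<in> ideal_span C r J X"
| join: "J Z = Some a \<Longrightarrow> (\<forall>z\<in>Z. z \<in> ideal_span C r J X) \<Longrightarrow> a \<in> ideal_span C r J X"

lemma ideal_span_minimal:
  assumes "X \<subseteq> I" "\<And>x y. y \<in> I \<Longrightarrow> x \<in> C \<Longrightarrow> r x y \<Longrightarrow> x \<in> I"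
    and "\<And>Z a. J Z = Some a \<Longrightarrow> Z \<subseteq> I \<Longrightarrow> a \<in> I"
  shows "ideal_span C r J X \<subseteq> I"
proof
  fix x assume "x \<in> ideal_span C r J X"
  then show "x \<in> I"
  proof induction
    case (join Z a)
    then show ?case using assms(3)[of Z a] by auto
  qed (use assms(1,2) in auto)
qed

lemma ideal_span_least:
  assumes "X \<subseteq> ideal_span C r J Y"
  shows "ideal_span C r J X \<subseteq> ideal_span C r J Y"
  using assms by (rule ideal_span_minimal) (auto intro: ideal_span.intros)

lemma ideal_span_mono: "X \<subseteq> Y \<Longrightarrow> ideal_span C r J X \<subseteq> ideal_span C r J Y"
  by (rule ideal_span_least) (auto intro: ideal_span.base)

text \<open>The join half of a partial prelattice whose ordering varies with a prime ideal, together with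
  the finiteness conditions that make its ideals definable uniformly in the prime ideal. The meet half
  is the same locale for the converse orderings.\<close>

locale uniform_family =
  fixes C :: "'a set" and le :: "('d::{distrib_lattice,order_bot} \<Rightarrow> bool) \<Rightarrow> 'a \<Rightarrow> 'a \<Rightarrow> bool"
    and J :: "'a set \<Rightarrow> 'a option"
  assumes le_refl: "prime_ideal H \<Longrightarrow> x \<in> C \<Longrightarrow> le H x x"
    and le_trans: "prime_ideal H \<Longrightarrow> x \<in> C \<Longrightarrow> y \<in> C \<Longrightarrow> z \<in> C \<Longrightarrow> le H x y \<Longrightarrow> le H y z \<Longrightarrow> le H x z"
    and le_True: "x \<in> C \<Longrightarrow> y \<in> C \<Longrightarrow> le (\<lambda>_. True) x y"
    and le_definable: "x \<in> C \<Longrightarrow> y \<in> C \<Longrightarrow> definable (\<lambda>H. le H x y)"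
    and J_nfin: "J X = Some a \<Longrightarrow> X \<in> nfin C"
    and J_in: "J X = Some a \<Longrightarrow> a \<in> C"
    and J_upper: "prime_ideal H \<Longrightarrow> J X = Some a \<Longrightarrow> x \<in> X \<Longrightarrow> le H x a"
    and J_least: "prime_ideal H \<Longrightarrow> J X = Some a \<Longrightarrow> b \<in> C \<Longrightarrow> (\<And>x. x \<in> X \<Longrightarrow> le H x b) \<Longrightarrow> le H a b"
    and cap: "a \<in> C \<Longrightarrow> b \<in> C \<Longrightarrow> \<exists>U. finite U \<and> U \<subseteq> C \<and>
      (\<forall>H x. prime_ideal H \<longrightarrow> x \<in> C \<longrightarrow> le H x a \<longrightarrow> le H x b \<longrightarrow> (\<exists>u\<in>U. le H x u \<and> le H u a \<and> le H u b))"
    and span_fg: "finite X \<Longrightarrow> X \<subseteq> C \<Longrightarrow> \<exists>U. finite U \<and> U \<subseteq> C \<and>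
      (\<forall>H x. prime_ideal H \<longrightarrow> x \<in> ideal_span C (le H) J X \<longrightarrow> (\<exists>u\<in>U. le H x u \<and> u \<in> ideal_span C (le H) J X))"
    and span_definable: "finite X \<Longrightarrow> X \<subseteq> C \<Longrightarrow> x \<in> C \<Longrightarrow> definable (\<lambda>H. x \<in> ideal_span C (le H) J X)"
begin

lemma span_subset:
  assumes "X \<subseteq> C"
  shows "ideal_span C (le H) J X \<subseteq> C"
  using assms by (rule ideal_span_minimal) (auto dest: J_in)

end


section \<open>Whitman's ordering of lattice terms over a partial lattice\<close>

text \<open>The value of the term in the lattice of ideals of \<open>C\<close>. By
  \<open>tle_Gen_iff\<close> it consists of the generators below the term.\<close>

primrec low :: "'a set \<Rightarrow> ('a \<Rightarrow> 'a \<Rightarrow> bool) \<Rightarrow> ('a set \<Rightarrow> 'a option) \<Rightarrow> 'a lterm \<Rightarrow> 'a set" where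
  "low C r J (Gen y) = {x \<in> C. r x y}"
| "low C r J (TJoin s t) = ideal_span C r J (low C r J s \<union> low C r J t)"
| "low C r J (TMeet s t) = low C r J s \<inter> low C r J t"

primrec tdual :: "'a lterm \<Rightarrow> 'a lterm" where
  "tdual (Gen y) = Gen y"
| "tdual (TJoin s t) = TMeet (tdual s) (tdual t)"
| "tdual (TMeet s t) = TJoin (tdual s) (tdual t)"

lemma tdual_tdual [simp]: "tdual (tdual t) = t"
  by (induction t) auto

lemma set_tdual [simp]: "set_lterm (tdual t) = set_lterm t"
  by (induction t) auto

text \<open>Upper sets are \<open>low\<close> for the converse ordering and the dual term, so that
  every fact about ideals yields the one about filters by instantiation.\<close>

abbreviation upp :: "'a set \<Rightarrow> ('a \<Rightarrow> 'a \<Rightarrow> bool) \<Rightarrow> ('a set \<Rightarrow> 'a option) \<Rightarrow> 'a lterm \<Rightarrow> 'a set" where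
  "upp C r M t \<equiv> low C (\<lambda>x y. r y x) M (tdual t)"

text \<open>A cut-free presentation of Whitman's ordering: rule \<open>mid\<close> interpolates an element of the
  partial lattice, the other rules decompose one of the terms. Transitivity becomes a theorem, and each
  instance reduces to finitely many instances for smaller terms, which makes the ordering definable.\<close>

inductive tle :: "'a set \<Rightarrow> ('a \<Rightarrow> 'a \<Rightarrow> bool) \<Rightarrow> ('a set \<Rightarrow> 'a option) \<Rightarrow> ('a set \<Rightarrow> 'a option) \<Rightarrow>
    'a lterm \<Rightarrow> 'a lterm \<Rightarrow> bool"
  for C r J M where
  mid: "x \<in> upp C r M s \<Longrightarrow> x \<in> low C r J t \<Longrightarrow> tle C r J M s t"
| join_left: "tle C r J M s u \<Longrightarrow> tle C r J M t u \<Longrightarrow> tle C r J M (TJoin s t) u"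
| meet_left1: "tle C r J M s u \<Longrightarrow> tle C r J M (TMeet s t) u"
| meet_left2: "tle C r J M t u \<Longrightarrow> tle C r J M (TMeet s t) u"
| join_right1: "tle C r J M s t \<Longrightarrow> tle C r J M s (TJoin t u)"
| join_right2: "tle C r J M s u \<Longrightarrow> tle C r J M s (TJoin t u)"
| meet_right: "tle C r J M s t \<Longrightarrow> tle C r J M s u \<Longrightarrow> tle C r J M s (TMeet t u)"

lemma tle_tdual_imp: "tle C r J M s t \<Longrightarrow> tle C (\<lambda>x y. r y x) M J (tdual t) (tdual s)"
  by (induction rule: tle.induct) (auto intro: tle.intros)

lemma tle_tdual: "tle C (\<lambda>x y. r y x) M J (tdual t) (tdual s) \<longleftrightarrow> tle C r J M s t"
  using tle_tdual_imp[of C r J M s t] tle_tdual_imp[of C "\<lambda>x y. r y x" M J "tdual t" "tdual s"] by auto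

text \<open>Whitman's condition for a join on the left: every rule that can end in such a
  comparison, including \<open>mid\<close>, descends to both components.\<close>

lemma tle_join_left_iff: "tle C r J M (TJoin s t) u \<longleftrightarrow> tle C r J M s u \<and> tle C r J M t u"
proof
  show "tle C r J M s u \<and> tle C r J M t u" if "tle C r J M (TJoin s t) u"
    using that by (induction "TJoin s t" u rule: tle.induct) (auto intro: tle.intros)
qed (auto intro: tle.intros)

lemma tle_meet_right_iff: "tle C r J M u (TMeet s t) \<longleftrightarrow> tle C r J M u s \<and> tle C r J M u t"
  using tle_join_left_iff[of C "\<lambda>x y. r y x" M J "tdual s" "tdual t" "tdual u"]
  by (simp add: tle_tdual flip: tdual.simps)

context uniform_family
begin

lemma low_subset: "low C (le H) J t \<subseteq> C"
  by (induction t) (auto dest: subsetD[OF span_subset, rotated])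

lemma low_down:
  assumes "prime_ideal H" "set_lterm t \<subseteq> C"
  shows "y \<in> low C (le H) J t \<Longrightarrow> x \<in> C \<Longrightarrow> le H x y \<Longrightarrow> x \<in> low C (le H) J t"
  using assms(2) by (induction t) (auto intro: ideal_span.down le_trans[OF assms(1)])

lemma low_join:
  assumes "prime_ideal H" "set_lterm t \<subseteq> C" "J Z = Some a"
  shows "Z \<subseteq> low C (le H) J t \<Longrightarrow> a \<in> low C (le H) J t"
  using assms(2)
proof (induction t)
  case (Gen x)
  then show ?case using J_least[OF assms(1,3)] J_in[OF assms(3)] by auto
next
  case (TJoin s t)
  then show ?case by (auto intro: ideal_span.join[of J, OF assms(3)])
qed auto

lemma low_minimal:
  assumes "prime_ideal H" "set_lterm t \<subseteq> C" "X \<subseteq> low C (le H) J t"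
  shows "ideal_span C (le H) J X \<subseteq> low C (le H) J t"
  using assms(3) low_down[OF assms(1,2)] low_join[OF assms(1,2)] by (rule ideal_span_minimal)

lemma low_True: "set_lterm t \<subseteq> C \<Longrightarrow> low C (le (\<lambda>_. True)) J t = C"
proof (induction t)
  case (Gen y)
  then show ?case using le_True by auto
next
  case (TJoin s t)
  then show ?case using span_subset[of C "\<lambda>_. True"] by (auto intro: ideal_span.base)
qed auto

text \<open>The two claims need a common induction. For a join, the generating set of the ideal is
  infinite and varies with \<open>H\<close>; only the finite sets \<open>U\<close> and
  \<open>V\<close>, which do not depend on \<open>H\<close>, make membership expressible. New
  generators come from \<open>cap\<close> for meets and from \<open>span_fg\<close> for
  joins.\<close>

lemma low_definable_fg:
  assumes "set_lterm t \<subseteq> C"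
  shows "(\<forall>x\<in>C. definable (\<lambda>H. x \<in> low C (le H) J t)) \<and>
    (\<exists>U. finite U \<and> U \<subseteq> C \<and>
      (\<forall>H x. prime_ideal H \<longrightarrow> x \<in> low C (le H) J t \<longrightarrow> (\<exists>u\<in>U. le H x u \<and> u \<in> low C (le H) J t)))"
  using assms
proof (induction t)
  case (Gen y)
  then show ?case
    by (auto intro!: le_definable exI[of _ "{y}"] le_refl)
next
  case (TMeet s t)
  then have def: "\<forall>x\<in>C. definable (\<lambda>H. x \<in> low C (le H) J s)" "\<forall>x\<in>C. definable (\<lambda>H. x \<in> low C (le H) J t)"
    and sub: "set_lterm s \<subseteq> C" "set_lterm t \<subseteq> C" by auto
  obtain U where U: "finite U" "U \<subseteq> C"
    "\<And>H x. prime_ideal H \<Longrightarrow> x \<in> low C (le H) J s \<Longrightarrow> \<exists>u\<in>U. le H x u \<and> u \<in> low C (le H) J s"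
    using TMeet by auto
  obtain V where V: "finite V" "V \<subseteq> C"
    "\<And>H x. prime_ideal H \<Longrightarrow> x \<in> low C (le H) J t \<Longrightarrow> \<exists>u\<in>V. le H x u \<and> u \<in> low C (le H) J t"
    using TMeet by auto
  \<comment> \<open>An element of both ideals lies below some u in \<open>U\<close> and some v in
    \<open>V\<close>, so generators for the finitely many intersections of principal ideals
    suffice.\<close>
  have "\<forall>p\<in>U \<times> V. \<exists>W. finite W \<and> W \<subseteq> C \<and>
      (\<forall>H x. prime_ideal H \<longrightarrow> x \<in> C \<longrightarrow> le H x (fst p) \<longrightarrow> le H x (snd p) \<longrightarrow>
        (\<exists>u\<in>W. le H x u \<and> le H u (fst p) \<and> le H u (snd p)))"
    using U(2) V(2) by (intro ballI cap) auto
  then obtain W where W: "\<forall>p\<in>U \<times> V. finite (W p) \<and> W p \<subseteq> C \<and>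
      (\<forall>H x. prime_ideal H \<longrightarrow> x \<in> C \<longrightarrow> le H x (fst p) \<longrightarrow> le H x (snd p) \<longrightarrow>
        (\<exists>u\<in>W p. le H x u \<and> le H u (fst p) \<and> le H u (snd p)))"
    unfolding bchoice_iff by blast
  have e: "\<exists>w\<in>\<Union>(W ` (U \<times> V)). le H x w \<and> w \<in> low C (le H) J (TMeet s t)"
    if H: "prime_ideal H" and x: "x \<in> low C (le H) J (TMeet s t)" for H x
  proof -
    obtain u where u: "u \<in> U" "le H x u" "u \<in> low C (le H) J s" using U(3)[OF H, of x] x by auto
    obtain v where v: "v \<in> V" "le H x v" "v \<in> low C (le H) J t" using V(3)[OF H, of x] x by auto
    have "x \<in> C" using x low_subset by blast
    moreover have uv: "(u, v) \<in> U \<times> V" using u v by simp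
    ultimately obtain w where w: "w \<in> W (u, v)" "le H x w" "le H w u" "le H w v"
      using W[THEN bspec, OF uv, THEN conjunct2, THEN conjunct2, rule_format, of H x] H u(2) v(2) by auto
    then have "w \<in> C" using W uv by blast
    then have "w \<in> low C (le H) J (TMeet s t)"
      using low_down[OF H sub(1) u(3)] low_down[OF H sub(2) v(3)] w by simp
    then show ?thesis using w uv by blast
  qed
  have f: "finite (\<Union>(W ` (U \<times> V)))" "\<Union>(W ` (U \<times> V)) \<subseteq> C"
    using W U(1) V(1) by (auto 0 3)
  have d: "definable (\<lambda>H. x \<in> low C (le H) J (TMeet s t))" if "x \<in> C" for x
    using def that by (auto intro!: definable_conj)
  show ?case
    by (intro conjI ballI exI[of _ "\<Union>(W ` (U \<times> V))"] allI impI) (erule d | rule f | erule (1) e)+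
next
  case (TJoin s t)
  let ?L = "\<lambda>H. low C (le H) J s \<union> low C (le H) J t"
  have def: "definable (\<lambda>H. x \<in> ?L H)" if "x \<in> C" for x
    using TJoin that by (auto intro!: definable_disj)
  obtain U where U: "finite U" "U \<subseteq> C"
    "\<And>H x. prime_ideal H \<Longrightarrow> x \<in> low C (le H) J s \<Longrightarrow> \<exists>u\<in>U. le H x u \<and> u \<in> low C (le H) J s"
    using TJoin by auto
  obtain V where V: "finite V" "V \<subseteq> C"
    "\<And>H x. prime_ideal H \<Longrightarrow> x \<in> low C (le H) J t \<Longrightarrow> \<exists>u\<in>V. le H x u \<and> u \<in> low C (le H) J t"
    using TJoin by auto
  define X where "X = U \<union> V"
  have X: "finite X" "X \<subseteq> C" using U V by (auto simp: X_def)
  \<comment> \<open>At \<open>H\<close>, the members of \<open>X\<close> lying in one of the two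
    ideals generate the same ideal. Letting \<open>Y\<close> range over all subsets of
    \<open>X\<close> turns the dependence on \<open>H\<close> into a finite disjunction.\<close>
  have eq: "x \<in> ideal_span C (le H) J (?L H) \<longleftrightarrow>
      (\<exists>Y\<in>Pow X. (\<forall>u\<in>Y. u \<in> ?L H) \<and> x \<in> ideal_span C (le H) J Y)" if H: "prime_ideal H" for H x
  proof
    assume x: "x \<in> ideal_span C (le H) J (?L H)"
    have "?L H \<subseteq> ideal_span C (le H) J {u \<in> X. u \<in> ?L H}"
    proof
      fix y assume y: "y \<in> ?L H"
      then obtain u where "u \<in> X" "le H y u" "u \<in> ?L H"
        using U(3)[OF H, of y] V(3)[OF H, of y] unfolding X_def by blast
      moreover have "y \<in> C" using y low_subset by blast
      ultimately show "y \<in> ideal_span C (le H) J {u \<in> X. u \<in> ?L H}"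
        by (intro ideal_span.down[OF ideal_span.base, of u]) auto
    qed
    from ideal_span_least[OF this] x
    show "\<exists>Y\<in>Pow X. (\<forall>u\<in>Y. u \<in> ?L H) \<and> x \<in> ideal_span C (le H) J Y"
      by (intro bexI[of _ "{u \<in> X. u \<in> ?L H}"]) auto
  next
    assume "\<exists>Y\<in>Pow X. (\<forall>u\<in>Y. u \<in> ?L H) \<and> x \<in> ideal_span C (le H) J Y"
    then obtain Y where "Y \<subseteq> ?L H" "x \<in> ideal_span C (le H) J Y" by blast
    then show "x \<in> ideal_span C (le H) J (?L H)" using ideal_span_mono by blast
  qed
  have d: "definable (\<lambda>H. x \<in> low C (le H) J (TJoin s t))" if x: "x \<in> C" for x
  proof -
    have "definable (\<lambda>H. \<exists>Y\<in>Pow X. (\<forall>u\<in>Y. u \<in> ?L H) \<and> x \<in> ideal_span C (le H) J Y)"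
      using X x def
      by (intro definable_Bex definable_conj definable_Ball span_definable) (auto dest: finite_subset)
    then show ?thesis unfolding low.simps by (rule iffD2[OF definable_cong, rotated]) (rule eq)
  qed
  have "\<forall>Y\<in>Pow X. \<exists>W. finite W \<and> W \<subseteq> C \<and>
      (\<forall>H x. prime_ideal H \<longrightarrow> x \<in> ideal_span C (le H) J Y \<longrightarrow> (\<exists>u\<in>W. le H x u \<and> u \<in> ideal_span C (le H) J Y))"
    using X by (intro ballI span_fg) (auto dest: finite_subset)
  then obtain W where W: "\<forall>Y\<in>Pow X. finite (W Y) \<and> W Y \<subseteq> C \<and>
      (\<forall>H x. prime_ideal H \<longrightarrow> x \<in> ideal_span C (le H) J Y \<longrightarrow> (\<exists>u\<in>W Y. le H x u \<and> u \<in> ideal_span C (le H) J Y))"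
    unfolding bchoice_iff by blast
  have e: "\<exists>w\<in>\<Union>(W ` Pow X). le H x w \<and> w \<in> low C (le H) J (TJoin s t)"
    if H: "prime_ideal H" and x: "x \<in> low C (le H) J (TJoin s t)" for H x
  proof -
    obtain Y where Y: "Y \<in> Pow X" "\<forall>u\<in>Y. u \<in> ?L H" "x \<in> ideal_span C (le H) J Y"
      using x eq[OF H, of x] by auto
    then obtain w where w: "w \<in> W Y" "le H x w" "w \<in> ideal_span C (le H) J Y"
      using W H by blast
    then have "w \<in> low C (le H) J (TJoin s t)" using eq[OF H, of w] Y by auto
    then show ?thesis using w Y(1) by blast
  qed
  have f: "finite (\<Union>(W ` Pow X))" "\<Union>(W ` Pow X) \<subseteq> C"
    using W X(1) by (auto 0 3)
  show ?case
    by (intro conjI ballI exI[of _ "\<Union>(W ` Pow X)"] allI impI) (erule d | rule f | erule (1) e)+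
qed

end

locale uniform_pair = uniform_family C le J + dual: uniform_family C "\<lambda>H x y. le H y x" M
  for C :: "'a set" and le :: "('d::{distrib_lattice,order_bot} \<Rightarrow> bool) \<Rightarrow> 'a \<Rightarrow> 'a \<Rightarrow> bool" and J M
begin

abbreviation tle_at :: "('d \<Rightarrow> bool) \<Rightarrow> 'a lterm \<Rightarrow> 'a lterm \<Rightarrow> bool" where
  "tle_at H \<equiv> tle C (le H) J M"

lemma uniform_pair_dual: "uniform_pair C (\<lambda>H x y. le H y x) M J"
  using uniform_family_axioms dual.uniform_family_axioms by (simp add: uniform_pair_def)

text \<open>If \<open>y\<close> lies above both components of a join, its principal ideal contains
  their lower sets and therefore the ideal these generate. Meets are dual.\<close>

lemma low_upp:
  assumes H: "prime_ideal H" and "set_lterm t \<subseteq> C"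
  shows "x \<in> low C (le H) J t \<Longrightarrow> y \<in> upp C (le H) M t \<Longrightarrow> le H x y"
  using assms(2)
proof (induction t arbitrary: x y)
  case (Gen z)
  then show ?case using le_trans[OF H] by auto
next
  case (TJoin s t)
  have y: "y \<in> upp C (le H) M s" "y \<in> upp C (le H) M t" using TJoin.prems(2) by simp_all
  then have "y \<in> C" using dual.low_subset by blast
  have sub: "set_lterm s \<subseteq> C" "set_lterm t \<subseteq> C" using TJoin.prems(3) by simp_all
  have "z \<in> low C (le H) J (Gen y)" if "z \<in> low C (le H) J s \<union> low C (le H) J t" for z
  proof -
    have "z \<in> C" using that low_subset by blast
    then show ?thesis using that TJoin.IH(1)[OF _ y(1) sub(1)] TJoin.IH(2)[OF _ y(2) sub(2)] by auto
  qed
  then have "ideal_span C (le H) J (low C (le H) J s \<union> low C (le H) J t) \<subseteq> low C (le H) J (Gen y)"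
    using \<open>y \<in> C\<close> by (intro low_minimal[OF H] subsetI) simp_all
  then show ?case using TJoin.prems(1) by auto
next
  case (TMeet s t)
  have x: "x \<in> low C (le H) J s" "x \<in> low C (le H) J t" using TMeet.prems(1) by simp_all
  then have "x \<in> C" using low_subset by blast
  have sub: "set_lterm s \<subseteq> C" "set_lterm t \<subseteq> C" using TMeet.prems(3) by simp_all
  have "z \<in> upp C (le H) M (Gen x)" if "z \<in> upp C (le H) M s \<union> upp C (le H) M t" for z
  proof -
    have "z \<in> C" using that dual.low_subset by blast
    then show ?thesis using that TMeet.IH(1)[OF x(1) _ sub(1)] TMeet.IH(2)[OF x(2) _ sub(2)] by auto
  qed
  then have "ideal_span C (\<lambda>x y. le H y x) M (upp C (le H) M s \<union> upp C (le H) M t) \<subseteq> upp C (le H) M (Gen x)"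
    using \<open>x \<in> C\<close> by (intro dual.low_minimal[OF H] subsetI) simp_all
  then show ?case using TMeet.prems(2) by auto
qed

text \<open>Soundness of the rules in the lattice of ideals, with \<open>low_upp\<close> behind the
  case \<open>mid\<close>. Together with \<open>upp_mono\<close> it carries interpolants through the
  proof of transitivity.\<close>

lemma low_mono:
  assumes H: "prime_ideal H" and "tle_at H s t"
  shows "set_lterm s \<subseteq> C \<Longrightarrow> set_lterm t \<subseteq> C \<Longrightarrow> low C (le H) J s \<subseteq> low C (le H) J t"
  using assms(2)
proof (induction rule: tle.induct)
  case (mid x s t)
  then show ?case
    using low_upp[OF H mid(3) _ mid(1)] low_down[OF H mid(4) mid(2)] low_subset[of H s] by auto
next
  case (join_left s u t)
  then show ?case using low_minimal[OF H, of u] by simp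
qed (auto intro: ideal_span.base)

lemma upp_mono:
  assumes "prime_ideal H" "tle_at H s t" "set_lterm s \<subseteq> C" "set_lterm t \<subseteq> C"
  shows "upp C (le H) M t \<subseteq> upp C (le H) M s"
  using uniform_pair.low_mono[OF uniform_pair_dual, of H "tdual t" "tdual s"] assms by (simp add: tle_tdual)

lemma tle_refl:
  assumes "prime_ideal H"
  shows "set_lterm t \<subseteq> C \<Longrightarrow> tle_at H t t"
proof (induction t)
  case (Gen x)
  then show ?case using le_refl[OF assms] by (intro tle.mid[of x]) auto
qed (auto intro: tle.intros)

lemma tle_Gen_iff:
  assumes "prime_ideal H" "x \<in> C" "set_lterm t \<subseteq> C"
  shows "tle_at H (Gen x) t \<longleftrightarrow> x \<in> low C (le H) J t"
proof
  show "x \<in> low C (le H) J t" if "tle_at H (Gen x) t"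
    using low_mono[OF assms(1) that] assms le_refl by auto
  show "tle_at H (Gen x) t" if "x \<in> low C (le H) J t"
    using that le_refl assms by (intro tle.mid[of x]) auto
qed

text \<open>Cut elimination by induction on the middle term. For a compound middle term, an inner
  induction runs over the derivation that may have chosen one of its components, while the other
  derivation splits by \<open>tle_join_left_iff\<close> or
  \<open>tle_meet_right_iff\<close>.\<close>

lemma tle_trans:
  assumes H: "prime_ideal H" and "set_lterm t \<subseteq> C"
  shows "set_lterm s \<subseteq> C \<Longrightarrow> set_lterm u \<subseteq> C \<Longrightarrow> tle_at H s t \<Longrightarrow> tle_at H t u \<Longrightarrow> tle_at H s u"
  using assms(2)
proof (induction t arbitrary: s u)
  case (Gen x)
  have "x \<in> low C (le H) J u" using Gen tle_Gen_iff[OF H, of x u] by simp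
  moreover have "x \<in> upp C (le H) M s"
    using upp_mono[OF H Gen(3)] Gen le_refl[OF H, of x] by auto
  ultimately show ?case by (intro tle.mid)
next
  case (TJoin t1 t2)
  have lu: "low C (le H) J (TJoin t1 t2) \<subseteq> low C (le H) J u"
    using TJoin.prems by (intro low_mono[OF H])
  have u: "tle_at H t1 u" "tle_at H t2 u" using TJoin.prems by (simp_all add: tle_join_left_iff)
  show ?case
    using TJoin.prems(3,1)
  proof (induction s "TJoin t1 t2" rule: tle.induct)
    case (mid x s)
    then show ?case using lu by (intro tle.mid[of x]) auto
  next
    case (join_right1 s)
    show ?case
      by (rule TJoin.IH(1)[OF join_right1(3) TJoin.prems(2) join_right1(1) u(1)]) (use TJoin.prems(5) in auto)
  next
    case (join_right2 s)
    show ?case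
      by (rule TJoin.IH(2)[OF join_right2(3) TJoin.prems(2) join_right2(1) u(2)]) (use TJoin.prems(5) in auto)
  qed (auto intro: tle.intros)
next
  case (TMeet t1 t2)
  have us: "upp C (le H) M (TMeet t1 t2) \<subseteq> upp C (le H) M s"
    using TMeet.prems by (intro upp_mono[OF H])
  have s: "tle_at H s t1" "tle_at H s t2" using TMeet.prems by (simp_all add: tle_meet_right_iff)
  show ?case
    using TMeet.prems(4,2)
  proof (induction "TMeet t1 t2" u rule: tle.induct)
    case (mid x u)
    then show ?case using us by (intro tle.mid[of x]) auto
  next
    case (meet_left1 u)
    show ?case
      by (rule TMeet.IH(1)[OF TMeet.prems(1) meet_left1(3) s(1) meet_left1(1)]) (use TMeet.prems(5) in auto)
  next
    case (meet_left2 u)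
    show ?case
      by (rule TMeet.IH(2)[OF TMeet.prems(1) meet_left2(3) s(2) meet_left2(1)]) (use TMeet.prems(5) in auto)
  qed (auto intro: tle.intros)
qed

lemma tle_Gen_Gen:
  assumes "prime_ideal H" "x \<in> C" "y \<in> C"
  shows "tle_at H (Gen x) (Gen y) \<longleftrightarrow> le H x y"
  using assms by (simp add: tle_Gen_iff)

lemma tle_Gen_join:
  assumes "prime_ideal H" "J X = Some a" "set_lterm t \<subseteq> C" "\<And>x. x \<in> X \<Longrightarrow> tle_at H (Gen x) t"
  shows "tle_at H (Gen a) t"
proof -
  have "X \<subseteq> low C (le H) J t"
  proof
    fix x assume x: "x \<in> X"
    then have "x \<in> C" using J_nfin[OF assms(2)] by (auto simp: nfin_def)
    then show "x \<in> low C (le H) J t" using assms(4)[OF x] tle_Gen_iff[OF assms(1) _ assms(3)] by blast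
  qed
  then show ?thesis
    using assms low_join[OF assms(1,3,2)] by (simp add: tle_Gen_iff J_in)
qed

lemma tle_Gen_meet:
  assumes "prime_ideal H" "M X = Some a" "set_lterm t \<subseteq> C" "\<And>x. x \<in> X \<Longrightarrow> tle_at H t (Gen x)"
  shows "tle_at H t (Gen a)"
  using uniform_pair.tle_Gen_join[OF uniform_pair_dual, of H X a "tdual t"] assms
    tle_tdual[of C "le H" M J "Gen _" t] by simp

text \<open>At the improper ideal all generators are equivalent, so any generator occurring in
  \<open>s\<close> interpolates. This supplies the second premise of
  \<open>definable_obtain\<close>.\<close>

lemma tle_True:
  assumes "set_lterm s \<subseteq> C" "set_lterm t \<subseteq> C"
  shows "tle_at (\<lambda>_. True) s t"
proof -
  obtain x where "x \<in> set_lterm s" by (induction s) auto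
  then have "x \<in> C" using assms by blast
  then show ?thesis
    using assms low_True[of t] dual.low_True[of "tdual s"] by (intro tle.mid[of x]) auto
qed

lemma tle_definable:
  assumes "set_lterm s \<subseteq> C" "set_lterm t \<subseteq> C"
  shows "definable (\<lambda>H. tle_at H s t)"
  using assms
proof (induction "size s + size t" arbitrary: s t rule: less_induct)
  case less
  obtain U where U: "finite U" "U \<subseteq> C"
    "\<And>H x. prime_ideal H \<Longrightarrow> x \<in> low C (le H) J t \<Longrightarrow> \<exists>u\<in>U. le H x u \<and> u \<in> low C (le H) J t"
    using low_definable_fg[OF less.prems(2)] by auto
  \<comment> \<open>An interpolant can be moved up to a generator of \<open>low\<close>, since
    \<open>upp\<close> is closed upwards. So the quantifier in rule \<open>mid\<close> may range
    over a finite set independent of \<open>H\<close>.\<close>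
  have eq: "(\<exists>x. x \<in> upp C (le H) M s \<and> x \<in> low C (le H) J t) \<longleftrightarrow>
      (\<exists>x\<in>U. x \<in> upp C (le H) M s \<and> x \<in> low C (le H) J t)" if H: "prime_ideal H" for H
  proof
    assume "\<exists>x. x \<in> upp C (le H) M s \<and> x \<in> low C (le H) J t"
    then obtain x where x: "x \<in> upp C (le H) M s" "x \<in> low C (le H) J t" by blast
    then obtain u where "u \<in> U" "le H x u" "u \<in> low C (le H) J t" using U(3)[OF H] by blast
    moreover have "u \<in> upp C (le H) M s"
      using dual.low_down[OF H, of "tdual s" x u] x less.prems \<open>u \<in> U\<close> U(2) \<open>le H x u\<close> by auto
    ultimately show "\<exists>x\<in>U. x \<in> upp C (le H) M s \<and> x \<in> low C (le H) J t" by blast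
  qed auto
  have "definable (\<lambda>H. \<exists>x\<in>U. x \<in> upp C (le H) M s \<and> x \<in> low C (le H) J t)"
    using U low_definable_fg[OF less.prems(2)] dual.low_definable_fg[of "tdual s"] less.prems
    by (intro definable_Bex definable_conj) auto
  then have d1: "definable (\<lambda>H. \<exists>x. x \<in> upp C (le H) M s \<and> x \<in> low C (le H) J t)"
    by (rule iffD2[OF definable_cong, rotated]) (rule eq)
  have d2: "definable (\<lambda>H. \<exists>s1 s2. s = TJoin s1 s2 \<and> tle_at H s1 t \<and> tle_at H s2 t)"
    using less by (cases s) (auto intro!: definable_conj simp: definable_False)
  have d3: "definable (\<lambda>H. \<exists>s1 s2. s = TMeet s1 s2 \<and> (tle_at H s1 t \<or> tle_at H s2 t))"
    using less by (cases s) (auto intro!: definable_disj simp: definable_False)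
  have d4: "definable (\<lambda>H. \<exists>t1 t2. t = TJoin t1 t2 \<and> (tle_at H s t1 \<or> tle_at H s t2))"
    using less by (cases t) (auto intro!: definable_disj simp: definable_False)
  have d5: "definable (\<lambda>H. \<exists>t1 t2. t = TMeet t1 t2 \<and> tle_at H s t1 \<and> tle_at H s t2)"
    using less by (cases t) (auto intro!: definable_conj simp: definable_False)
  have "tle_at H s t \<longleftrightarrow> (\<exists>x. x \<in> upp C (le H) M s \<and> x \<in> low C (le H) J t) \<or>
      (\<exists>s1 s2. s = TJoin s1 s2 \<and> tle_at H s1 t \<and> tle_at H s2 t) \<or>
      (\<exists>s1 s2. s = TMeet s1 s2 \<and> (tle_at H s1 t \<or> tle_at H s2 t)) \<or>
      (\<exists>t1 t2. t = TJoin t1 t2 \<and> (tle_at H s t1 \<or> tle_at H s t2)) \<or>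
      (\<exists>t1 t2. t = TMeet t1 t2 \<and> tle_at H s t1 \<and> tle_at H s t2)" for H
    by (subst tle.simps) auto
  then show ?case
    by (simp only:) (intro definable_disj d1 d2 d3 d4 d5)
qed

end


section \<open>Amalgamation over a finite lattice\<close>

text \<open>The two sides stay disjoint: \<open>f k\<close> and \<open>g k\<close> become equivalent
  but are not identified. Their identification is left to the classes of terms.\<close>

definition amal_le :: "'k set \<Rightarrow> ('k \<Rightarrow> 'p) \<Rightarrow> ('k \<Rightarrow> 'q) \<Rightarrow> ('p \<Rightarrow> 'p \<Rightarrow> bool) \<Rightarrow> ('q \<Rightarrow> 'q \<Rightarrow> bool) \<Rightarrow>
    'p + 'q \<Rightarrow> 'p + 'q \<Rightarrow> bool" where
  "amal_le K f g r s x y = (case x of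
      Inl p \<Rightarrow> (case y of Inl p' \<Rightarrow> r p p' | Inr q' \<Rightarrow> \<exists>k\<in>K. r p (f k) \<and> s (g k) q')
    | Inr q \<Rightarrow> (case y of Inl p' \<Rightarrow> \<exists>k\<in>K. s q (g k) \<and> r (f k) p' | Inr q' \<Rightarrow> s q q'))"

lemma amal_le_simps [simp]:
  "amal_le K f g r s (Inl p) (Inl p') \<longleftrightarrow> r p p'"
  "amal_le K f g r s (Inl p) (Inr q') \<longleftrightarrow> (\<exists>k\<in>K. r p (f k) \<and> s (g k) q')"
  "amal_le K f g r s (Inr q) (Inl p') \<longleftrightarrow> (\<exists>k\<in>K. s q (g k) \<and> r (f k) p')"
  "amal_le K f g r s (Inr q) (Inr q') \<longleftrightarrow> s q q'"
  by (simp_all add: amal_le_def)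

lemma amal_le_dual:
  "amal_le K f g (\<lambda>x y. r y x) (\<lambda>x y. s y x) = (\<lambda>x y. amal_le K f g r s y x)"
  by (auto simp: amal_le_def fun_eq_iff split: sum.split)

text \<open>No value is given to sets that meet both sides. The empty set counts as part of the left
  side, whence the premise of \<open>amal_op_Inr\<close>.\<close>

definition amal_op :: "('p set \<Rightarrow> 'p option) \<Rightarrow> ('q set \<Rightarrow> 'q option) \<Rightarrow> ('p + 'q) set \<Rightarrow> ('p + 'q) option" where
  "amal_op JP JQ X = (if X \<subseteq> range Inl then map_option Inl (JP (Inl -` X))
     else if X \<subseteq> range Inr then map_option Inr (JQ (Inr -` X)) else None)"

lemma amal_op_Inl: "amal_op JP JQ (Inl ` Z) = map_option Inl (JP Z)"
  by (simp add: amal_op_def image_subset_iff inj_vimage_image_eq)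

lemma amal_op_Inr: "Z \<noteq> {} \<Longrightarrow> amal_op JP JQ (Inr ` Z) = map_option Inr (JQ Z)"
  by (auto simp: amal_op_def image_subset_iff inj_vimage_image_eq)

lemma amal_op_cases:
  assumes "amal_op JP JQ X = Some a"
  obtains Z p where "X = Inl ` Z" "JP Z = Some p" "a = Inl p"
  | Z q where "X = Inr ` Z" "JQ Z = Some q" "a = Inr q"
proof (cases "X \<subseteq> range Inl")
  case True
  then have "X = Inl ` (Inl -` X)" by auto
  then show thesis using that(1)[of "Inl -` X"] assms True by (auto simp: amal_op_def)
next
  case False
  then have "X \<subseteq> range Inr" using assms by (auto simp: amal_op_def split: if_splits)
  then have "X = Inr ` (Inr -` X)" by auto
  then show thesis using that(2)[of "Inr -` X"] assms False \<open>X \<subseteq> range Inr\<close> by (auto simp: amal_op_def)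
qed

text \<open>The chain stops for good at its first repetition and can grow strictly at most
  \<open>card K\<close> times. The bound depends on \<open>K\<close> alone and hence serves all
  \<open>H\<close>.\<close>

lemma finite_chain_stable:
  fixes N :: "nat \<Rightarrow> 'a set"
  assumes "finite K" and sub: "\<And>n. N n \<subseteq> K" and incr: "\<And>n. N n \<subseteq> N (Suc n)"
    and stable: "\<And>n. N (Suc n) = N n \<Longrightarrow> N (Suc (Suc n)) = N (Suc n)"
  shows "N (Suc (card K)) = N (card K)"
proof (rule ccontr)
  assume neg: "N (Suc (card K)) \<noteq> N (card K)"
  have neq: "N (Suc n) \<noteq> N n" if "n \<le> card K" for n
    using that
  \<comment> \<open>Downward from \<open>card K\<close>: a repetition at \<open>n\<close> would
    persist at the next index by \<open>stable\<close>.\<close>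
  proof (induction rule: inc_induct)
    case base
    then show ?case using neg by simp
  next
    case (step n)
    then show ?case using stable[of n] by blast
  qed
  have "n \<le> card (N n)" if "n \<le> Suc (card K)" for n
    using that
  proof (induction n)
    case (Suc n)
    have "N n \<subset> N (Suc n)" using incr[of n] neq[of n] Suc.prems by auto
    then have "card (N n) < card (N (Suc n))"
      using sub assms(1) by (meson finite_subset psubset_card_mono)
    then show ?case using Suc by simp
  qed simp
  from this[of "Suc (card K)"] show False
    using card_mono[OF assms(1) sub[of "Suc (card K)"]] by simp
qed

text \<open>Only the join halves of the two sides enter, yet both operations of \<open>K\<close> do:
  \<open>K_join\<close> treats upper bounds on the opposite side in \<open>amal_J_least\<close>, and
  \<open>K_meet\<close> treats lower bounds from the opposite side in \<open>amal_cap\<close>. So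
  the locale also has an instance with all orderings reversed. The witness \<open>j\<close> is
  chosen before \<open>H\<close>.\<close>

locale amalgam = P: uniform_family CP leP JP + Q: uniform_family CQ leQ JQ
  for CP :: "'p set" and leP :: "('d::{distrib_lattice,order_bot} \<Rightarrow> bool) \<Rightarrow> 'p \<Rightarrow> 'p \<Rightarrow> bool" and JP
    and CQ :: "'q set" and leQ :: "('d \<Rightarrow> bool) \<Rightarrow> 'q \<Rightarrow> 'q \<Rightarrow> bool" and JQ +
  fixes K :: "'k set" and f :: "'k \<Rightarrow> 'p" and g :: "'k \<Rightarrow> 'q"
  assumes K_finite: "finite K" and K_nonempty: "K \<noteq> {}"
    and f_in: "k \<in> K \<Longrightarrow> f k \<in> CP" and g_in: "k \<in> K \<Longrightarrow> g k \<in> CQ"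
    and embed: "prime_ideal H \<Longrightarrow> k \<in> K \<Longrightarrow> l \<in> K \<Longrightarrow> leP H (f k) (f l) \<longleftrightarrow> leQ H (g k) (g l)"
    and K_join: "X \<subseteq> K \<Longrightarrow> X \<noteq> {} \<Longrightarrow> \<exists>j\<in>K. \<forall>H. prime_ideal H \<longrightarrow>
      (\<forall>x\<in>X. leP H (f x) (f j) \<and> leQ H (g x) (g j)) \<and>
      (\<forall>b\<in>CP. (\<forall>x\<in>X. leP H (f x) b) \<longrightarrow> leP H (f j) b) \<and>
      (\<forall>b\<in>CQ. (\<forall>x\<in>X. leQ H (g x) b) \<longrightarrow> leQ H (g j) b)"
    and K_meet: "X \<subseteq> K \<Longrightarrow> X \<noteq> {} \<Longrightarrow> \<exists>j\<in>K. \<forall>H. prime_ideal H \<longrightarrow>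
      (\<forall>x\<in>X. leP H (f j) (f x) \<and> leQ H (g j) (g x)) \<and>
      (\<forall>b\<in>CP. (\<forall>x\<in>X. leP H b (f x)) \<longrightarrow> leP H b (f j)) \<and>
      (\<forall>b\<in>CQ. (\<forall>x\<in>X. leQ H b (g x)) \<longrightarrow> leQ H b (g j))"
begin

abbreviation C where "C \<equiv> CP <+> CQ"
abbreviation le where "le H \<equiv> amal_le K f g (leP H) (leQ H)"
abbreviation J where "J \<equiv> amal_op JP JQ"
abbreviation spanP where "spanP H X \<equiv> ideal_span CP (leP H) JP X"
abbreviation spanQ where "spanQ H X \<equiv> ideal_span CQ (leQ H) JQ X"

section \<open>The amalgamated ordering and its partial joins\<close>

lemma amal_refl: "prime_ideal H \<Longrightarrow> x \<in> C \<Longrightarrow> le H x x"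
  by (auto simp: P.le_refl Q.le_refl)

text \<open>A path that leaves a side and returns passes through two elements of \<open>K\<close>.
  By \<open>embed\<close> they are comparable on one side exactly when they are on the other, so the
  detour can be cut short.\<close>

lemma amal_trans:
  assumes H: "prime_ideal H" and C: "x \<in> C" "y \<in> C" "z \<in> C" and le: "le H x y" "le H y z"
  shows "le H x z"
proof -
  note tP = P.le_trans[OF H] and tQ = Q.le_trans[OF H]
  show ?thesis
  proof (cases x; cases y; cases z)
    fix p q p' assume *: "x = Inl p" "y = Inr q" "z = Inl p'"
    then obtain k l where kl: "k \<in> K" "l \<in> K" "leP H p (f k)" "leQ H (g k) q" "leQ H q (g l)" "leP H (f l) p'"
      using le by auto
    have "leQ H (g k) (g l)" using tQ[OF _ _ _ kl(4,5)] C * kl g_in by auto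
    then have "leP H (f k) (f l)" using embed[OF H] kl by simp
    then have "leP H p (f l)" using tP[OF _ _ _ kl(3)] C * kl f_in by auto
    then show ?thesis using tP[OF _ _ _ _ kl(6), of p] C * kl f_in by auto
  next
    fix q p q' assume *: "x = Inr q" "y = Inl p" "z = Inr q'"
    then obtain k l where kl: "k \<in> K" "l \<in> K" "leQ H q (g k)" "leP H (f k) p" "leP H p (f l)" "leQ H (g l) q'"
      using le by auto
    have "leP H (f k) (f l)" using tP[OF _ _ _ kl(4,5)] C * kl f_in by auto
    then have "leQ H (g k) (g l)" using embed[OF H] kl by simp
    then have "leQ H q (g l)" using tQ[OF _ _ _ kl(3)] C * kl g_in by auto
    then show ?thesis using tQ[OF _ _ _ _ kl(6), of q] C * kl g_in by auto
  next
    fix p p' p'' assume "x = Inl p" "y = Inl p'" "z = Inl p''"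
    then show ?thesis using le C tP[of p p' p''] by auto
  next
    fix q q' q'' assume "x = Inr q" "y = Inr q'" "z = Inr q''"
    then show ?thesis using le C tQ[of q q' q''] by auto
  next
    fix p p' q assume *: "x = Inl p" "y = Inl p'" "z = Inr q"
    then obtain k where "k \<in> K" "leP H p' (f k)" "leQ H (g k) q" "leP H p p'" using le by auto
    then show ?thesis using * C f_in[of k] tP[of p p' "f k"] by auto
  next
    fix p q q' assume *: "x = Inl p" "y = Inr q" "z = Inr q'"
    then obtain k where "k \<in> K" "leP H p (f k)" "leQ H (g k) q" "leQ H q q'" using le by auto
    then show ?thesis using * C g_in[of k] tQ[of "g k" q q'] by auto
  next
    fix q q' p assume *: "x = Inr q" "y = Inr q'" "z = Inl p"
    then obtain k where "k \<in> K" "leQ H q q'" "leQ H q' (g k)" "leP H (f k) p" using le by auto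
    then show ?thesis using * C g_in[of k] tQ[of q q' "g k"] by auto
  next
    fix q p p' assume *: "x = Inr q" "y = Inl p" "z = Inl p'"
    then obtain k where "k \<in> K" "leQ H q (g k)" "leP H (f k) p" "leP H p p'" using le by auto
    then show ?thesis using * C f_in[of k] tP[of "f k" p p'] by auto
  qed
qed

lemma amal_J_nfin: "J X = Some a \<Longrightarrow> X \<in> nfin C"
  by (erule amal_op_cases; drule P.J_nfin Q.J_nfin; force simp: nfin_def)

lemma amal_J_in: "J X = Some a \<Longrightarrow> a \<in> C"
  by (erule amal_op_cases) (auto dest: P.J_in Q.J_in)

lemma amal_J_upper: "prime_ideal H \<Longrightarrow> J X = Some a \<Longrightarrow> x \<in> X \<Longrightarrow> le H x a"
  by (erule amal_op_cases) (auto intro: P.J_upper Q.J_upper)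

lemma amal_J_least:
  assumes H: "prime_ideal H" and J: "J X = Some a" and b: "b \<in> C" and le: "\<And>x. x \<in> X \<Longrightarrow> le H x b"
  shows "le H a b"
  using J
proof (cases rule: amal_op_cases)
  case (1 Z p)
  have Z: "Z \<subseteq> CP" "Z \<noteq> {}" using P.J_nfin[OF 1(2)] by (auto simp: nfin_def)
  have p: "p \<in> CP" using P.J_in[OF 1(2)] .
  show ?thesis
  proof (cases b)
    case (Inl b')
    have "leP H x b'" if "x \<in> Z" for x using le[of "Inl x"] that 1(1) Inl by simp
    then show ?thesis using 1 b Inl P.J_least[OF H 1(2), of b'] by auto
  next
    case (Inr b')
    then have b': "b' \<in> CQ" using b by auto
    \<comment> \<open>The bound lies on the other side, so each element of \<open>Z\<close> has its
      own interpolant; the join of these in \<open>K\<close> interpolates for all of them and hence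
      for \<open>p\<close>.\<close>
    have "\<forall>x\<in>Z. \<exists>k. k \<in> K \<and> leP H x (f k) \<and> leQ H (g k) b'" 
    proof
      fix x assume "x \<in> Z"
      then show "\<exists>k. k \<in> K \<and> leP H x (f k) \<and> leQ H (g k) b'" using le[of "Inl x"] 1(1) Inr by auto
    qed
    then obtain k where k: "\<forall>x\<in>Z. k x \<in> K \<and> leP H x (f (k x)) \<and> leQ H (g (k x)) b'" by metis
    then have "k ` Z \<subseteq> K" "k ` Z \<noteq> {}" using Z by auto
    from K_join[OF this] obtain j where j: "j \<in> K" "\<forall>x\<in>Z. leP H (f (k x)) (f j)"
      "(\<forall>x\<in>Z. leQ H (g (k x)) b') \<longrightarrow> leQ H (g j) b'" using H b' by auto
    have "leP H x (f j)" if "x \<in> Z" for x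
      using P.le_trans[OF H, of x "f (k x)" "f j"] that k j f_in Z(1) by auto
    then have "leP H p (f j)" using P.J_least[OF H 1(2), of "f j"] j f_in by blast
    then show ?thesis using 1 Inr j k by auto
  qed
next
  case (2 Z q)
  have Z: "Z \<subseteq> CQ" "Z \<noteq> {}" using Q.J_nfin[OF 2(2)] by (auto simp: nfin_def)
  have q: "q \<in> CQ" using Q.J_in[OF 2(2)] .
  show ?thesis
  proof (cases b)
    case (Inr b')
    have "leQ H x b'" if "x \<in> Z" for x using le[of "Inr x"] that 2(1) Inr by simp
    then show ?thesis using 2 b Inr Q.J_least[OF H 2(2), of b'] by auto
  next
    case (Inl b')
    then have b': "b' \<in> CP" using b by auto
    have "\<forall>x\<in>Z. \<exists>k. k \<in> K \<and> leQ H x (g k) \<and> leP H (f k) b'" 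
    proof
      fix x assume "x \<in> Z"
      then show "\<exists>k. k \<in> K \<and> leQ H x (g k) \<and> leP H (f k) b'" using le[of "Inr x"] 2(1) Inl by auto
    qed
    then obtain k where k: "\<forall>x\<in>Z. k x \<in> K \<and> leQ H x (g (k x)) \<and> leP H (f (k x)) b'" by metis
    then have "k ` Z \<subseteq> K" "k ` Z \<noteq> {}" using Z by auto
    from K_join[OF this] obtain j where j: "j \<in> K" "\<forall>x\<in>Z. leQ H (g (k x)) (g j)"
      "(\<forall>x\<in>Z. leP H (f (k x)) b') \<longrightarrow> leP H (f j) b'" using H b' by auto
    have "leQ H x (g j)" if "x \<in> Z" for x
      using Q.le_trans[OF H, of x "g (k x)" "g j"] that k j g_in Z(1) by auto
    then have qj: "leQ H q (g j)" using Q.J_least[OF H 2(2), of "g j"] j g_in by blast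
    then show ?thesis using 2 Inl j k by auto
  qed
qed

lemma amal_le_definable:
  assumes "x \<in> C" "y \<in> C"
  shows "definable (\<lambda>H. le H x y)"
  using assms K_finite f_in g_in
  by (cases x; cases y)
    (auto intro!: definable_Bex definable_conj P.le_definable Q.le_definable)

lemma amal_le_True: "x \<in> C \<Longrightarrow> y \<in> C \<Longrightarrow> le (\<lambda>_. True) x y"
  using K_nonempty f_in g_in P.le_True Q.le_True by (cases x; cases y) auto

section \<open>Intersections of principal ideals in the amalgam\<close>

lemma cap_P:
  assumes "a \<in> CP" "b \<in> CP"
  obtains U where "finite U" "U \<subseteq> CP"
    "\<And>H x. prime_ideal H \<Longrightarrow> x \<in> CP \<Longrightarrow> leP H x a \<Longrightarrow> leP H x b \<Longrightarrow> \<exists>u\<in>U. leP H x u \<and> leP H u a \<and> leP H u b"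
  using P.cap[OF assms] by blast

lemma cap_Q:
  assumes "a \<in> CQ" "b \<in> CQ"
  obtains U where "finite U" "U \<subseteq> CQ"
    "\<And>H x. prime_ideal H \<Longrightarrow> x \<in> CQ \<Longrightarrow> leQ H x a \<Longrightarrow> leQ H x b \<Longrightarrow> \<exists>u\<in>U. leQ H x u \<and> leQ H u a \<and> leQ H u b"
  using Q.cap[OF assms] by blast

lemma K_meet2:
  assumes "k \<in> K" "l \<in> K" "prime_ideal H"
  shows "\<exists>j\<in>K. leP H (f j) (f k) \<and> leP H (f j) (f l) \<and> leQ H (g j) (g k) \<and> leQ H (g j) (g l) \<and>
    (\<forall>b\<in>CP. leP H b (f k) \<longrightarrow> leP H b (f l) \<longrightarrow> leP H b (f j)) \<and>
    (\<forall>b\<in>CQ. leQ H b (g k) \<longrightarrow> leQ H b (g l) \<longrightarrow> leQ H b (g j))"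
  using K_meet[of "{k, l}"] assms by auto

abbreviation is_cap :: "'p + 'q \<Rightarrow> 'p + 'q \<Rightarrow> ('p + 'q) set \<Rightarrow> bool" where
  "is_cap a b U \<equiv> finite U \<and> U \<subseteq> C \<and>
      (\<forall>H x. prime_ideal H \<longrightarrow> x \<in> C \<longrightarrow> le H x a \<longrightarrow> le H x b \<longrightarrow> (\<exists>u\<in>U. le H x u \<and> le H u a \<and> le H u b))"

text \<open>An element of the other side reaches \<open>a\<close> and \<open>b\<close> through
  \<open>k\<close> and \<open>l\<close> in \<open>K\<close>, hence through their meet in
  \<open>K\<close>. So the image of \<open>K\<close> supplies the generators missing from
  \<open>P.cap\<close>.\<close>

lemma amal_cap_Inl_Inl:
  assumes ab: "a \<in> CP" "b \<in> CP"
  shows "\<exists>U. is_cap (Inl a) (Inl b) U"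
proof -
  obtain U where U: "finite U" "U \<subseteq> CP"
    "\<And>H x. prime_ideal H \<Longrightarrow> x \<in> CP \<Longrightarrow> leP H x a \<Longrightarrow> leP H x b \<Longrightarrow> \<exists>u\<in>U. leP H x u \<and> leP H u a \<and> leP H u b"
    using cap_P[OF ab] by blast
  let ?U = "Inl ` U \<union> Inr ` g ` K"
  have "\<exists>u\<in>?U. le H x u \<and> le H u (Inl a) \<and> le H u (Inl b)"
    if H: "prime_ideal H" and x: "x \<in> C" "le H x (Inl a)" "le H x (Inl b)" for H x
  proof (cases x)
    case (Inl p)
    then obtain u where "u \<in> U" "leP H p u \<and> leP H u a \<and> leP H u b" using U(3)[OF H, of p] x by auto
    then show ?thesis using Inl by (intro bexI[of _ "Inl u"]) auto
  next
    case (Inr q)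
    then obtain k l where kl: "k \<in> K" "l \<in> K" "leQ H q (g k)" "leP H (f k) a" "leQ H q (g l)" "leP H (f l) b"
      using x by auto
    from K_meet2[OF kl(1,2) H] obtain j where j: "j \<in> K" "leP H (f j) (f k)" "leP H (f j) (f l)"
      and "\<forall>b\<in>CQ. leQ H b (g k) \<longrightarrow> leQ H b (g l) \<longrightarrow> leQ H b (g j)" by fast
    then have qj: "leQ H q (g j)" using kl Inr x(1) by auto
    have "leP H (f j) a" "leP H (f j) b"
      using P.le_trans[OF H _ _ _ j(2) kl(4)] P.le_trans[OF H _ _ _ j(3) kl(6)] j kl ab f_in by auto
    moreover have "leQ H (g j) (g j)" using Q.le_refl[OF H] g_in j by blast
    ultimately show ?thesis using Inr j qj by (intro bexI[of _ "Inr (g j)"]) auto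
  qed
  moreover have "finite ?U" "?U \<subseteq> C" using U K_finite g_in by auto
  ultimately show ?thesis by (intro exI[of _ ?U]) blast
qed

lemma amal_cap_Inr_Inr:
  assumes ab: "a \<in> CQ" "b \<in> CQ"
  shows "\<exists>U. is_cap (Inr a) (Inr b) U"
proof -
  obtain U where U: "finite U" "U \<subseteq> CQ"
    "\<And>H x. prime_ideal H \<Longrightarrow> x \<in> CQ \<Longrightarrow> leQ H x a \<Longrightarrow> leQ H x b \<Longrightarrow> \<exists>u\<in>U. leQ H x u \<and> leQ H u a \<and> leQ H u b"
    using cap_Q[OF ab] by blast
  let ?U = "Inr ` U \<union> Inl ` f ` K"
  have "\<exists>u\<in>?U. le H x u \<and> le H u (Inr a) \<and> le H u (Inr b)"
    if H: "prime_ideal H" and x: "x \<in> C" "le H x (Inr a)" "le H x (Inr b)" for H x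
  proof (cases x)
    case (Inr q)
    then obtain u where "u \<in> U" "leQ H q u \<and> leQ H u a \<and> leQ H u b" using U(3)[OF H, of q] x by auto
    then show ?thesis using Inr by (intro bexI[of _ "Inr u"]) auto
  next
    case (Inl p)
    then obtain k l where kl: "k \<in> K" "l \<in> K" "leP H p (f k)" "leQ H (g k) a" "leP H p (f l)" "leQ H (g l) b"
      using x by auto
    from K_meet2[OF kl(1,2) H] obtain j where j: "j \<in> K" "leQ H (g j) (g k)" "leQ H (g j) (g l)"
      and "\<forall>b\<in>CP. leP H b (f k) \<longrightarrow> leP H b (f l) \<longrightarrow> leP H b (f j)" by fast
    then have pj: "leP H p (f j)" using kl Inl x(1) by auto
    have "leQ H (g j) a" "leQ H (g j) b"
      using Q.le_trans[OF H _ _ _ j(2) kl(4)] Q.le_trans[OF H _ _ _ j(3) kl(6)] j kl ab g_in by auto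
    moreover have "leP H (f j) (f j)" using P.le_refl[OF H] f_in j by blast
    ultimately show ?thesis using Inl j pj by (intro bexI[of _ "Inl (f j)"]) auto
  qed
  moreover have "finite ?U" "?U \<subseteq> C" using U K_finite f_in by auto
  ultimately show ?thesis by (intro exI[of _ ?U]) blast
qed

text \<open>An element of the left side is below \<open>b\<close> only through some
  \<open>f k\<close>, so \<open>P.cap\<close> applied to \<open>a\<close> and each of the finitely
  many \<open>f k\<close> gives the generators on the left. The right side is symmetric, with
  \<open>g k\<close> and \<open>b\<close>.\<close>

lemma amal_cap_Inl_Inr:
  assumes ab: "a \<in> CP" "b \<in> CQ"
  shows "\<exists>U. is_cap (Inl a) (Inr b) U"
proof -
  have "\<forall>k\<in>K. \<exists>U. finite U \<and> U \<subseteq> CP \<and> (\<forall>H x. prime_ideal H \<longrightarrow> x \<in> CP \<longrightarrow> leP H x a \<longrightarrow> leP H x (f k) \<longrightarrow>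
      (\<exists>u\<in>U. leP H x u \<and> leP H u a \<and> leP H u (f k)))"
    using ab f_in by (intro ballI P.cap)
  then obtain U where U0: "\<forall>k\<in>K. finite (U k) \<and> U k \<subseteq> CP \<and> (\<forall>H x. prime_ideal H \<longrightarrow> x \<in> CP \<longrightarrow> leP H x a \<longrightarrow> leP H x (f k) \<longrightarrow>
      (\<exists>u\<in>U k. leP H x u \<and> leP H u a \<and> leP H u (f k)))"
    unfolding bchoice_iff by blast
  have U: "finite (U k) \<and> U k \<subseteq> CP" if "k \<in> K" for k
    using U0 that by blast
  note U2 = U0[THEN bspec, THEN conjunct2, THEN conjunct2, rule_format]
  have "\<forall>k\<in>K. \<exists>U. finite U \<and> U \<subseteq> CQ \<and> (\<forall>H x. prime_ideal H \<longrightarrow> x \<in> CQ \<longrightarrow> leQ H x (g k) \<longrightarrow> leQ H x b \<longrightarrow>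
      (\<exists>u\<in>U. leQ H x u \<and> leQ H u (g k) \<and> leQ H u b))"
    using ab g_in by (intro ballI Q.cap)
  then obtain V where V0: "\<forall>k\<in>K. finite (V k) \<and> V k \<subseteq> CQ \<and> (\<forall>H x. prime_ideal H \<longrightarrow> x \<in> CQ \<longrightarrow> leQ H x (g k) \<longrightarrow> leQ H x b \<longrightarrow>
      (\<exists>u\<in>V k. leQ H x u \<and> leQ H u (g k) \<and> leQ H u b))"
    unfolding bchoice_iff by blast
  have V: "finite (V k) \<and> V k \<subseteq> CQ" if "k \<in> K" for k
    using V0 that by blast
  note V2 = V0[THEN bspec, THEN conjunct2, THEN conjunct2, rule_format]
  let ?U = "Inl ` (\<Union>(U ` K)) \<union> Inr ` (\<Union>(V ` K))"
  have "\<exists>u\<in>?U. le H x u \<and> le H u (Inl a) \<and> le H u (Inr b)"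
    if H: "prime_ideal H" and x: "x \<in> C" "le H x (Inl a)" "le H x (Inr b)" for H x
  proof (cases x)
    case (Inl p)
    then obtain k where k: "k \<in> K" "leP H p (f k)" "leQ H (g k) b" using x by auto
    then obtain u where "u \<in> U k" "leP H p u \<and> leP H u a \<and> leP H u (f k)" using U2[of k H p] H Inl x by auto
    then show ?thesis using Inl k by (intro bexI[of _ "Inl u"]) auto
  next
    case (Inr q)
    then obtain k where k: "k \<in> K" "leQ H q (g k)" "leP H (f k) a" using x by auto
    then obtain u where "u \<in> V k" "leQ H q u \<and> leQ H u (g k) \<and> leQ H u b" using V2[of k H q] H Inr x by auto
    then show ?thesis using Inr k by (intro bexI[of _ "Inr u"]) auto
  qed
  moreover have "finite ?U" using U V K_finite by simp
  moreover have "?U \<subseteq> C" using U V by blast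
  ultimately show ?thesis by (intro exI[of _ ?U]) blast
qed

lemma amal_cap:
  assumes "a \<in> C" "b \<in> C"
  shows "\<exists>U. is_cap a b U"
proof (cases a; cases b)
  fix q p assume *: "a = Inr q" "b = Inl p"
  then obtain U where "is_cap b a U" using amal_cap_Inl_Inr[of p q] assms by auto
  then have "is_cap a b U" by fast
  then show ?thesis by (rule exI)
next
  fix p p' assume "a = Inl p" "b = Inl p'"
  then show ?thesis using amal_cap_Inl_Inl[of p p'] assms by (simp only: Plus_def) blast
next
  fix q q' assume "a = Inr q" "b = Inr q'"
  then show ?thesis using amal_cap_Inr_Inr[of q q'] assms by (simp only: Plus_def) blast
next
  fix p q assume "a = Inl p" "b = Inr q"
  then show ?thesis using amal_cap_Inl_Inr[of p q] assms by (simp only: Plus_def) blast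
qed

section \<open>Ideals of the amalgam generated by a finite set\<close>

context
  fixes X :: "('p + 'q) set"
  assumes X: "finite X" "X \<subseteq> C"
begin

abbreviation SP where "SP H A \<equiv> spanP H (Inl -` X \<union> f ` A)"
abbreviation SQ where "SQ H A \<equiv> spanQ H (Inr -` X \<union> g ` A)"

text \<open>The elements of \<open>K\<close> that enter the ideal generated by \<open>X\<close> after \<open>n\<close> exchanges between the two sides.\<close>

primrec stage :: "('d \<Rightarrow> bool) \<Rightarrow> nat \<Rightarrow> 'k set" where
  "stage H 0 = {}"
| "stage H (Suc n) = {k \<in> K. f k \<in> SP H (stage H n) \<or> g k \<in> SQ H (stage H n)}"

lemma SP_mono: "A \<subseteq> B \<Longrightarrow> SP H A \<subseteq> SP H B" and SQ_mono: "A \<subseteq> B \<Longrightarrow> SQ H A \<subseteq> SQ H B"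
  by (intro ideal_span_mono; blast)+

lemma gen_finite:
  assumes "A \<subseteq> K"
  shows "finite (Inl -` X \<union> f ` A)" "Inl -` X \<union> f ` A \<subseteq> CP"
    "finite (Inr -` X \<union> g ` A)" "Inr -` X \<union> g ` A \<subseteq> CQ"
  using X K_finite assms f_in g_in by (auto intro: finite_vimageI finite_subset)

lemma stage_subset: "stage H n \<subseteq> K"
  by (cases n) auto

lemma stage_incr: "stage H n \<subseteq> stage H (Suc n)"
proof (induction n)
  case (Suc n)
  then show ?case using SP_mono[OF Suc] SQ_mono[OF Suc] unfolding stage.simps by blast
qed simp

text \<open>The same number of exchanges works for all \<open>H\<close>; this is what allows the
  final stage to be described by a finite formula.\<close>

lemma stage_stable: "stage H (Suc (card K)) = stage H (card K)"
proof (rule finite_chain_stable[where N = "stage H", OF K_finite stage_subset stage_incr])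
  fix n assume "stage H (Suc n) = stage H n"
  then show "stage H (Suc (Suc n)) = stage H (Suc n)" by (subst (1 2) stage.simps(2)) (simp only:)
qed

text \<open>Crossing from one side to the other is possible only through \<open>K\<close>. Once
  \<open>A\<close> contains all elements of \<open>K\<close> reached from either side, the two
  one-sided ideals together are closed.\<close>

lemma span_subset_of_closed:
  assumes H: "prime_ideal H" and A: "{k \<in> K. f k \<in> SP H A \<or> g k \<in> SQ H A} \<subseteq> A"
  shows "ideal_span C (le H) J X \<subseteq> Inl ` SP H A \<union> Inr ` SQ H A"
proof (rule ideal_span_minimal)
  show "X \<subseteq> Inl ` SP H A \<union> Inr ` SQ H A"
  proof
    fix x assume "x \<in> X"
    then show "x \<in> Inl ` SP H A \<union> Inr ` SQ H A"
      by (cases x) (auto intro: ideal_span.base)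
  qed
next
  fix x y assume y: "y \<in> Inl ` SP H A \<union> Inr ` SQ H A" and x: "x \<in> C" "le H x y"
  show "x \<in> Inl ` SP H A \<union> Inr ` SQ H A"
  proof (cases x; cases y)
    fix p q assume *: "x = Inl p" "y = Inr q"
    then obtain k where k: "k \<in> K" "leP H p (f k)" "leQ H (g k) q" using x by auto
    have "g k \<in> SQ H A" using y * ideal_span.down[where r = "leQ H", OF _ g_in[OF k(1)] k(3)] by auto
    then have "f k \<in> SP H A" using A k(1) by (auto intro: ideal_span.base)
    then show ?thesis using ideal_span.down[where r = "leP H", OF _ _ k(2)] * x by auto
  next
    fix q p assume *: "x = Inr q" "y = Inl p"
    then obtain k where k: "k \<in> K" "leQ H q (g k)" "leP H (f k) p" using x by auto
    have "f k \<in> SP H A" using y * ideal_span.down[where r = "leP H", OF _ f_in[OF k(1)] k(3)] by auto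
    then have "g k \<in> SQ H A" using A k(1) by (auto intro: ideal_span.base)
    then show ?thesis using ideal_span.down[where r = "leQ H", OF _ _ k(2)] * x by auto
  qed (use x y in \<open>auto intro: ideal_span.down\<close>)
next
  fix Z a assume "J Z = Some a" and Z: "Z \<subseteq> Inl ` SP H A \<union> Inr ` SQ H A"
  then show "a \<in> Inl ` SP H A \<union> Inr ` SQ H A"
  proof (cases rule: amal_op_cases)
    case (1 W p)
    then have "\<forall>w\<in>W. w \<in> SP H A" using Z by blast
    then show ?thesis using ideal_span.join[of JP, OF 1(2)] 1(3) by blast
  next
    case (2 W q)
    then have "\<forall>w\<in>W. w \<in> SQ H A" using Z by blast
    then show ?thesis using ideal_span.join[of JQ, OF 2(2)] 2(3) by blast
  qed
qed

lemma subset_span: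
  assumes H: "prime_ideal H" and A: "A \<subseteq> K" "\<And>k. k \<in> A \<Longrightarrow> Inl (f k) \<in> ideal_span C (le H) J X"
  shows "Inl ` SP H A \<union> Inr ` SQ H A \<subseteq> ideal_span C (le H) J X"
proof -
  let ?S = "ideal_span C (le H) J X"
  have gA: "Inr (g k) \<in> ?S" if "k \<in> A" for k
  proof (rule ideal_span.down[OF A(2)[OF that]])
    have k: "k \<in> K" using that A by blast
    then have "leP H (f k) (f k)" "leQ H (g k) (g k)"
      using f_in g_in P.le_refl[OF H] Q.le_refl[OF H] by blast+
    with k show "Inr (g k) \<in> C" "le H (Inr (g k)) (Inl (f k))"
      using g_in by auto
  qed
  have "SP H A \<subseteq> Inl -` ?S"
  proof (rule ideal_span_minimal)
    show "Inl -` X \<union> f ` A \<subseteq> Inl -` ?S" using A by (auto intro: ideal_span.base)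
    show "x \<in> Inl -` ?S" if "y \<in> Inl -` ?S" "x \<in> CP" "leP H x y" for x y
      using that ideal_span.down[of "Inl y" C "le H" J X "Inl x"] by auto
    show "a \<in> Inl -` ?S" if "JP Z = Some a" "Z \<subseteq> Inl -` ?S" for Z a
      using that ideal_span.join[where J = J and Z = "Inl ` Z" and a = "Inl a" and C = C and r = "le H" and X = X] by (auto simp: amal_op_Inl)
  qed
  moreover have "SQ H A \<subseteq> Inr -` ?S"
  proof (rule ideal_span_minimal)
    show "Inr -` X \<union> g ` A \<subseteq> Inr -` ?S" using gA by (auto intro: ideal_span.base)
    show "x \<in> Inr -` ?S" if "y \<in> Inr -` ?S" "x \<in> CQ" "leQ H x y" for x y
      using that ideal_span.down[of "Inr y" C "le H" J X "Inr x"] by auto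
    show "a \<in> Inr -` ?S" if "JQ Z = Some a" "Z \<subseteq> Inr -` ?S" for Z a
      using that ideal_span.join[where J = J and Z = "Inr ` Z" and a = "Inr a" and C = C and r = "le H" and X = X] Q.J_nfin[OF that(1)]
      by (auto simp: amal_op_Inr nfin_def)
  qed
  ultimately show ?thesis by blast
qed

lemma stage_in_span:
  assumes H: "prime_ideal H"
  shows "k \<in> stage H n \<Longrightarrow> Inl (f k) \<in> ideal_span C (le H) J X"
proof (induction n arbitrary: k)
  case (Suc n)
  have sub: "Inl ` SP H (stage H n) \<union> Inr ` SQ H (stage H n) \<subseteq> ideal_span C (le H) J X"
    using subset_span[OF H stage_subset] Suc.IH by blast
  have k: "k \<in> K" using Suc.prems by simp
  show ?case
  proof (cases "f k \<in> SP H (stage H n)")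
    case True
    then show ?thesis using sub by blast
  next
    case False
    then have "Inr (g k) \<in> ideal_span C (le H) J X" using Suc.prems sub by auto
    moreover have "leP H (f k) (f k)" "leQ H (g k) (g k)"
      using k f_in g_in P.le_refl[OF H] Q.le_refl[OF H] by blast+
    ultimately show ?thesis using k f_in by (elim ideal_span.down) auto
  qed
qed simp

lemma span_eq:
  assumes H: "prime_ideal H"
  shows "ideal_span C (le H) J X = Inl ` SP H (stage H (card K)) \<union> Inr ` SQ H (stage H (card K))"
proof (rule subset_antisym)
  show "ideal_span C (le H) J X \<subseteq> Inl ` SP H (stage H (card K)) \<union> Inr ` SQ H (stage H (card K))"
    using stage_stable[of H] unfolding stage.simps by (intro span_subset_of_closed[OF H]) simp
  show "Inl ` SP H (stage H (card K)) \<union> Inr ` SQ H (stage H (card K)) \<subseteq> ideal_span C (le H) J X"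
    using stage_in_span[OF H] by (rule subset_span[OF H stage_subset])
qed

text \<open>Trades the set \<open>stage H n\<close>, which varies with \<open>H\<close>, for a
  disjunction over the finitely many subsets of \<open>K\<close>; for a fixed subset, definability
  is known from \<open>P.span_definable\<close>.\<close>

lemma SP_stage_iff: "p \<in> SP H (stage H n) \<longleftrightarrow> (\<exists>A\<in>Pow K. (\<forall>k\<in>A. k \<in> stage H n) \<and> p \<in> SP H A)"
  using SP_mono[of _ "stage H n" H] stage_subset[of H n] by blast

lemma SQ_stage_iff: "q \<in> SQ H (stage H n) \<longleftrightarrow> (\<exists>A\<in>Pow K. (\<forall>k\<in>A. k \<in> stage H n) \<and> q \<in> SQ H A)"
  using SQ_mono[of _ "stage H n" H] stage_subset[of H n] by blast

lemma S_stage_definable: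
  assumes "\<And>k. k \<in> K \<Longrightarrow> definable (\<lambda>H. k \<in> stage H n)"
  shows "p \<in> CP \<Longrightarrow> definable (\<lambda>H. p \<in> SP H (stage H n))" "q \<in> CQ \<Longrightarrow> definable (\<lambda>H. q \<in> SQ H (stage H n))"
  unfolding SP_stage_iff SQ_stage_iff
  using K_finite assms gen_finite
  by (intro definable_Bex definable_conj definable_Ball P.span_definable Q.span_definable;
      auto dest: finite_subset)+

lemma stage_definable: "k \<in> K \<Longrightarrow> definable (\<lambda>H. k \<in> stage H n)"
proof (induction n arbitrary: k)
  case 0
  then show ?case by (simp add: definable_False)
next
  case (Suc n)
  then show ?case
    using S_stage_definable[of n] f_in g_in by (simp add: definable_disj)
qed

lemma amal_span_definable:
  assumes "x \<in> C"
  shows "definable (\<lambda>H. x \<in> ideal_span C (le H) J X)"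
proof -
  have "definable (\<lambda>H. x \<in> Inl ` SP H (stage H (card K)) \<union> Inr ` SQ H (stage H (card K)))"
    using assms S_stage_definable[OF stage_definable, of _ "card K"]
    by (cases x) (auto simp: image_iff)
  then show ?thesis by (rule iffD2[OF definable_cong, rotated]) (simp add: span_eq)
qed

lemma amal_span_fg:
  "\<exists>U. finite U \<and> U \<subseteq> C \<and>
    (\<forall>H x. prime_ideal H \<longrightarrow> x \<in> ideal_span C (le H) J X \<longrightarrow> (\<exists>u\<in>U. le H x u \<and> u \<in> ideal_span C (le H) J X))"
proof -
  have "\<forall>A\<in>Pow K. \<exists>U. finite U \<and> U \<subseteq> CP \<and>
      (\<forall>H x. prime_ideal H \<longrightarrow> x \<in> SP H A \<longrightarrow> (\<exists>u\<in>U. leP H x u \<and> u \<in> SP H A))"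
    using gen_finite by (intro ballI P.span_fg) auto
  then obtain U where U0: "\<forall>A\<in>Pow K. finite (U A) \<and> U A \<subseteq> CP \<and> (\<forall>H x. prime_ideal H \<longrightarrow> x \<in> SP H A \<longrightarrow>
      (\<exists>u\<in>U A. leP H x u \<and> u \<in> SP H A))"
    unfolding bchoice_iff by blast
  have U: "finite (U A) \<and> U A \<subseteq> CP" if "A \<in> Pow K" for A
    using U0 that by blast
  note U2 = U0[THEN bspec, THEN conjunct2, THEN conjunct2, rule_format]
  have "\<forall>A\<in>Pow K. \<exists>U. finite U \<and> U \<subseteq> CQ \<and>
      (\<forall>H x. prime_ideal H \<longrightarrow> x \<in> SQ H A \<longrightarrow> (\<exists>u\<in>U. leQ H x u \<and> u \<in> SQ H A))"
    using gen_finite by (intro ballI Q.span_fg) auto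
  then obtain V where V0: "\<forall>A\<in>Pow K. finite (V A) \<and> V A \<subseteq> CQ \<and> (\<forall>H x. prime_ideal H \<longrightarrow> x \<in> SQ H A \<longrightarrow>
      (\<exists>u\<in>V A. leQ H x u \<and> u \<in> SQ H A))"
    unfolding bchoice_iff by blast
  have V: "finite (V A) \<and> V A \<subseteq> CQ" if "A \<in> Pow K" for A
    using V0 that by blast
  note V2 = V0[THEN bspec, THEN conjunct2, THEN conjunct2, rule_format]
  \<comment> \<open>Whatever \<open>H\<close> is, the final stage is one of the finitely many
    subsets \<open>A\<close> of \<open>K\<close>, so the generators for all \<open>A\<close> are
    collected.\<close>
  let ?U = "Inl ` (\<Union>(U ` Pow K)) \<union> Inr ` (\<Union>(V ` Pow K))"
  have "\<exists>u\<in>?U. le H x u \<and> u \<in> ideal_span C (le H) J X"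
    if H: "prime_ideal H" and x: "x \<in> ideal_span C (le H) J X" for H x
  proof (cases x)
    case (Inl p)
    then have "p \<in> SP H (stage H (card K))" using x by (auto simp: span_eq[OF H])
    then obtain u where "u \<in> U (stage H (card K))" "leP H p u" "u \<in> SP H (stage H (card K))"
      using U2[OF PowI[OF stage_subset] H] by blast
    moreover have "stage H (card K) \<in> Pow K" using stage_subset by (rule PowI)
    ultimately have "Inl u \<in> ?U" "le H x (Inl u)" "Inl u \<in> ideal_span C (le H) J X"
      using Inl unfolding span_eq[OF H] by (blast, simp, blast)
    then show ?thesis by blast
  next
    case (Inr q)
    then have "q \<in> SQ H (stage H (card K))" using x by (auto simp: span_eq[OF H])
    then obtain u where "u \<in> V (stage H (card K))" "leQ H q u" "u \<in> SQ H (stage H (card K))"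
      using V2[OF PowI[OF stage_subset] H] by blast
    moreover have "stage H (card K) \<in> Pow K" using stage_subset by (rule PowI)
    ultimately have "Inr u \<in> ?U" "le H x (Inr u)" "Inr u \<in> ideal_span C (le H) J X"
      using Inr unfolding span_eq[OF H] by (blast, simp, blast)
    then show ?thesis by blast
  qed
  moreover have "finite ?U" using U V K_finite by simp
  moreover have "?U \<subseteq> C" using U V by blast
  ultimately show ?thesis by (intro exI[of _ ?U]) blast
qed

end

lemma uniform_family_amalgam: "uniform_family C le J"
  by (rule uniform_family.intro)
    (fact amal_refl amal_trans amal_le_True amal_le_definable amal_J_nfin amal_J_in amal_J_upper
      amal_J_least amal_cap amal_span_fg amal_span_definable)+

end


section \<open>Balanced partial lattices\<close>

text \<open>A prime ideal of \<open>D\<close> is a prime filter of the dual lattice. Evaluating the values of a comeasured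
  partial lattice at it turns them into truth values.\<close>

abbreviation ev :: "('d \<Rightarrow> bool) \<Rightarrow> 'd dual \<Rightarrow> bool" where
  "ev H e \<equiv> H (undual e)"

lemma ev_Inf_fin:
  fixes A :: "'d::{distrib_lattice,order_bot} dual set"
  assumes "prime_ideal H" "finite A" "A \<noteq> {}"
  shows "ev H (Inf_fin A) \<longleftrightarrow> (\<forall>a\<in>A. ev H a)"
  using assms(2,3) by (induction rule: finite_ne_induct) (simp_all add: prime_ideal_sup[OF assms(1)])

lemma ev_Sup_fin:
  fixes A :: "'d::{distrib_lattice,order_bot} dual set"
  assumes "prime_ideal H" "finite A" "A \<noteq> {}"
  shows "ev H (Sup_fin A) \<longleftrightarrow> (\<exists>a\<in>A. ev H a)"
  using assms(2,3) by (induction rule: finite_ne_induct) (simp_all add: prime_ideal_inf[OF assms(1)])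

lemma ev_mono:
  fixes a b :: "'d::{distrib_lattice,order_bot} dual"
  shows "prime_ideal H \<Longrightarrow> a \<le> b \<Longrightarrow> ev H a \<Longrightarrow> ev H b"
  unfolding dual_less_eq_iff by (rule prime_ideal_mono)

lemma le_evI:
  fixes a b :: "'d::{distrib_lattice,order_bot} dual"
  assumes "\<And>H. prime_ideal H \<Longrightarrow> ev H a \<Longrightarrow> ev H b"
  shows "a \<le> b"
  unfolding dual_less_eq_iff using assms prime_ideal_separation by blast

lemma nfin_iff: "X \<in> nfin A \<longleftrightarrow> X \<subseteq> A \<and> finite X \<and> X \<noteq> {}"
  by (simp add: nfin_def)

definition equiv_at :: "('a \<Rightarrow> 'a \<Rightarrow> 'd dual) \<Rightarrow> ('d \<Rightarrow> bool) \<Rightarrow> 'a \<Rightarrow> 'a \<Rightarrow> bool" where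
  "equiv_at v H x y \<longleftrightarrow> ev H (v x y) \<and> ev H (v y x)"

definition set_equiv_at :: "('a \<Rightarrow> 'a \<Rightarrow> 'd dual) \<Rightarrow> ('d \<Rightarrow> bool) \<Rightarrow> 'a set \<Rightarrow> 'a set \<Rightarrow> bool" where
  "set_equiv_at v H X Y \<longleftrightarrow> (\<forall>x\<in>X. \<exists>y\<in>Y. equiv_at v H x y) \<and> (\<forall>y\<in>Y. \<exists>x\<in>X. equiv_at v H y x)"

lemma ev_eq_val:
  fixes v :: "'a \<Rightarrow> 'a \<Rightarrow> 'd::{distrib_lattice,order_bot} dual"
  shows "prime_ideal H \<Longrightarrow> ev H (eq_val v x y) \<longleftrightarrow> equiv_at v H x y"
  by (simp add: eq_val_def equiv_at_def prime_ideal_sup)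

lemma ev_set_eq_val:
  fixes v :: "'a \<Rightarrow> 'a \<Rightarrow> 'd::{distrib_lattice,order_bot} dual"
  assumes "prime_ideal H" "finite X" "X \<noteq> {}" "finite Y" "Y \<noteq> {}"
  shows "ev H (set_eq_val v X Y) \<longleftrightarrow> set_equiv_at v H X Y"
  using assms
  by (simp add: set_eq_val_def set_equiv_at_def subset_val_def ev_Inf_fin ev_Sup_fin ev_eq_val prime_ideal_sup)

text \<open>Only the join half of the axioms; the meet half is the same locale for the dual partial lattice.\<close>

locale comeasured_join =
  fixes P :: "'a partial_lattice" and v :: "'a \<Rightarrow> 'a \<Rightarrow> 'd::{distrib_lattice,order_bot} dual"
  assumes v_refl: "prime_ideal H \<Longrightarrow> x \<in> pcarrier P \<Longrightarrow> ev H (v x x)"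
    and v_trans: "prime_ideal H \<Longrightarrow> x \<in> pcarrier P \<Longrightarrow> y \<in> pcarrier P \<Longrightarrow> z \<in> pcarrier P \<Longrightarrow>
      ev H (v x y) \<Longrightarrow> ev H (v y z) \<Longrightarrow> ev H (v x z)"
    and pjoin_nfin: "pjoin P X = Some a \<Longrightarrow> X \<in> nfin (pcarrier P)"
    and pjoin_in: "pjoin P X = Some a \<Longrightarrow> a \<in> pcarrier P"
    and pjoin_upper: "prime_ideal H \<Longrightarrow> pjoin P X = Some a \<Longrightarrow> x \<in> X \<Longrightarrow> ev H (v x a)"
    and pjoin_least: "prime_ideal H \<Longrightarrow> pjoin P X = Some a \<Longrightarrow> b \<in> pcarrier P \<Longrightarrow>
      (\<And>x. x \<in> X \<Longrightarrow> ev H (v x b)) \<Longrightarrow> ev H (v a b)"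
    and cover: "X \<in> nfin (pcarrier P) \<Longrightarrow> \<exists>\<C>. is_cover v (dom (pjoin P)) X \<C>"
    and Id_cap: "Id_cap P v" and Id_vee: "Id_vee P v"
begin

text \<open>Quantifies over the whole domain of \<open>pjoin P\<close>, so it is visibly independent
  of the cover chosen inside \<open>eq_op_val\<close>; \<open>ev_eq_op_val\<close> shows that the
  two agree.\<close>

definition is_join_at :: "('d \<Rightarrow> bool) \<Rightarrow> 'a \<Rightarrow> 'a set \<Rightarrow> bool" where
  "is_join_at H a X \<longleftrightarrow> (\<exists>Z b. pjoin P Z = Some b \<and> equiv_at v H a b \<and> set_equiv_at v H X Z)"

definition le_join_at :: "('d \<Rightarrow> bool) \<Rightarrow> 'a \<Rightarrow> 'a set \<Rightarrow> bool" where
  "le_join_at H a X \<longleftrightarrow> (\<exists>Z b. pjoin P Z = Some b \<and> ev H (v a b) \<and> set_equiv_at v H X Z)"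

lemma equiv_at_refl: "prime_ideal H \<Longrightarrow> x \<in> pcarrier P \<Longrightarrow> equiv_at v H x x"
  by (simp add: equiv_at_def v_refl)

lemma set_equiv_at_refl: "prime_ideal H \<Longrightarrow> X \<subseteq> pcarrier P \<Longrightarrow> set_equiv_at v H X X"
  unfolding set_equiv_at_def using equiv_at_refl by blast

text \<open>Each element of \<open>Z\<close> is equivalent at \<open>H\<close> to one of
  \<open>X\<close> and then to one of \<open>W\<close>, hence below \<open>c\<close>. Used in both
  directions, this gives independence of the cover.\<close>

lemma join_le_join:
  assumes H: "prime_ideal H" and J: "pjoin P Z = Some b" "pjoin P W = Some c"
    and X: "X \<subseteq> pcarrier P" "set_equiv_at v H X Z" "set_equiv_at v H X W"
  shows "ev H (v b c)"
proof (rule pjoin_least[OF H J(1) pjoin_in[OF J(2)]])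
  fix z assume z: "z \<in> Z"
  then obtain x where x: "x \<in> X" "ev H (v z x)" using X(2) unfolding set_equiv_at_def equiv_at_def by blast
  then obtain w where w: "w \<in> W" "ev H (v x w)" using X(3) unfolding set_equiv_at_def equiv_at_def by blast
  have C: "z \<in> pcarrier P" "x \<in> pcarrier P" "w \<in> pcarrier P"
    using pjoin_nfin[OF J(1)] pjoin_nfin[OF J(2)] X(1) z x w by (auto simp: nfin_iff)
  have "ev H (v z w)" using v_trans[OF H C x(2) w(2)] .
  then show "ev H (v z c)"
    using v_trans[OF H C(1,3) pjoin_in[OF J(2)]] pjoin_upper[OF H J(2) w(1)] by blast
qed

lemma cover_at:
  assumes X: "X \<in> nfin (pcarrier P)" and c: "is_cover v (dom (pjoin P)) X \<C>"
  shows "finite \<C>" "\<C> \<noteq> {}" "\<And>Z. Z \<in> \<C> \<Longrightarrow> \<exists>b. pjoin P Z = Some b \<and> Z \<in> nfin (pcarrier P)"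
    "\<And>H Z b. prime_ideal H \<Longrightarrow> pjoin P Z = Some b \<Longrightarrow> set_equiv_at v H X Z \<Longrightarrow> \<exists>W\<in>\<C>. set_equiv_at v H X W"
proof -
  show fin: "finite \<C>" "\<C> \<noteq> {}" using c by (auto simp: is_cover_def nfin_iff)
  show *: "\<And>Z. Z \<in> \<C> \<Longrightarrow> \<exists>b. pjoin P Z = Some b \<and> Z \<in> nfin (pcarrier P)"
  proof -
    fix Z assume "Z \<in> \<C>"
    then obtain b where "pjoin P Z = Some b" using c by (auto simp: is_cover_def nfin_iff)
    then show "\<exists>b. pjoin P Z = Some b \<and> Z \<in> nfin (pcarrier P)" using pjoin_nfin by simp
  qed
  fix H Z b assume H: "prime_ideal H" and Z: "pjoin P Z = Some b" "set_equiv_at v H X Z"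
  have "set_eq_val v X Z \<le> Sup_fin ((\<lambda>Z. set_eq_val v X Z) ` \<C>)"
    using c Z by (auto simp: is_cover_def)
  moreover have "ev H (set_eq_val v X Z)"
    using Z pjoin_nfin[OF Z(1)] X by (simp add: nfin_iff ev_set_eq_val[OF H])
  ultimately have "ev H (Sup_fin ((\<lambda>Z. set_eq_val v X Z) ` \<C>))" by (rule ev_mono[OF H])
  then obtain W where W: "W \<in> \<C>" "ev H (set_eq_val v X W)"
    using ev_Sup_fin[OF H, of "(\<lambda>Z. set_eq_val v X Z) ` \<C>"] fin by auto
  then have "set_equiv_at v H X W" using *[OF W(1)] X by (auto simp: nfin_iff ev_set_eq_val[OF H])
  then show "\<exists>W\<in>\<C>. set_equiv_at v H X W" using W(1) by blast
qed

lemma ev_eq_op_val_cover: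
  assumes X: "X \<in> nfin (pcarrier P)"
  obtains \<C> where "is_cover v (dom (pjoin P)) X \<C>"
    "\<And>H a. prime_ideal H \<Longrightarrow> ev H (eq_op_val v (pjoin P) a X) \<longleftrightarrow>
      (\<exists>Z\<in>\<C>. equiv_at v H a (the (pjoin P Z)) \<and> set_equiv_at v H X Z)"
proof -
  let ?C = "SOME \<C>. is_cover v (dom (pjoin P)) X \<C>"
  have c: "is_cover v (dom (pjoin P)) X ?C" using cover[OF X] by (rule someI_ex)
  have "ev H (eq_op_val v (pjoin P) a X) \<longleftrightarrow>
      (\<exists>Z\<in>?C. equiv_at v H a (the (pjoin P Z)) \<and> set_equiv_at v H X Z)" if H: "prime_ideal H" for H a
  proof -
    have "ev H (eq_op_val v (pjoin P) a X) \<longleftrightarrow>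
        (\<exists>Z\<in>?C. ev H (inf (eq_val v a (the (pjoin P Z))) (set_eq_val v X Z)))"
      unfolding eq_op_val_def Let_def using cover_at[OF X c] by (subst ev_Sup_fin[OF H]) auto
    also have "\<dots> \<longleftrightarrow> (\<exists>Z\<in>?C. equiv_at v H a (the (pjoin P Z)) \<and> set_equiv_at v H X Z)"
    proof (rule bex_cong[OF refl])
      fix Z assume "Z \<in> ?C"
      then have "Z \<in> nfin (pcarrier P)" using cover_at(3)[OF X c] by blast
      then show "ev H (inf (eq_val v a (the (pjoin P Z))) (set_eq_val v X Z)) \<longleftrightarrow>
          equiv_at v H a (the (pjoin P Z)) \<and> set_equiv_at v H X Z"
        using X H by (simp add: prime_ideal_sup ev_eq_val ev_set_eq_val nfin_iff)
    qed
    finally show ?thesis .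
  qed
  then show thesis using that[OF c] by blast
qed

lemma ev_eq_op_val:
  assumes H: "prime_ideal H" and X: "X \<in> nfin (pcarrier P)" and a: "a \<in> pcarrier P"
  shows "ev H (eq_op_val v (pjoin P) a X) \<longleftrightarrow> is_join_at H a X"
proof -
  obtain \<C> where c: "is_cover v (dom (pjoin P)) X \<C>"
    and iff: "\<And>H a. prime_ideal H \<Longrightarrow> ev H (eq_op_val v (pjoin P) a X) \<longleftrightarrow>
      (\<exists>Z\<in>\<C>. equiv_at v H a (the (pjoin P Z)) \<and> set_equiv_at v H X Z)"
    using ev_eq_op_val_cover[OF X] by blast
  have XC: "X \<subseteq> pcarrier P" using X by (simp add: nfin_iff)
  show ?thesis
  proof
    assume "ev H (eq_op_val v (pjoin P) a X)"
    then obtain Z where Z: "Z \<in> \<C>" "equiv_at v H a (the (pjoin P Z))" "set_equiv_at v H X Z"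
      using iff[OF H] by blast
    moreover obtain b where "pjoin P Z = Some b" using cover_at(3)[OF X c Z(1)] by blast
    ultimately show "is_join_at H a X" by (auto simp: is_join_at_def)
  next
    assume "is_join_at H a X"
    then obtain W b where W: "pjoin P W = Some b" "equiv_at v H a b" "set_equiv_at v H X W"
      by (auto simp: is_join_at_def)
    obtain Z where Z: "Z \<in> \<C>" "set_equiv_at v H X Z" using cover_at(4)[OF X c H W(1,3)] by blast
    obtain c where c: "pjoin P Z = Some c" using cover_at(3)[OF X c Z(1)] by blast
    have "ev H (v b c)" "ev H (v c b)"
      using join_le_join[OF H W(1) c XC W(3) Z(2)] join_le_join[OF H c W(1) XC Z(2) W(3)] .
    then have ac: "equiv_at v H a c"
      using W(2) v_trans[OF H a pjoin_in[OF W(1)] pjoin_in[OF c]]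
        v_trans[OF H pjoin_in[OF c] pjoin_in[OF W(1)] a] by (simp add: equiv_at_def)
    show "ev H (eq_op_val v (pjoin P) a X)"
      by (intro iff[OF H, THEN iffD2] bexI[OF _ Z(1)]) (simp add: c Z(2) ac)
  qed
qed

text \<open>The joins of the members of a cover form a sample: if \<open>X\<close> has a join at
  \<open>H\<close> at all, some member is equivalent to \<open>X\<close> there, and its own join is
  a join of \<open>X\<close> at \<open>H\<close>.\<close>

lemma sample_exists:
  assumes X: "X \<in> nfin (pcarrier P)"
  shows "\<exists>U. is_sample P v (pjoin P) X U"
proof -
  obtain \<C> where c: "is_cover v (dom (pjoin P)) X \<C>"
    and iff: "\<And>H a. prime_ideal H \<Longrightarrow> ev H (eq_op_val v (pjoin P) a X) \<longleftrightarrow>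
      (\<exists>Z\<in>\<C>. equiv_at v H a (the (pjoin P Z)) \<and> set_equiv_at v H X Z)"
    using ev_eq_op_val_cover[OF X] by blast
  let ?U = "(\<lambda>Z. the (pjoin P Z)) ` \<C>"
  have in_C: "the (pjoin P Z) \<in> pcarrier P" if "Z \<in> \<C>" for Z
    using cover_at(3)[OF X c that] pjoin_in by auto
  have U: "?U \<in> nfin (pcarrier P)" using cover_at(1,2)[OF X c] in_C by (auto simp: nfin_iff)
  have "eq_op_val v (pjoin P) x X \<le> Sup_fin ((\<lambda>u. eq_op_val v (pjoin P) u X) ` ?U)" for x
  proof (rule le_evI)
    fix H :: "'d \<Rightarrow> bool" assume H: "prime_ideal H" and "ev H (eq_op_val v (pjoin P) x X)"
    then obtain Z where Z: "Z \<in> \<C>" "set_equiv_at v H X Z" using iff by blast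
    then have "ev H (eq_op_val v (pjoin P) (the (pjoin P Z)) X)"
      using iff[OF H] equiv_at_refl[OF H in_C[OF Z(1)]] by blast
    then show "ev H (Sup_fin ((\<lambda>u. eq_op_val v (pjoin P) u X) ` ?U))"
      using U Z(1) by (subst ev_Sup_fin[OF H]) (auto simp: nfin_iff)
  qed
  then show ?thesis using U by (auto simp: is_sample_def)
qed

text \<open>Besides evaluating the value, this exposes the sample as a finite set of generators,
  common to all \<open>H\<close>, for the elements below the join of \<open>X\<close>.
  \<open>Id_val_fg\<close> depends on it.\<close>

lemma ev_le_join_val:
  assumes X: "X \<in> nfin (pcarrier P)"
  obtains U where "U \<in> nfin (pcarrier P)"
    "\<And>H a. prime_ideal H \<Longrightarrow> a \<in> pcarrier P \<Longrightarrow> ev H (le_join_val P v a X) \<longleftrightarrow> le_join_at H a X"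
    "\<And>H a. prime_ideal H \<Longrightarrow> a \<in> pcarrier P \<Longrightarrow> le_join_at H a X \<Longrightarrow> \<exists>u\<in>U. ev H (v a u) \<and> le_join_at H u X"
proof -
  let ?U = "SOME U. is_sample P v (pjoin P) X U"
  have s: "is_sample P v (pjoin P) X ?U" using sample_exists[OF X] by (rule someI_ex)
  then have U: "?U \<in> nfin (pcarrier P)" by (simp add: is_sample_def)
  have XC: "X \<subseteq> pcarrier P" using X by (simp add: nfin_iff)
  have sample: "\<exists>u\<in>?U. is_join_at H u X" if H: "prime_ideal H" and x: "x \<in> pcarrier P" "is_join_at H x X" for H x
  proof -
    have "eq_op_val v (pjoin P) x X \<le> Sup_fin ((\<lambda>u. eq_op_val v (pjoin P) u X) ` ?U)"
      using s x by (simp add: is_sample_def)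
    moreover have "ev H (eq_op_val v (pjoin P) x X)" using ev_eq_op_val[OF H X x(1)] x(2) by simp
    ultimately have "ev H (Sup_fin ((\<lambda>u. eq_op_val v (pjoin P) u X) ` ?U))" by (rule ev_mono[OF H])
    then have "\<exists>u\<in>?U. ev H (eq_op_val v (pjoin P) u X)"
      using U ev_Sup_fin[OF H, of "(\<lambda>u. eq_op_val v (pjoin P) u X) ` ?U"] by (auto simp: nfin_iff)
    then show ?thesis using U ev_eq_op_val[OF H X] by (auto simp: nfin_iff)
  qed
  have gen: "\<exists>u\<in>?U. ev H (v a u) \<and> is_join_at H u X"
    if H: "prime_ideal H" and a: "a \<in> pcarrier P" "le_join_at H a X" for H a
  proof -
    obtain Z b where Z: "pjoin P Z = Some b" "ev H (v a b)" "set_equiv_at v H X Z"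
      using a by (auto simp: le_join_at_def)
    have "is_join_at H b X" using Z equiv_at_refl[OF H pjoin_in[OF Z(1)]] by (auto simp: is_join_at_def)
    then obtain u where u: "u \<in> ?U" "is_join_at H u X" using sample[OF H pjoin_in[OF Z(1)]] by blast
    then obtain W c where W: "pjoin P W = Some c" "equiv_at v H u c" "set_equiv_at v H X W"
      by (auto simp: is_join_at_def)
    have uC: "u \<in> pcarrier P" using u U by (auto simp: nfin_iff)
    have "ev H (v b c)" by (rule join_le_join[OF H Z(1) W(1) XC Z(3) W(3)])
    then have "ev H (v b u)"
      using v_trans[OF H pjoin_in[OF Z(1)] pjoin_in[OF W(1)] uC] W(2) by (simp add: equiv_at_def)
    then have "ev H (v a u)" using v_trans[OF H a(1) pjoin_in[OF Z(1)] uC] Z(2) by simp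
    then show ?thesis using u by blast
  qed
  have join_le: "le_join_at H a X" if H: "prime_ideal H" and a: "a \<in> pcarrier P" and u: "u \<in> pcarrier P"
    "ev H (v a u)" "is_join_at H u X" for H a u
  proof -
    obtain Z b where Z: "pjoin P Z = Some b" "equiv_at v H u b" "set_equiv_at v H X Z"
      using u by (auto simp: is_join_at_def)
    have "ev H (v a b)" using v_trans[OF H a u(1) pjoin_in[OF Z(1)]] u Z(2) by (simp add: equiv_at_def)
    then show ?thesis using Z by (auto simp: le_join_at_def)
  qed
  have UC: "\<And>u. u \<in> ?U \<Longrightarrow> u \<in> pcarrier P" using U by (auto simp: nfin_iff)
  show thesis
  proof (rule that[OF U])
    fix H :: "'d \<Rightarrow> bool" and a assume H: "prime_ideal H" and a: "a \<in> pcarrier P"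
    have "ev H (le_join_val P v a X) \<longleftrightarrow> (\<exists>u\<in>?U. ev H (inf (v a u) (eq_op_val v (pjoin P) u X)))"
      unfolding le_join_val_def Let_def using U by (subst ev_Sup_fin[OF H]) (auto simp: nfin_iff)
    also have "\<dots> \<longleftrightarrow> (\<exists>u\<in>?U. ev H (v a u) \<and> is_join_at H u X)"
      using ev_eq_op_val[OF H X] UC by (intro bex_cong) (simp_all add: prime_ideal_sup[OF H])
    also have "\<dots> \<longleftrightarrow> le_join_at H a X"
      using gen[OF H a] join_le[OF H a] UC by blast
    finally show "ev H (le_join_val P v a X) \<longleftrightarrow> le_join_at H a X" .
    assume "le_join_at H a X"
    then obtain u where u: "u \<in> ?U" "ev H (v a u)" "is_join_at H u X" using gen[OF H a] by blast
    then have "le_join_at H u X" using join_le[OF H UC UC] v_refl[OF H UC] by blast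
    then show "\<exists>u\<in>?U. ev H (v a u) \<and> le_join_at H u X" using u by blast
  qed
qed

section \<open>The iterated values \<open>Id_val\<close> and the ideals at a prime ideal\<close>

lemma ev_Id_val_0:
  assumes "prime_ideal H" "X \<in> nfin (pcarrier P)"
  shows "ev H (Id_val P v 0 X U a) \<longleftrightarrow> (\<exists>x\<in>X. ev H (v a x))"
  using assms by (simp add: ev_Sup_fin nfin_iff)

lemma ev_Id_val_Suc:
  assumes H: "prime_ideal H" and U: "U \<in> nfin (pcarrier P)" and X: "X \<in> nfin (pcarrier P)"
    and a: "a \<in> pcarrier P"
  shows "ev H (Id_val P v (Suc n) X U a) \<longleftrightarrow> ev H (Id_val P v n X U a) \<or>
    (\<exists>Z. Z \<noteq> {} \<and> Z \<subseteq> U \<and> le_join_at H a Z \<and> (\<forall>z\<in>Z. ev H (Id_val P v n X U z)))"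
proof -
  let ?S = "{Z. Z \<noteq> {} \<and> Z \<subseteq> U}"
  have S: "finite ?S" "?S \<noteq> {}"
    using U finite_subset[of ?S "Pow U"] by (auto simp: nfin_iff)
  have "ev H (Id_val P v (Suc n) X U a) \<longleftrightarrow> ev H (Id_val P v n X U a) \<or>
    (\<exists>Z\<in>?S. ev H (inf (le_join_val P v a Z) (Inf_fin ((\<lambda>z. Id_val P v n X U z) ` Z))))"
    using S by (simp only: Id_val.simps undual_sup_eq prime_ideal_inf[OF H]) (subst ev_Sup_fin[OF H]; simp)
  also have "(\<exists>Z\<in>?S. ev H (inf (le_join_val P v a Z) (Inf_fin ((\<lambda>z. Id_val P v n X U z) ` Z)))) \<longleftrightarrow>
    (\<exists>Z\<in>?S. le_join_at H a Z \<and> (\<forall>z\<in>Z. ev H (Id_val P v n X U z)))"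
  proof (rule bex_cong[OF refl])
    fix Z assume "Z \<in> ?S"
    then have Z: "Z \<in> nfin (pcarrier P)" using U by (auto simp: nfin_iff intro: finite_subset)
    then have "ev H (le_join_val P v a Z) \<longleftrightarrow> le_join_at H a Z" using ev_le_join_val[OF Z] H a by metis
    moreover have "ev H (Inf_fin ((\<lambda>z. Id_val P v n X U z) ` Z)) \<longleftrightarrow> (\<forall>z\<in>Z. ev H (Id_val P v n X U z))"
      using Z by (subst ev_Inf_fin[OF H]) (auto simp: nfin_iff)
    ultimately show "ev H (inf (le_join_val P v a Z) (Inf_fin ((\<lambda>z. Id_val P v n X U z) ` Z))) \<longleftrightarrow>
        le_join_at H a Z \<and> (\<forall>z\<in>Z. ev H (Id_val P v n X U z))"
      by (simp add: prime_ideal_sup[OF H])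
  qed
  finally show ?thesis by auto
qed

abbreviation span_at :: "('d \<Rightarrow> bool) \<Rightarrow> 'a set \<Rightarrow> 'a set" where
  "span_at H X \<equiv> ideal_span (pcarrier P) (\<lambda>x y. ev H (v x y)) (pjoin P) X"

lemma Id_val_in_span:
  assumes H: "prime_ideal H" and U: "U \<in> nfin (pcarrier P)" and X: "X \<in> nfin (pcarrier P)"
  shows "a \<in> pcarrier P \<Longrightarrow> ev H (Id_val P v n X U a) \<Longrightarrow> a \<in> span_at H X"
proof (induction n arbitrary: a)
  case 0
  then obtain x where "x \<in> X" "ev H (v a x)" using ev_Id_val_0[OF H X] by blast
  then show ?case using ideal_span.down[OF ideal_span.base 0(1)] by fast
next
  case (Suc n)
  show ?case
  proof (cases "ev H (Id_val P v n X U a)")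
    case True
    then show ?thesis using Suc by simp
  next
    case False
    then obtain Z where Z: "Z \<subseteq> U" "le_join_at H a Z" "\<forall>z\<in>Z. ev H (Id_val P v n X U z)"
      using ev_Id_val_Suc[OF H U X Suc.prems(1)] Suc.prems(2) by blast
    obtain W b where W: "pjoin P W = Some b" "ev H (v a b)" "set_equiv_at v H Z W"
      using Z(2) by (auto simp: le_join_at_def)
    have "w \<in> span_at H X" if w: "w \<in> W" for w
    proof -
      obtain z where z: "z \<in> Z" "ev H (v w z)"
        using W(3) w by (auto simp: set_equiv_at_def equiv_at_def)
      have "z \<in> span_at H X" using Suc.IH[of z] z Z U by (auto simp: nfin_iff)
      moreover have "w \<in> pcarrier P" using pjoin_nfin[OF W(1)] w by (auto simp: nfin_iff)
      ultimately show ?thesis using z(2) by (rule ideal_span.down)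
    qed
    then have "b \<in> span_at H X" using ideal_span.join[where J = "pjoin P", OF W(1)] by blast
    then show ?thesis using Suc.prems(1) W(2) by (rule ideal_span.down)
  qed
qed

lemma Id_val_down:
  assumes H: "prime_ideal H" and U: "U \<in> nfin (pcarrier P)" and X: "X \<in> nfin (pcarrier P)"
    and ab: "a \<in> pcarrier P" "b \<in> pcarrier P" "ev H (v a b)"
  shows "ev H (Id_val P v n X U b) \<Longrightarrow> ev H (Id_val P v n X U a)"
proof (induction n)
  case 0
  then obtain x where x: "x \<in> X" "ev H (v b x)" using ev_Id_val_0[OF H X] by blast
  then have "ev H (v a x)" using v_trans[OF H ab(1,2) _ ab(3)] X by (auto simp: nfin_iff)
  then show ?case using x ev_Id_val_0[OF H X] by blast
next
  case (Suc n)
  have le: "le_join_at H a Z" if bZ: "le_join_at H b Z" for Z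
  proof -
    obtain W c where W: "pjoin P W = Some c" "ev H (v b c)" "set_equiv_at v H Z W"
      using bZ by (auto simp: le_join_at_def)
    then show ?thesis using v_trans[OF H ab(1,2) pjoin_in[OF W(1)] ab(3)] by (auto simp: le_join_at_def)
  qed
  show ?case
    using Suc le unfolding ev_Id_val_Suc[OF H U X ab(1)] ev_Id_val_Suc[OF H U X ab(2)] by blast
qed

lemma Id_val_mono:
  assumes H: "prime_ideal H" and U: "U \<in> nfin (pcarrier P)" and Y: "Y \<in> nfin (pcarrier P)"
    and X: "X \<in> nfin (pcarrier P)" and UY: "U \<subseteq> Y"
  shows "a \<in> pcarrier P \<Longrightarrow> ev H (Id_val P v n X U a) \<Longrightarrow> ev H (Id_val P v n X Y a)"
proof (induction n arbitrary: a)
  case 0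
  then show ?case by simp
next
  case (Suc n)
  have "\<exists>Z. Z \<noteq> {} \<and> Z \<subseteq> Y \<and> le_join_at H a Z \<and> (\<forall>z\<in>Z. ev H (Id_val P v n X Y z))"
    if Z: "Z \<noteq> {}" "Z \<subseteq> U" "le_join_at H a Z" "\<forall>z\<in>Z. ev H (Id_val P v n X U z)" for Z
  proof -
    have "ev H (Id_val P v n X Y z)" if "z \<in> Z" for z
      using Suc.IH[of z] that Z U by (auto simp: nfin_iff)
    then show ?thesis using Z UY by (intro exI[of _ Z]) auto
  qed
  then show ?case
    using Suc.IH[of a] Suc.prems unfolding ev_Id_val_Suc[OF H U X Suc.prems(1)] ev_Id_val_Suc[OF H Y X Suc.prems(1)]
    by blast
qed

lemma Id_val_of_base:
  assumes H: "prime_ideal H" and U: "U \<in> nfin (pcarrier P)" and X: "X \<in> nfin (pcarrier P)" and x: "x \<in> X"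
  shows "ev H (Id_val P v n X U x)"
proof (induction n)
  case 0
  have "x \<in> pcarrier P" using X x by (auto simp: nfin_iff)
  then show ?case using ev_Id_val_0[OF H X] v_refl[OF H] x by blast
next
  case (Suc n)
  have "x \<in> pcarrier P" using X x by (auto simp: nfin_iff)
  then show ?case using ev_Id_val_Suc[OF H U X] Suc by blast
qed

text \<open>Level \<open>Suc n\<close> is generated by the generators of level \<open>n\<close> and
  the samples for the finitely many nonempty subsets of \<open>U\<close>; a sample element below the
  join at \<open>H\<close> belongs to the new level at the same \<open>H\<close>.\<close>

lemma Id_val_fg:
  assumes U: "U \<in> nfin (pcarrier P)" and X: "X \<in> nfin (pcarrier P)"
  shows "\<exists>W. finite W \<and> W \<subseteq> pcarrier P \<and> (\<forall>H a. prime_ideal H \<longrightarrow> a \<in> pcarrier P \<longrightarrow>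
    ev H (Id_val P v n X U a) \<longrightarrow> (\<exists>w\<in>W. ev H (v a w) \<and> ev H (Id_val P v n X U w)))"
proof (induction n)
  case 0
  have "\<exists>w\<in>X. ev H (v a w) \<and> ev H (Id_val P v 0 X U w)"
    if H: "prime_ideal H" and a: "ev H (Id_val P v 0 X U a)" for H a
  proof -
    obtain x where "x \<in> X" "ev H (v a x)" using a ev_Id_val_0[OF H X] by blast
    then show ?thesis using Id_val_of_base[OF H U X] by blast
  qed
  then show ?case using X by (intro exI[of _ X]) (simp add: nfin_iff del: Id_val.simps)
next
  case (Suc n)
  then obtain W where W: "finite W" "W \<subseteq> pcarrier P"
    "\<And>H a. prime_ideal H \<Longrightarrow> a \<in> pcarrier P \<Longrightarrow>
      ev H (Id_val P v n X U a) \<Longrightarrow> \<exists>w\<in>W. ev H (v a w) \<and> ev H (Id_val P v n X U w)"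
    by blast
  let ?S = "{Z. Z \<noteq> {} \<and> Z \<subseteq> U}"
  have S: "finite ?S" using U finite_subset[of ?S "Pow U"] by (auto simp: nfin_iff)
  have "\<forall>Z\<in>?S. \<exists>V. V \<in> nfin (pcarrier P) \<and>
    (\<forall>H a. prime_ideal H \<longrightarrow> a \<in> pcarrier P \<longrightarrow> le_join_at H a Z \<longrightarrow> (\<exists>u\<in>V. ev H (v a u) \<and> le_join_at H u Z))"
  proof
    fix Z assume "Z \<in> ?S"
    then have "Z \<in> nfin (pcarrier P)" using U by (auto simp: nfin_iff intro: finite_subset)
    from ev_le_join_val[OF this] show "\<exists>V. V \<in> nfin (pcarrier P) \<and>
      (\<forall>H a. prime_ideal H \<longrightarrow> a \<in> pcarrier P \<longrightarrow> le_join_at H a Z \<longrightarrow> (\<exists>u\<in>V. ev H (v a u) \<and> le_join_at H u Z))"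
      by metis
  qed
  then obtain V where V: "\<forall>Z\<in>?S. V Z \<in> nfin (pcarrier P) \<and>
    (\<forall>H a. prime_ideal H \<longrightarrow> a \<in> pcarrier P \<longrightarrow> le_join_at H a Z \<longrightarrow> (\<exists>u\<in>V Z. ev H (v a u) \<and> le_join_at H u Z))"
    unfolding bchoice_iff by blast
  note V1 = V[THEN bspec, THEN conjunct1] and V2 = V[THEN bspec, THEN conjunct2, rule_format]
  let ?W = "W \<union> \<Union>(V ` ?S)"
  have gen: "\<exists>w\<in>?W. ev H (v a w) \<and> ev H (Id_val P v (Suc n) X U w)"
    if H: "prime_ideal H" and a: "a \<in> pcarrier P" "ev H (Id_val P v (Suc n) X U a)" for H a
  proof (cases "ev H (Id_val P v n X U a)")
    case True
    then obtain w where "w \<in> W" "ev H (v a w)" "ev H (Id_val P v n X U w)" using W(3)[OF H a(1)] by blast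
    then show ?thesis using ev_Id_val_Suc[OF H U X, of w n] W(2) by blast
  next
    case False
    then obtain Z where Z: "Z \<noteq> {}" "Z \<subseteq> U" "le_join_at H a Z" "\<forall>z\<in>Z. ev H (Id_val P v n X U z)"
      using ev_Id_val_Suc[OF H U X a(1), THEN iffD1, OF a(2)] by blast
    then have ZS: "Z \<in> ?S" by simp
    obtain u where u: "u \<in> V Z" "ev H (v a u)" "le_join_at H u Z"
      using V2[OF ZS H a(1) Z(3)] by blast
    have "u \<in> pcarrier P" using V1[OF ZS] u(1) by (auto simp: nfin_iff)
    then have "ev H (Id_val P v (Suc n) X U u)"
      by (rule ev_Id_val_Suc[OF H U X, THEN iffD2]) (use u(3) Z in blast)
    moreover have "u \<in> ?W" using u(1) ZS by blast
    ultimately show ?thesis using u(2) by blast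
  qed
  have "finite (V Z)" "V Z \<subseteq> pcarrier P" if "Z \<in> ?S" for Z
    using V1[OF that] by (simp_all add: nfin_iff)
  then have "finite ?W" "?W \<subseteq> pcarrier P"
    using W(1,2) S by (simp, blast)
  then show ?case by (intro exI[of _ ?W] conjI allI impI gen)
qed

text \<open>Stability in \<open>Id_vee\<close> is required for all larger finite sets. With
  \<open>U \<union> Z\<close> it absorbs the join of any \<open>Z\<close> in the domain, so level
  \<open>n\<close> over \<open>U\<close> is already closed under all partial joins, for every
  \<open>H\<close>.\<close>

lemma span_at_eq_Id_val:
  assumes X: "X \<in> nfin (pcarrier P)"
  obtains U n where "U \<in> nfin (pcarrier P)"
    "\<And>H a. prime_ideal H \<Longrightarrow> a \<in> pcarrier P \<Longrightarrow> a \<in> span_at H X \<longleftrightarrow> ev H (Id_val P v n X U a)"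
proof -
  have "\<exists>U\<in>nfin (pcarrier P). \<exists>n. \<forall>a\<in>pcarrier P. \<forall>Y\<in>nfin (pcarrier P). U \<subseteq> Y \<longrightarrow>
      Id_val P v n X U a = Id_val P v (Suc n) X Y a"
    using Id_vee[unfolded Id_vee_def] X by (rule bspec)
  then obtain U n where U: "U \<in> nfin (pcarrier P)"
    and eq0: "\<forall>a\<in>pcarrier P. \<forall>Y\<in>nfin (pcarrier P). U \<subseteq> Y \<longrightarrow> Id_val P v n X U a = Id_val P v (Suc n) X Y a"
    by (elim bexE exE)
  note eq = eq0[THEN bspec, THEN bspec, THEN mp]
  have "span_at H X \<subseteq> {a \<in> pcarrier P. ev H (Id_val P v n X U a)}" if H: "prime_ideal H" for H
  proof (rule ideal_span_minimal)
    show "X \<subseteq> {a \<in> pcarrier P. ev H (Id_val P v n X U a)}"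
      using Id_val_of_base[OF H U X] X by (auto simp: nfin_iff)
    show "x \<in> {a \<in> pcarrier P. ev H (Id_val P v n X U a)}"
      if "y \<in> {a \<in> pcarrier P. ev H (Id_val P v n X U a)}" "x \<in> pcarrier P" "ev H (v x y)" for x y
      using that Id_val_down[OF H U X, of x y] by simp
    fix Z a assume Z: "pjoin P Z = Some a" "Z \<subseteq> {a \<in> pcarrier P. ev H (Id_val P v n X U a)}"
    have Znf: "Z \<in> nfin (pcarrier P)" and a: "a \<in> pcarrier P" using pjoin_nfin[OF Z(1)] pjoin_in[OF Z(1)] .
    then have Y: "U \<union> Z \<in> nfin (pcarrier P)" using U by (simp add: nfin_iff)
    have "le_join_at H a Z"
      using Z(1) v_refl[OF H a] set_equiv_at_refl[OF H, of Z] Znf by (auto simp: le_join_at_def nfin_iff)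
    moreover have "ev H (Id_val P v n X (U \<union> Z) z)" if "z \<in> Z" for z
      using Id_val_mono[OF H U Y X] that Z(2) by auto
    ultimately have "ev H (Id_val P v (Suc n) X (U \<union> Z) a)"
      using ev_Id_val_Suc[OF H Y X a] Znf by (auto simp: nfin_iff)
    then show "a \<in> {a \<in> pcarrier P. ev H (Id_val P v n X U a)}" using eq[OF a Y Un_upper1] a by simp
  qed
  then show thesis
    by (intro that[OF U]) (use Id_val_in_span[OF _ U X] in auto)
qed

text \<open>\<open>Id_val\<close> is meaningful for nonempty \<open>X\<close> only, so the empty
  generating set, which occurs for instance at stage 0 of the amalgam, is settled directly: partial
  joins are taken of nonempty sets.\<close>

lemma span_at_empty: "span_at H {} = {}"
proof -
  have "span_at H {} \<subseteq> {}"
    by (rule ideal_span_minimal) (auto dest: pjoin_nfin simp: nfin_iff)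
  then show ?thesis by simp
qed

lemma uniform_family_join: "uniform_family (pcarrier P) (\<lambda>H x y. ev H (v x y)) (pjoin P)"
proof
  fix a b assume ab: "a \<in> pcarrier P" "b \<in> pcarrier P"
  obtain U where U: "U \<in> nfin (pcarrier P)" and eq: "\<And>x. x \<in> pcarrier P \<Longrightarrow>
      inf (v x a) (v x b) = Sup_fin ((\<lambda>u. inf (v x u) (inf (v u a) (v u b))) ` U)"
    using Id_cap ab unfolding Id_cap_def by blast
  have "\<exists>u\<in>U. ev H (v x u) \<and> ev H (v u a) \<and> ev H (v u b)"
    if H: "prime_ideal H" and x: "x \<in> pcarrier P" "ev H (v x a)" "ev H (v x b)" for H x
  proof -
    have "ev H (inf (v x a) (v x b))" using x by (simp add: prime_ideal_sup[OF H])
    then have "ev H (Sup_fin ((\<lambda>u. inf (v x u) (inf (v u a) (v u b))) ` U))" using eq[OF x(1)] by simp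
    then show ?thesis
      using U by (subst (asm) ev_Sup_fin[OF H]) (auto simp: nfin_iff prime_ideal_sup[OF H])
  qed
  then show "\<exists>U. finite U \<and> U \<subseteq> pcarrier P \<and> (\<forall>H x. prime_ideal H \<longrightarrow> x \<in> pcarrier P \<longrightarrow>
      ev H (v x a) \<longrightarrow> ev H (v x b) \<longrightarrow> (\<exists>u\<in>U. ev H (v x u) \<and> ev H (v u a) \<and> ev H (v u b)))"
    using U by (intro exI[of _ U]) (simp add: nfin_iff)
next
  fix X assume X: "finite X" "X \<subseteq> pcarrier P"
  show "\<exists>U. finite U \<and> U \<subseteq> pcarrier P \<and> (\<forall>H x. prime_ideal H \<longrightarrow> x \<in> span_at H X \<longrightarrow>
      (\<exists>u\<in>U. ev H (v x u) \<and> u \<in> span_at H X))"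
  proof (cases "X = {}")
    case True
    then show ?thesis by (intro exI[of _ "{}"]) (simp add: span_at_empty)
  next
    case False
    then have Xn: "X \<in> nfin (pcarrier P)" using X by (simp add: nfin_iff)
    obtain U n where U: "U \<in> nfin (pcarrier P)"
      and iff: "\<And>H a. prime_ideal H \<Longrightarrow> a \<in> pcarrier P \<Longrightarrow> a \<in> span_at H X \<longleftrightarrow> ev H (Id_val P v n X U a)"
      using span_at_eq_Id_val[OF Xn] by blast
    have sub: "span_at H X \<subseteq> pcarrier P" for H
      using X(2) by (rule ideal_span_minimal) (auto dest: pjoin_in)
    obtain W where W: "finite W" "W \<subseteq> pcarrier P" "\<forall>H a. prime_ideal H \<longrightarrow> a \<in> pcarrier P \<longrightarrow>
        ev H (Id_val P v n X U a) \<longrightarrow> (\<exists>w\<in>W. ev H (v a w) \<and> ev H (Id_val P v n X U w))"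
      using Id_val_fg[OF U Xn, of n] by (elim exE conjE)
    have "\<exists>w\<in>W. ev H (v x w) \<and> w \<in> span_at H X" if H: "prime_ideal H" and x: "x \<in> span_at H X" for H x
    proof -
      have "x \<in> pcarrier P" using x sub by blast
      moreover have "ev H (Id_val P v n X U x)" using iff[OF H] x sub by blast
      ultimately obtain w where w: "w \<in> W" "ev H (v x w)" "ev H (Id_val P v n X U w)"
        using W(3)[rule_format, OF H] by blast
      then have "w \<in> span_at H X" using iff[OF H, of w] W(2) by blast
      then show ?thesis using w by blast
    qed
    then show ?thesis using W by (intro exI[of _ W]) simp
  qed
  fix x assume x: "x \<in> pcarrier P"
  show "definable (\<lambda>H. x \<in> span_at H X)"
  proof (cases "X = {}")
    case True
    then show ?thesis by (simp add: span_at_empty definable_False)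
  next
    case False
    then have "X \<in> nfin (pcarrier P)" using X by (simp add: nfin_iff)
    from span_at_eq_Id_val[OF this] obtain U n where
      "\<And>H. prime_ideal H \<Longrightarrow> x \<in> span_at H X \<longleftrightarrow> ev H (Id_val P v n X U x)" using x by metis
    then show ?thesis by (rule iffD2[OF definable_cong, OF _ definable_elem])
  qed
qed (auto intro: v_refl v_trans pjoin_nfin pjoin_in pjoin_upper pjoin_least definable_elem)

end

text \<open>\<open>ple\<close> is left alone: the comeasured notions see the ordering only through
  \<open>v\<close>, whose arguments are exchanged separately.\<close>

definition pdual :: "'a partial_lattice \<Rightarrow> 'a partial_lattice" where
  "pdual P = P\<lparr>pjoin := pmeet P, pmeet := pjoin P\<rparr>"

lemma pdual_simps [simp]: "pcarrier (pdual P) = pcarrier P" "pjoin (pdual P) = pmeet P"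
  by (simp_all add: pdual_def)

text \<open>Symmetry of equality values makes the predicates for covers literally equal for both
  orderings. Hence \<open>SOME\<close> picks the same covers, and later the same samples, with no
  appeal to independence of the choice.\<close>

lemma eq_val_converse: "eq_val (\<lambda>x y. v y x) = eq_val v"
  by (simp add: fun_eq_iff eq_val_def inf_commute)

lemma set_eq_val_converse: "set_eq_val (\<lambda>x y. v y x) = set_eq_val v"
  by (simp add: fun_eq_iff set_eq_val_def subset_val_def eq_val_converse[of v])

lemma is_cover_converse: "is_cover (\<lambda>x y. v y x) = is_cover v"
  by (simp add: fun_eq_iff is_cover_def set_eq_val_converse[of v])

lemma eq_op_val_converse: "eq_op_val (\<lambda>x y. v y x) = eq_op_val v"
  by (simp add: fun_eq_iff eq_op_val_def eq_val_converse[of v] set_eq_val_converse[of v] is_cover_converse[of v])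

lemma le_join_val_pdual: "le_join_val (pdual P) (\<lambda>x y. v y x) a X = meet_le_val P v X a"
  by (simp add: le_join_val_def meet_le_val_def is_sample_def eq_op_val_converse[of v])

lemma Id_val_pdual: "Id_val (pdual P) (\<lambda>x y. v y x) n X U a = Fil_val P v n X U a"
  by (induction n arbitrary: a) (simp_all add: le_join_val_pdual[of P v])

text \<open>The order axioms hold because \<open>kernel_at\<close> is a congruence at every
  \<open>H\<close>; the finiteness axioms are the conditions in \<open>balanced\<close>, read once
  for each ordering.\<close>

lemma uniform_pair_balanced:
  fixes \<mu> :: "'a rel \<Rightarrow> 'd::{distrib_lattice,order_bot}"
  assumes "balanced_measured P \<mu>"
  shows "uniform_pair (pcarrier P) (\<lambda>H x y. H (\<mu> (Theta_plus P x y))) (pjoin P) (pmeet P)"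
proof -
  have m: "measured P \<mu>" and b: "balanced P (comeasure P \<mu>)"
    using assms by (simp_all add: balanced_measured_def)
  note P = measured_prelattice[OF m]
  let ?v = "comeasure P \<mu>"
  have ev: "ev H (?v x y) \<longleftrightarrow> (x, y) \<in> kernel_at P \<mu> H" if "x \<in> pcarrier P" "y \<in> pcarrier P" for H x y
    using that by (simp add: comeasure_def kernel_at_def)
  have evI: "ev H (?v x y)" if "(x, y) \<in> kernel_at P \<mu> H" for H x y
    using that by (simp add: comeasure_def kernel_at_def)
  note con = kernel_at_in_Con[OF m]
  have "comeasured_join P ?v"
  proof
    fix H :: "'d \<Rightarrow> bool" and x assume "prime_ideal H" "x \<in> pcarrier P"
    then show "ev H (?v x x)" using evI Con_refl[OF P con] by blast
  next
    fix H :: "'d \<Rightarrow> bool" and x y z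
    assume "prime_ideal H" "x \<in> pcarrier P" "y \<in> pcarrier P" "z \<in> pcarrier P" "ev H (?v x y)" "ev H (?v y z)"
    then show "ev H (?v x z)" using ev Con_trans[OF P con, of H x y z] by simp
  next
    fix X a assume "pjoin P X = Some a"
    then show "X \<in> nfin (pcarrier P)" "a \<in> pcarrier P" using prelattice_join[OF P] by (auto simp: nfin_iff)
  next
    fix H :: "'d \<Rightarrow> bool" and X a x assume "prime_ideal H" "pjoin P X = Some a" "x \<in> X"
    then show "ev H (?v x a)"
      using evI prelattice_join(5)[OF P, of X a x] subsetD[OF Con_ple[OF P con]] by blast
  next
    fix H :: "'d \<Rightarrow> bool" and X a b
    assume *: "prime_ideal H" "pjoin P X = Some a" "b \<in> pcarrier P" "\<And>x. x \<in> X \<Longrightarrow> ev H (?v x b)"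
    have "(a, b) \<in> kernel_at P \<mu> H"
      using prelattice_join(1)[OF P *(2)] *(3,4) by (intro Con_join[OF P con *(2)] *) (auto simp flip: ev)
    then show "ev H (?v a b)" by (rule evI)
  qed (use b in \<open>auto simp: balanced_def finitely_covering_def\<close>)
  then have 1: "uniform_family (pcarrier P) (\<lambda>H x y. ev H (?v x y)) (pjoin P)"
    by (rule comeasured_join.uniform_family_join)
  have "comeasured_join (pdual P) (\<lambda>x y. ?v y x)"
  proof (standard, unfold pdual_simps)
    fix H :: "'d \<Rightarrow> bool" and x assume "prime_ideal H" "x \<in> pcarrier P"
    then show "ev H (?v x x)" using evI Con_refl[OF P con] by blast
  next
    fix H :: "'d \<Rightarrow> bool" and x y z
    assume "prime_ideal H" "x \<in> pcarrier P" "y \<in> pcarrier P" "z \<in> pcarrier P" "ev H (?v y x)" "ev H (?v z y)"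
    then show "ev H (?v z x)" using ev Con_trans[OF P con, of H z y x] by simp
  next
    fix X a assume "pmeet P X = Some a"
    then show "X \<in> nfin (pcarrier P)" "a \<in> pcarrier P" using prelattice_meet[OF P] by (auto simp: nfin_iff)
  next
    fix H :: "'d \<Rightarrow> bool" and X a x assume "prime_ideal H" "pmeet P X = Some a" "x \<in> X"
    then show "ev H (?v a x)"
      using evI prelattice_meet(5)[OF P, of X a x] subsetD[OF Con_ple[OF P con]] by blast
  next
    fix H :: "'d \<Rightarrow> bool" and X a b
    assume *: "prime_ideal H" "pmeet P X = Some a" "b \<in> pcarrier P" "\<And>x. x \<in> X \<Longrightarrow> ev H (?v b x)"
    have "(b, a) \<in> kernel_at P \<mu> H"
      using prelattice_meet(1)[OF P *(2)] *(3,4) by (intro Con_meet[OF P con *(2)] *) (auto simp flip: ev)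
    then show "ev H (?v b a)" by (rule evI)
  next
    fix X assume "X \<in> nfin (pcarrier P)"
    then show "\<exists>\<C>. is_cover (\<lambda>x y. ?v y x) (dom (pmeet P)) X \<C>"
      using b by (simp add: balanced_def finitely_covering_def is_cover_converse[of ?v])
  next
    show "Id_cap (pdual P) (\<lambda>x y. ?v y x)"
      using b by (simp add: balanced_def Id_cap_def Fil_cap_def)
    show "Id_vee (pdual P) (\<lambda>x y. ?v y x)"
      using b by (simp add: balanced_def Id_vee_def Fil_vee_def Id_val_pdual[of P ?v] del: Id_val.simps Fil_val.simps)
  qed
  then have 2: "uniform_family (pcarrier P) (\<lambda>H x y. ev H (?v y x)) (pmeet P)"
    using comeasured_join.uniform_family_join[of "pdual P" "\<lambda>x y. ?v y x"] by simp
  show ?thesis using 1 2 by (simp add: uniform_pair_def comeasure_def)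
qed


section \<open>The lattice of classes of terms\<close>

context uniform_pair
begin

definition lterms :: "'a lterm set" where
  "lterms = {t. set_lterm t \<subseteq> C}"

definition cls :: "'a lterm \<Rightarrow> 'a lterm set" where
  "cls t = {s \<in> lterms. \<forall>H. prime_ideal H \<longrightarrow> tle_at H s t \<and> tle_at H t s}"

text \<open>With \<open>S\<close> the set of all prime ideals this orders \<open>L\<close>; with a
  singleton it is the ordering at \<open>H\<close> carried over to \<open>L\<close>. Keeping
  \<open>S\<close> general proves the lattice laws and the congruence property together.\<close>

definition cls_rel :: "('d \<Rightarrow> bool) set \<Rightarrow> 'a lterm set rel" where
  "cls_rel S = {(cls s, cls t) |s t. s \<in> lterms \<and> t \<in> lterms \<and> (\<forall>H\<in>S. tle_at H s t)}"

text \<open>The universal property is demanded at each \<open>H\<close> separately. So one class is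
  a supremum for the ordering of \<open>L\<close> and for every \<open>cls_rel {H}\<close>, which
  makes the latter congruences of \<open>L\<close>.\<close>

definition join_term :: "'a lterm set set \<Rightarrow> 'a lterm \<Rightarrow> bool" where
  "join_term X t \<longleftrightarrow> t \<in> lterms \<and>
    (\<forall>H. prime_ideal H \<longrightarrow> (\<forall>u\<in>lterms. tle_at H t u \<longleftrightarrow> (\<forall>A\<in>X. (A, cls u) \<in> cls_rel {H})))"

definition meet_term :: "'a lterm set set \<Rightarrow> 'a lterm \<Rightarrow> bool" where
  "meet_term X t \<longleftrightarrow> t \<in> lterms \<and>
    (\<forall>H. prime_ideal H \<longrightarrow> (\<forall>u\<in>lterms. tle_at H u t \<longleftrightarrow> (\<forall>A\<in>X. (cls u, A) \<in> cls_rel {H})))"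

definition L :: "'a lterm set partial_lattice" where
  "L = \<lparr>pcarrier = cls ` lterms, ple = cls_rel {H. prime_ideal H},
    pjoin = (\<lambda>X. if X \<in> nfin (cls ` lterms) then Some (cls (SOME t. join_term X t)) else None),
    pmeet = (\<lambda>X. if X \<in> nfin (cls ` lterms) then Some (cls (SOME t. meet_term X t)) else None)\<rparr>"

lemma L_simps: "pcarrier L = cls ` lterms" "ple L = cls_rel {H. prime_ideal H}"
  by (simp_all add: L_def)

lemma lterms_simps [simp]:
  "Gen x \<in> lterms \<longleftrightarrow> x \<in> C" "TJoin s t \<in> lterms \<longleftrightarrow> s \<in> lterms \<and> t \<in> lterms"
  "TMeet s t \<in> lterms \<longleftrightarrow> s \<in> lterms \<and> t \<in> lterms"
  by (auto simp: lterms_def)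

lemma tle_refl': "prime_ideal H \<Longrightarrow> t \<in> lterms \<Longrightarrow> tle_at H t t"
  by (simp add: lterms_def tle_refl)

lemma tle_trans':
  "prime_ideal H \<Longrightarrow> s \<in> lterms \<Longrightarrow> t \<in> lterms \<Longrightarrow> u \<in> lterms \<Longrightarrow> tle_at H s t \<Longrightarrow> tle_at H t u \<Longrightarrow> tle_at H s u"
  using tle_trans[of H t s u] by (simp add: lterms_def)

lemma cls_eqD:
  assumes "cls s = cls t" "s \<in> lterms" "prime_ideal H"
  shows "tle_at H s t \<and> tle_at H t s"
proof -
  have "s \<in> cls s" using assms(2) tle_refl' by (simp add: cls_def)
  then have "s \<in> cls t" using assms(1) by simp
  then show ?thesis using assms(3) by (simp add: cls_def)
qed

lemma cls_eqI:
  assumes "s \<in> lterms" "t \<in> lterms" "\<And>H. prime_ideal H \<Longrightarrow> tle_at H s t \<and> tle_at H t s"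
  shows "cls s = cls t"
  unfolding cls_def using assms tle_trans'[OF _ _ assms(1,2)] tle_trans'[OF _ _ assms(2,1)]
    tle_trans'[OF _ assms(1,2)] tle_trans'[OF _ assms(2,1)] by blast

lemma cls_rel_iff:
  assumes "S \<subseteq> {H. prime_ideal H}" "s \<in> lterms" "t \<in> lterms"
  shows "(cls s, cls t) \<in> cls_rel S \<longleftrightarrow> (\<forall>H\<in>S. tle_at H s t)"
proof
  assume "(cls s, cls t) \<in> cls_rel S"
  then obtain s' t' where *: "cls s = cls s'" "cls t = cls t'" "s' \<in> lterms" "t' \<in> lterms" "\<forall>H\<in>S. tle_at H s' t'"
    by (auto simp: cls_rel_def)
  show "\<forall>H\<in>S. tle_at H s t"
  proof
    fix H assume "H \<in> S"
    then have H: "prime_ideal H" and le: "tle_at H s' t'" using assms(1) * by auto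
    have "tle_at H s s'" "tle_at H t' t" using cls_eqD[OF *(1) assms(2) H] cls_eqD[OF *(2) assms(3) H] by auto
    then show "tle_at H s t"
      using tle_trans'[OF H assms(2) *(3,4) _ le] tle_trans'[OF H assms(2) *(4) assms(3)] by blast
  qed
next
  assume "\<forall>H\<in>S. tle_at H s t"
  then show "(cls s, cls t) \<in> cls_rel S" using assms(2,3) by (auto simp: cls_rel_def)
qed

lemma cls_rel_at_iff:
  "prime_ideal H \<Longrightarrow> s \<in> lterms \<Longrightarrow> t \<in> lterms \<Longrightarrow> (cls s, cls t) \<in> cls_rel {H} \<longleftrightarrow> tle_at H s t"
  by (simp add: cls_rel_iff)

lemma cls_rel_eq_Inter:
  "S \<subseteq> {H. prime_ideal H} \<Longrightarrow> A \<in> cls ` lterms \<Longrightarrow> B \<in> cls ` lterms \<Longrightarrow>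
    (A, B) \<in> cls_rel S \<longleftrightarrow> (\<forall>H\<in>S. (A, B) \<in> cls_rel {H})"
  by (auto simp: cls_rel_iff cls_rel_at_iff subset_iff)

lemma cls_rel_carrier: "cls_rel S \<subseteq> cls ` lterms \<times> cls ` lterms"
  by (auto simp: cls_rel_def)

section \<open>Joins, meets and the lattice laws for classes\<close>

lemma join_term_exists:
  assumes "finite X" "X \<noteq> {}" "X \<subseteq> cls ` lterms"
  shows "\<exists>t. join_term X t"
  using assms
proof (induction rule: finite_ne_induct)
  case (singleton A)
  then show ?case by (auto simp: join_term_def cls_rel_at_iff)
next
  case (insert A X)
  then obtain t where t: "join_term X t" by auto
  obtain s where s: "s \<in> lterms" "A = cls s" using insert.prems by auto
  have "join_term (insert A X) (TJoin s t)"
    using t s by (simp add: join_term_def tle_join_left_iff cls_rel_at_iff)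
  then show ?case by blast
qed

lemma meet_term_exists:
  assumes "finite X" "X \<noteq> {}" "X \<subseteq> cls ` lterms"
  shows "\<exists>t. meet_term X t"
  using assms
proof (induction rule: finite_ne_induct)
  case (singleton A)
  then show ?case by (auto simp: meet_term_def cls_rel_at_iff)
next
  case (insert A X)
  then obtain t where t: "meet_term X t" by auto
  obtain s where s: "s \<in> lterms" "A = cls s" using insert.prems by auto
  have "meet_term (insert A X) (TMeet s t)"
    using t s by (simp add: meet_term_def tle_meet_right_iff cls_rel_at_iff)
  then show ?case by blast
qed

lemma join_term_unique:
  assumes "join_term X s" "join_term X t"
  shows "cls s = cls t"
proof (rule cls_eqI)
  show st: "s \<in> lterms" "t \<in> lterms" using assms by (simp_all add: join_term_def)
  fix H :: "'d \<Rightarrow> bool" assume H: "prime_ideal H"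
  then have "tle_at H s u \<longleftrightarrow> tle_at H t u" if "u \<in> lterms" for u
    using assms that by (simp add: join_term_def)
  then show "tle_at H s t \<and> tle_at H t s" using st tle_refl'[OF H] by blast
qed

lemma meet_term_unique:
  assumes "meet_term X s" "meet_term X t"
  shows "cls s = cls t"
proof (rule cls_eqI)
  show st: "s \<in> lterms" "t \<in> lterms" using assms by (simp_all add: meet_term_def)
  fix H :: "'d \<Rightarrow> bool" assume H: "prime_ideal H"
  then have "tle_at H u s \<longleftrightarrow> tle_at H u t" if "u \<in> lterms" for u
    using assms that by (simp add: meet_term_def)
  then show "tle_at H s t \<and> tle_at H t s" using st tle_refl'[OF H] by blast
qed

lemma pjoin_L_eq: "X \<in> nfin (cls ` lterms) \<Longrightarrow> join_term X t \<Longrightarrow> pjoin L X = Some (cls t)"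
  using join_term_unique[OF someI[of "join_term X" t]] by (simp add: L_def)

lemma pmeet_L_eq: "X \<in> nfin (cls ` lterms) \<Longrightarrow> meet_term X t \<Longrightarrow> pmeet L X = Some (cls t)"
  using meet_term_unique[OF someI[of "meet_term X" t]] by (simp add: L_def)

lemma pjoin_L_obtain:
  assumes "pjoin L X = Some A"
  obtains t where "X \<in> nfin (cls ` lterms)" "join_term X t" "A = cls t"
proof -
  have X: "X \<in> nfin (cls ` lterms)" using assms by (simp add: L_def split: if_splits)
  then obtain t where "join_term X t" using join_term_exists[of X] by (auto simp: nfin_iff)
  then show thesis using that X assms pjoin_L_eq[OF X] by simp
qed

lemma pmeet_L_obtain:
  assumes "pmeet L X = Some A"
  obtains t where "X \<in> nfin (cls ` lterms)" "meet_term X t" "A = cls t"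
proof -
  have X: "X \<in> nfin (cls ` lterms)" using assms by (simp add: L_def split: if_splits)
  then obtain t where "meet_term X t" using meet_term_exists[of X] by (auto simp: nfin_iff)
  then show thesis using that X assms pmeet_L_eq[OF X] by simp
qed

lemma cls_rel_sup:
  assumes S: "S \<subseteq> {H. prime_ideal H}" and X: "X \<in> nfin (cls ` lterms)" and t: "join_term X t"
  shows "is_sup (cls ` lterms) (cls_rel S) X (cls t)"
  unfolding is_sup_def
proof (intro conjI ballI impI)
  have tT: "t \<in> lterms" using t by (simp add: join_term_def)
  then show "cls t \<in> cls ` lterms" by simp
  have iff: "tle_at H t u \<longleftrightarrow> (\<forall>A\<in>X. (A, cls u) \<in> cls_rel {H})" if "H \<in> S" "u \<in> lterms" for H u
    using t that S by (auto simp: join_term_def)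
  show "(A, cls t) \<in> cls_rel S" if A: "A \<in> X" for A
  proof -
    have "(A, cls t) \<in> cls_rel {H}" if "H \<in> S" for H
      using iff[OF that tT] tle_refl'[OF _ tT, of H] S that A by auto
    then show ?thesis using cls_rel_eq_Inter[OF S, of A "cls t"] A X tT by (auto simp: nfin_iff)
  qed
  fix B assume B: "B \<in> cls ` lterms" "\<forall>A\<in>X. (A, B) \<in> cls_rel S"
  then obtain u where u: "u \<in> lterms" "B = cls u" by auto
  have "tle_at H t u" if H: "H \<in> S" for H
  proof -
    have "(A, cls u) \<in> cls_rel {H}" if "A \<in> X" for A
      using cls_rel_eq_Inter[OF S, of A B] B u that X H by (auto simp: nfin_iff)
    then show ?thesis using iff[OF H u(1)] by blast
  qed
  then show "(cls t, B) \<in> cls_rel S" using cls_rel_iff[OF S tT u(1)] u(2) by simp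
qed

lemma cls_rel_inf:
  assumes S: "S \<subseteq> {H. prime_ideal H}" and X: "X \<in> nfin (cls ` lterms)" and t: "meet_term X t"
  shows "is_inf (cls ` lterms) (cls_rel S) X (cls t)"
  unfolding is_inf_def
proof (intro conjI ballI impI)
  have tT: "t \<in> lterms" using t by (simp add: meet_term_def)
  then show "cls t \<in> cls ` lterms" by simp
  have iff: "tle_at H u t \<longleftrightarrow> (\<forall>A\<in>X. (cls u, A) \<in> cls_rel {H})" if "H \<in> S" "u \<in> lterms" for H u
    using t that S by (auto simp: meet_term_def)
  show "(cls t, A) \<in> cls_rel S" if A: "A \<in> X" for A
  proof -
    have "(cls t, A) \<in> cls_rel {H}" if "H \<in> S" for H
      using iff[OF that tT] tle_refl'[OF _ tT, of H] S that A by auto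
    then show ?thesis using cls_rel_eq_Inter[OF S, of "cls t" A] A X tT by (auto simp: nfin_iff)
  qed
  fix B assume B: "B \<in> cls ` lterms" "\<forall>A\<in>X. (B, A) \<in> cls_rel S"
  then obtain u where u: "u \<in> lterms" "B = cls u" by auto
  have "tle_at H u t" if H: "H \<in> S" for H
  proof -
    have "(cls u, A) \<in> cls_rel {H}" if "A \<in> X" for A
      using cls_rel_eq_Inter[OF S, of B A] B u that X H by (auto simp: nfin_iff)
    then show ?thesis using iff[OF H u(1)] by blast
  qed
  then show "(B, cls t) \<in> cls_rel S" using cls_rel_iff[OF S u(1) tT] u(2) by simp
qed

lemma cls_rel_preorder:
  assumes S: "S \<subseteq> {H. prime_ideal H}"
  shows "preorder_on (cls ` lterms) (cls_rel S)"
  unfolding preorder_on_iff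
proof (intro conjI ballI allI impI)
  show "(A, A) \<in> cls_rel S" if "A \<in> cls ` lterms" for A
    using that S by (auto simp: cls_rel_iff[OF S] intro!: tle_refl')
  fix A B D assume AB: "(A, B) \<in> cls_rel S" "(B, D) \<in> cls_rel S"
  then obtain s t u where *: "A = cls s" "B = cls t" "D = cls u" "s \<in> lterms" "t \<in> lterms" "u \<in> lterms"
    using cls_rel_carrier[of S] by blast
  then have "\<forall>H\<in>S. tle_at H s t" "\<forall>H\<in>S. tle_at H t u" using AB cls_rel_iff[OF S] by auto
  then have "\<forall>H\<in>S. tle_at H s u" using tle_trans'[OF _ *(4-6)] S by blast
  then show "(A, D) \<in> cls_rel S" using cls_rel_iff[OF S *(4,6)] * by simp
qed (rule cls_rel_carrier)

lemma prelattice_cls_rel: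
  assumes "S \<subseteq> {H. prime_ideal H}" "C \<noteq> {}"
  shows "partial_prelattice (L\<lparr>ple := cls_rel S\<rparr>)"
  unfolding partial_prelattice_def
proof (intro conjI allI impI)
  obtain x where "x \<in> C" using assms(2) by blast
  then have "cls (Gen x) \<in> pcarrier (L\<lparr>ple := cls_rel S\<rparr>)" by (simp add: L_simps)
  then show "pcarrier (L\<lparr>ple := cls_rel S\<rparr>) \<noteq> {}" by blast
  show "preorder_on (pcarrier (L\<lparr>ple := cls_rel S\<rparr>)) (ple (L\<lparr>ple := cls_rel S\<rparr>))"
    using cls_rel_preorder[OF assms(1)] by (simp add: L_simps)
  fix X A
  show "X \<in> nfin (pcarrier (L\<lparr>ple := cls_rel S\<rparr>))"
    "is_sup (pcarrier (L\<lparr>ple := cls_rel S\<rparr>)) (ple (L\<lparr>ple := cls_rel S\<rparr>)) X A"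
    if "pjoin (L\<lparr>ple := cls_rel S\<rparr>) X = Some A"
    using that cls_rel_sup[OF assms(1)] by (auto simp: L_simps elim: pjoin_L_obtain)
  show "X \<in> nfin (pcarrier (L\<lparr>ple := cls_rel S\<rparr>))"
    "is_inf (pcarrier (L\<lparr>ple := cls_rel S\<rparr>)) (ple (L\<lparr>ple := cls_rel S\<rparr>)) X A"
    if "pmeet (L\<lparr>ple := cls_rel S\<rparr>) X = Some A"
    using that cls_rel_inf[OF assms(1)] by (auto simp: L_simps elim: pmeet_L_obtain)
qed

lemma L_is_lattice:
  assumes "C \<noteq> {}"
  shows "is_lattice L"
proof -
  have "L\<lparr>ple := cls_rel {H. prime_ideal H}\<rparr> = L" by (simp add: L_def)
  then have "partial_prelattice L" using prelattice_cls_rel[OF subset_refl assms] by simp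
  moreover have "antisym (ple L)"
  proof (rule antisymI)
    fix A B assume AB: "(A, B) \<in> ple L" "(B, A) \<in> ple L"
    then obtain s t where *: "A = cls s" "B = cls t" "s \<in> lterms" "t \<in> lterms"
      using cls_rel_carrier[of "{H. prime_ideal H}"] unfolding L_simps by blast
    then have "tle_at H s t \<and> tle_at H t s" if "prime_ideal H" for H
      using AB that by (simp add: L_simps cls_rel_iff)
    then have "cls s = cls t" by (rule cls_eqI[OF *(3,4)])
    then show "A = B" using *(1,2) by simp
  qed
  moreover have "dom (pjoin L) = nfin (pcarrier L)" "dom (pmeet L) = nfin (pcarrier L)"
    by (auto simp: L_def split: if_splits)
  ultimately show ?thesis by (simp add: is_lattice_def is_partial_lattice_def)
qed

lemma L_prelattice: "C \<noteq> {} \<Longrightarrow> partial_prelattice L"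
  using L_is_lattice by (simp add: is_lattice_def is_partial_lattice_def)

section \<open>The congruences at prime ideals and the measure\<close>

lemma cls_rel_mono: "S \<subseteq> S' \<Longrightarrow> cls_rel S' \<subseteq> cls_rel S"
  by (auto simp: cls_rel_def)

lemma cls_rel_in_Con:
  assumes "prime_ideal H" "C \<noteq> {}"
  shows "cls_rel {H} \<in> Con L"
  using assms prelattice_cls_rel[of "{H}"] cls_rel_mono[of "{H}" "{H. prime_ideal H}"]
  by (simp add: Con_def L_simps)

text \<open>Uniqueness of \<open>d\<close> is \<open>prime_ideal_eqI\<close>. Existence is shown for
  compact \<open>\<theta>\<close> in \<open>\<phi>_iff\<close>; elsewhere the value is
  arbitrary.\<close>

definition \<phi> :: "'a lterm set rel \<Rightarrow> 'd" where
  "\<phi> \<theta> = (SOME d. \<forall>H. prime_ideal H \<longrightarrow> (H d \<longleftrightarrow> \<theta> \<subseteq> cls_rel {H}))"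

text \<open>For a compact \<open>\<theta>\<close>, containment in the congruence at \<open>H\<close>
  concerns finitely many generators, hence is a finite conjunction of definable comparisons of
  terms.\<close>

lemma \<phi>_iff:
  assumes \<theta>: "\<theta> \<in> Con_c L" and ne: "C \<noteq> {}" and H: "prime_ideal H"
  shows "H (\<phi> \<theta>) \<longleftrightarrow> \<theta> \<subseteq> cls_rel {H}"
proof -
  note P = L_prelattice[OF ne]
  obtain R where R: "finite R" "R \<subseteq> \<theta>" "\<theta> = cg L R" using Con_c_finite[OF P \<theta>] .
  have "\<theta> \<in> Con L" using \<theta> by (simp add: Con_c_def)
  then have RC: "R \<subseteq> cls ` lterms \<times> cls ` lterms"
    using R(2) Con_subset[OF P] unfolding L_simps by blast
  define S where "S = (\<lambda>H. \<forall>p\<in>R. p \<in> cls_rel {H})"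
  have "definable (\<lambda>H. p \<in> cls_rel {H})" if p: "p \<in> R" for p
  proof -
    obtain s t where st: "p = (cls s, cls t)" "s \<in> lterms" "t \<in> lterms" using RC p by blast
    have "definable (\<lambda>H. tle_at H s t)" using st by (intro tle_definable) (auto simp: lterms_def)
    then show ?thesis
      by (rule iffD2[OF definable_cong, rotated]) (simp add: st cls_rel_at_iff)
  qed
  then have "definable S" unfolding S_def using R(1) by (intro definable_Ball)
  \<comment> \<open>Excludes the constant False and so yields an element of \<open>D\<close> even if
    \<open>D\<close> has no unit.\<close>
  moreover have "S (\<lambda>_. True)"
    unfolding S_def
  proof
    fix p assume p: "p \<in> R"
    obtain s t where st: "p = (cls s, cls t)" "s \<in> lterms" "t \<in> lterms" using RC p by blast
    then show "p \<in> cls_rel {\<lambda>_. True}"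
      using tle_True[of s t] cls_rel_at_iff[OF prime_ideal_True] by (simp add: lterms_def)
  qed
  ultimately obtain d where d: "\<And>H. prime_ideal H \<Longrightarrow> S H \<longleftrightarrow> H d"
    using definable_obtain by blast
  have "H d \<longleftrightarrow> \<theta> \<subseteq> cls_rel {H}" if H: "prime_ideal H" for H
    using d[OF H] cg_subset_iff[OF P cls_rel_in_Con[OF H ne], of R] R(3) by (auto simp: S_def)
  then have "\<exists>d. \<forall>H. prime_ideal H \<longrightarrow> (H d \<longleftrightarrow> \<theta> \<subseteq> cls_rel {H})" by blast
  from someI_ex[OF this] show ?thesis using H unfolding \<phi>_def by blast
qed

lemma L_measured:
  assumes ne: "C \<noteq> {}"
  shows "measured_lattice L \<phi>"
proof -
  note P = L_prelattice[OF ne]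
  have "ple L \<in> Con_c L" using cg_finite_in_Con_c[OF P, of "{}"] by (simp add: cg_empty[OF P])
  then have "\<phi> (ple L) = bot"
    using \<phi>_iff[OF _ ne] cls_rel_mono[of "{_}" "{H. prime_ideal H}"]
    by (intro prime_ideal_eq_botI) (simp add: L_simps)
  moreover have "\<phi> (cg L (\<alpha> \<union> \<beta>)) = sup (\<phi> \<alpha>) (\<phi> \<beta>)" if ab: "\<alpha> \<in> Con_c L" "\<beta> \<in> Con_c L" for \<alpha> \<beta>
  proof (rule prime_ideal_eqI)
    obtain R where R: "finite R" "R \<subseteq> \<alpha>" "\<alpha> = cg L R" using Con_c_finite[OF P ab(1)] .
    obtain S where S: "finite S" "S \<subseteq> \<beta>" "\<beta> = cg L S" using Con_c_finite[OF P ab(2)] .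
    have sub: "R \<subseteq> pcarrier L \<times> pcarrier L" "S \<subseteq> pcarrier L \<times> pcarrier L"
      using R(2) S(2) ab Con_subset[OF P, of \<alpha>] Con_subset[OF P, of \<beta>] by (auto simp: Con_c_def)
    then have "cg L (\<alpha> \<union> \<beta>) = cg L (R \<union> S)" using cg_Un[OF P] R(3) S(3) by simp
    then have "cg L (\<alpha> \<union> \<beta>) \<in> Con_c L" using cg_finite_in_Con_c[OF P, of "R \<union> S"] R S sub by simp
    then show "H (\<phi> (cg L (\<alpha> \<union> \<beta>))) \<longleftrightarrow> H (sup (\<phi> \<alpha>) (\<phi> \<beta>))" if H: "prime_ideal H" for H
      using ab by (simp add: \<phi>_iff[OF _ ne H] prime_ideal_sup[OF H] cg_subset_iff[OF P cls_rel_in_Con[OF H ne]])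
  qed
  ultimately show ?thesis
    using L_is_lattice[OF ne] by (simp add: measured_lattice_def measured_def is_lattice_def)
qed

text \<open>Zero lies in every prime ideal, so a congruence of value zero is contained in all
  \<open>cls_rel {H}\<close>, whose intersection is the ordering of \<open>L\<close>.\<close>

lemma L_proper:
  assumes ne: "C \<noteq> {}"
  shows "proper L \<phi>"
  unfolding proper_def
proof (intro ballI impI)
  fix \<theta> assume \<theta>: "\<theta> \<in> Con_c L" "\<phi> \<theta> = bot"
  have \<theta>C: "\<theta> \<in> Con L" using \<theta> by (simp add: Con_c_def)
  have sub: "\<theta> \<subseteq> cls_rel {H}" if "prime_ideal H" for H
    using \<phi>_iff[OF \<theta>(1) ne that] \<theta>(2) prime_ideal_bot[OF that] by simp
  have "\<theta> \<subseteq> ple L"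
  proof
    fix p assume p: "p \<in> \<theta>"
    then obtain A B where AB: "p = (A, B)" "A \<in> cls ` lterms" "B \<in> cls ` lterms"
      using subsetD[OF Con_subset[OF L_prelattice[OF ne] \<theta>C] p] by (cases p) (auto simp: L_simps)
    have "(A, B) \<in> cls_rel {H}" if "prime_ideal H" for H using sub[OF that] p AB(1) by blast
    then show "p \<in> ple L" using cls_rel_eq_Inter[OF subset_refl AB(2,3)] AB(1) by (simp add: L_simps)
  qed
  then show "\<theta> = ple L" using Con_ple[OF L_prelattice[OF ne] \<theta>C] by (rule subset_antisym)
qed

text \<open>Stated for any \<open>e\<close> in order to serve both \<open>Inl\<close> and
  \<open>Inr\<close>. That \<open>e\<close> also reflects the ordering at \<open>H\<close> is
  essential: the congruence \<open>cls_rel {H}\<close> then pulls back to exactly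
  \<open>kernel_at P \<mu> H\<close>, and comparing at all \<open>H\<close> gives the equation for
  the measures.\<close>

lemma Gen_measured_hom:
  assumes ne: "C \<noteq> {}" and mP: "measured P \<mu>" and e: "\<And>x. x \<in> pcarrier P \<Longrightarrow> e x \<in> C"
    and le: "\<And>H x y. prime_ideal H \<Longrightarrow> x \<in> pcarrier P \<Longrightarrow> y \<in> pcarrier P \<Longrightarrow>
      le H (e x) (e y) \<longleftrightarrow> H (\<mu> (Theta_plus P x y))"
    and eJ: "\<And>X a. pjoin P X = Some a \<Longrightarrow> J (e ` X) = Some (e a)"
    and eM: "\<And>X a. pmeet P X = Some a \<Longrightarrow> M (e ` X) = Some (e a)"
  shows "measured_hom P \<mu> L \<phi> (\<lambda>x. cls (Gen (e x)))"
proof -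
  let ?h = "\<lambda>x. cls (Gen (e x))"
  note P = measured_prelattice[OF mP] and L = L_prelattice[OF ne]
  have kernel: "(?h x, ?h y) \<in> cls_rel {H} \<longleftrightarrow> (x, y) \<in> kernel_at P \<mu> H"
    if "prime_ideal H" "x \<in> pcarrier P" "y \<in> pcarrier P" for H x y
    using that e le by (simp add: cls_rel_at_iff tle_Gen_Gen kernel_at_def)
  have hom: "pl_hom P L ?h"
    unfolding pl_hom_def
  proof (intro conjI allI impI)
    show "?h \<in> pcarrier P \<rightarrow> pcarrier L" using e by (auto simp: L_simps)
  next
    fix x y assume xy: "(x, y) \<in> ple P"
    then have C: "x \<in> pcarrier P" "y \<in> pcarrier P" using Con_subset[OF P ple_in_Con[OF P]] by auto
    then have "(?h x, ?h y) \<in> cls_rel {H}" if "prime_ideal H" for H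
      using kernel[OF that C] xy Con_ple[OF P kernel_at_in_Con[OF mP that]] by auto
    then show "(?h x, ?h y) \<in> ple L"
      using cls_rel_eq_Inter[OF subset_refl, of "?h x" "?h y"] C e by (simp add: L_simps)
  next
    fix X a assume X: "pjoin P X = Some a"
    note XP = prelattice_join[OF P X]
    have XC: "\<And>x. x \<in> X \<Longrightarrow> e x \<in> C" and aC: "e a \<in> C" using XP e by auto
    have "?h ` X \<in> nfin (cls ` lterms)" using XP XC by (auto simp: nfin_iff)
    moreover have "join_term (?h ` X) (Gen (e a))"
      unfolding join_term_def
    proof (intro conjI allI impI ballI)
      show "Gen (e a) \<in> lterms" using aC by simp
      fix H :: "'d \<Rightarrow> bool" and u assume H: "prime_ideal H" and u: "u \<in> lterms"
      have "(\<forall>A\<in>?h ` X. (A, cls u) \<in> cls_rel {H}) \<longleftrightarrow> (\<forall>x\<in>X. tle_at H (Gen (e x)) u)"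
        using XC u H by (simp add: cls_rel_at_iff)
      also have "\<dots> \<longleftrightarrow> tle_at H (Gen (e a)) u"
      proof
        assume "\<forall>x\<in>X. tle_at H (Gen (e x)) u"
        then show "tle_at H (Gen (e a)) u"
          using u by (intro tle_Gen_join[OF H eJ[OF X]]) (auto simp: lterms_def)
      next
        assume au: "tle_at H (Gen (e a)) u"
        show "\<forall>x\<in>X. tle_at H (Gen (e x)) u"
        proof
          fix x assume x: "x \<in> X"
          have "le H (e x) (e a)" using J_upper[OF H eJ[OF X]] x by simp
          then have "tle_at H (Gen (e x)) (Gen (e a))" using tle_Gen_Gen[OF H XC[OF x] aC] by simp
          then show "tle_at H (Gen (e x)) u" using tle_trans'[OF H _ _ u _ au] XC[OF x] aC by simp
        qed
      qed
      finally show "tle_at H (Gen (e a)) u \<longleftrightarrow> (\<forall>A\<in>?h ` X. (A, cls u) \<in> cls_rel {H})" by simp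
    qed
    ultimately show "pjoin L (?h ` X) = Some (?h a)" by (rule pjoin_L_eq)
  next
    fix X a assume X: "pmeet P X = Some a"
    note XP = prelattice_meet[OF P X]
    have XC: "\<And>x. x \<in> X \<Longrightarrow> e x \<in> C" and aC: "e a \<in> C" using XP e by auto
    have "?h ` X \<in> nfin (cls ` lterms)" using XP XC by (auto simp: nfin_iff)
    moreover have "meet_term (?h ` X) (Gen (e a))"
      unfolding meet_term_def
    proof (intro conjI allI impI ballI)
      show "Gen (e a) \<in> lterms" using aC by simp
      fix H :: "'d \<Rightarrow> bool" and u assume H: "prime_ideal H" and u: "u \<in> lterms"
      have "(\<forall>A\<in>?h ` X. (cls u, A) \<in> cls_rel {H}) \<longleftrightarrow> (\<forall>x\<in>X. tle_at H u (Gen (e x)))"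
        using XC u H by (simp add: cls_rel_at_iff)
      also have "\<dots> \<longleftrightarrow> tle_at H u (Gen (e a))"
      proof
        assume "\<forall>x\<in>X. tle_at H u (Gen (e x))"
        then show "tle_at H u (Gen (e a))"
          using u by (intro tle_Gen_meet[OF H eM[OF X]]) (auto simp: lterms_def)
      next
        assume au: "tle_at H u (Gen (e a))"
        show "\<forall>x\<in>X. tle_at H u (Gen (e x))"
        proof
          fix x assume x: "x \<in> X"
          have "le H (e a) (e x)" using dual.J_upper[OF H eM[OF X]] x by simp
          then have "tle_at H (Gen (e a)) (Gen (e x))" using tle_Gen_Gen[OF H aC XC[OF x]] by simp
          then show "tle_at H u (Gen (e x))" using tle_trans'[OF H u _ _ au] XC[OF x] aC by simp
        qed
      qed
      finally show "tle_at H u (Gen (e a)) \<longleftrightarrow> (\<forall>A\<in>?h ` X. (cls u, A) \<in> cls_rel {H})" by simp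
    qed
    ultimately show "pmeet L (?h ` X) = Some (?h a)" by (rule pmeet_L_eq)
  qed
  moreover have "\<phi> (Con_c_map L ?h \<alpha>) = \<mu> \<alpha>" if \<alpha>: "\<alpha> \<in> Con_c P" for \<alpha>
  proof (rule prime_ideal_eqI)
    obtain R where R: "finite R" "R \<subseteq> \<alpha>" "\<alpha> = cg P R" using Con_c_finite[OF P \<alpha>] .
    have RC: "R \<subseteq> pcarrier P \<times> pcarrier P"
      using R(2) \<alpha> Con_subset[OF P, of \<alpha>] by (auto simp: Con_c_def)
    let ?R = "(\<lambda>(x, y). (?h x, ?h y)) ` R"
    have map: "Con_c_map L ?h \<alpha> = cg L ?R" using Con_c_map_cg[OF P L hom RC] R(3) by simp
    have RL: "?R \<subseteq> pcarrier L \<times> pcarrier L" using RC e by (auto simp: L_simps)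
    have c: "cg L ?R \<in> Con_c L" using cg_finite_in_Con_c[OF L _ RL] R(1) by simp
    fix H :: "'d \<Rightarrow> bool" assume H: "prime_ideal H"
    have "H (\<phi> (Con_c_map L ?h \<alpha>)) \<longleftrightarrow> ?R \<subseteq> cls_rel {H}"
      unfolding map using \<phi>_iff[OF c ne H] cg_subset_iff[OF L cls_rel_in_Con[OF H ne]] by simp
    also have "\<dots> \<longleftrightarrow> R \<subseteq> kernel_at P \<mu> H"
    proof -
      have "(case p of (x, y) \<Rightarrow> (?h x, ?h y)) \<in> cls_rel {H} \<longleftrightarrow> p \<in> kernel_at P \<mu> H" if "p \<in> R" for p
        using kernel[OF H] that RC by (cases p) auto
      then show ?thesis unfolding image_subset_iff unfolding subset_eq by (rule ball_cong[OF refl])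
    qed
    also have "\<dots> \<longleftrightarrow> \<alpha> \<subseteq> kernel_at P \<mu> H"
      unfolding R(3) using cg_subset_iff[OF P kernel_at_in_Con[OF mP H]] by simp
    also have "\<dots> \<longleftrightarrow> H (\<mu> \<alpha>)" using measure_iff_kernel_at[OF mP H \<alpha>] by simp
    finally show "H (\<phi> (Con_c_map L ?h \<alpha>)) \<longleftrightarrow> H (\<mu> \<alpha>)" .
  qed
  ultimately show ?thesis by (simp add: measured_hom_def)
qed

lemma L_span:
  "lattice_span L ((\<lambda>x. cls (Gen x)) ` C) = pcarrier L"
proof (rule subset_antisym)
  have "is_sublattice L (pcarrier L)"
    unfolding is_sublattice_def
    by (auto simp: L_simps join_term_def meet_term_def elim!: pjoin_L_obtain pmeet_L_obtain)
  then show "lattice_span L ((\<lambda>x. cls (Gen x)) ` C) \<subseteq> pcarrier L"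
    unfolding lattice_span_def by (rule Inter_lower[OF CollectI, OF conjI]) (auto simp: L_simps)
  have "cls t \<in> S" if S: "is_sublattice L S" "(\<lambda>x. cls (Gen x)) ` C \<subseteq> S" and t: "t \<in> lterms" for S t
    using t
  proof (induction t)
    case (Gen x)
    then show ?case using S(2) by auto
  next
    case (TJoin s t)
    have X: "{cls s, cls t} \<in> nfin (cls ` lterms)" using TJoin.prems by (simp add: nfin_iff)
    have "join_term {cls s, cls t} (TJoin s t)"
      using TJoin.prems by (simp add: join_term_def tle_join_left_iff cls_rel_at_iff)
    then have "pjoin L {cls s, cls t} = Some (cls (TJoin s t))" by (rule pjoin_L_eq[OF X])
    moreover have "{cls s, cls t} \<in> nfin S" using TJoin by (simp add: nfin_iff)
    ultimately show ?case using S(1) unfolding is_sublattice_def by blast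
  next
    case (TMeet s t)
    have X: "{cls s, cls t} \<in> nfin (cls ` lterms)" using TMeet.prems by (simp add: nfin_iff)
    have "meet_term {cls s, cls t} (TMeet s t)"
      using TMeet.prems by (simp add: meet_term_def tle_meet_right_iff cls_rel_at_iff)
    then have "pmeet L {cls s, cls t} = Some (cls (TMeet s t))" by (rule pmeet_L_eq[OF X])
    moreover have "{cls s, cls t} \<in> nfin S" using TMeet by (simp add: nfin_iff)
    ultimately show ?case using S(1) unfolding is_sublattice_def by blast
  qed
  then show "pcarrier L \<subseteq> lattice_span L ((\<lambda>x. cls (Gen x)) ` C)"
    by (auto simp: lattice_span_def L_simps)
qed

end

theorem proposition18p5:
  fixes K :: "'k partial_lattice" and lam :: "'k rel \<Rightarrow> 'd::{distrib_lattice,order_bot}"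
    and P :: "'p partial_lattice" and \<mu> :: "'p rel \<Rightarrow> 'd"
    and Q :: "'q partial_lattice" and \<nu> :: "'q rel \<Rightarrow> 'd"
    and f :: "'k \<Rightarrow> 'p" and g :: "'k \<Rightarrow> 'q"
  assumes "measured_lattice K lam" and "finite (pcarrier K)"
    and "balanced_measured P \<mu>"
    and "balanced_measured Q \<nu>"
    and "measured_hom K lam P \<mu> f"
    and "measured_hom K lam Q \<nu> g"
  shows "\<exists>(L :: ('p + 'q) lterm set partial_lattice) (\<phi> :: ('p + 'q) lterm set rel \<Rightarrow> 'd) fbar gbar.
           measured_lattice L \<phi> \<and> proper L \<phi> \<and>
           measured_hom P \<mu> L \<phi> fbar \<and>
           measured_hom Q \<nu> L \<phi> gbar \<and>
           (\<forall>x \<in> pcarrier K. fbar (f x) = gbar (g x)) \<and>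
           lattice_span L (fbar ` pcarrier P \<union> gbar ` pcarrier Q) = pcarrier L"
proof -
  have mK: "measured K lam" and mP: "measured P \<mu>" and mQ: "measured Q \<nu>"
    using assms by (simp_all add: measured_lattice_def balanced_measured_def)
  note PK = measured_prelattice[OF mK] and PP = measured_prelattice[OF mP] and PQ = measured_prelattice[OF mQ]
  have hf: "pl_hom K P f" and hg: "pl_hom K Q g" using assms(5,6) by (simp_all add: measured_hom_def)
  let ?K = "pcarrier K"
  let ?leP = "\<lambda>H x y. H (\<mu> (Theta_plus P x y))" and ?leQ = "\<lambda>H x y. H (\<nu> (Theta_plus Q x y))"
  interpret P: uniform_pair "pcarrier P" ?leP "pjoin P" "pmeet P" by (rule uniform_pair_balanced[OF assms(3)])
  interpret Q: uniform_pair "pcarrier Q" ?leQ "pjoin Q" "pmeet Q" by (rule uniform_pair_balanced[OF assms(4)])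
  have f_in: "f k \<in> pcarrier P" and g_in: "g k \<in> pcarrier Q" if "k \<in> ?K" for k
    using that hf hg by (auto simp: pl_hom_def)
  have K_ne: "?K \<noteq> {}" using PK by (simp add: partial_prelattice_def)
  \<comment> \<open>Both sides amount to the ordering of \<open>K\<close> at \<open>H\<close> given
    by \<open>lam\<close>.\<close>
  have embed: "?leP H (f k) (f l) \<longleftrightarrow> ?leQ H (g k) (g l)" if H: "prime_ideal H" and kl: "k \<in> ?K" "l \<in> ?K" for H k l
    using measured_hom_kernel_at[OF mK mP assms(5) H kl] measured_hom_kernel_at[OF mK mQ assms(6) H kl]
      f_in g_in kl by (simp add: kernel_at_def)
  have K_join: "\<exists>j\<in>?K. \<forall>H. prime_ideal H \<longrightarrow>
      (\<forall>x\<in>X. ?leP H (f x) (f j) \<and> ?leQ H (g x) (g j)) \<and>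
      (\<forall>b\<in>pcarrier P. (\<forall>x\<in>X. ?leP H (f x) b) \<longrightarrow> ?leP H (f j) b) \<and>
      (\<forall>b\<in>pcarrier Q. (\<forall>x\<in>X. ?leQ H (g x) b) \<longrightarrow> ?leQ H (g j) b)" if X: "X \<subseteq> ?K" "X \<noteq> {}" for X
  proof -
    \<comment> \<open>Finiteness makes every nonempty subset of the lattice \<open>K\<close> have a
      join. \<open>f\<close> and \<open>g\<close> carry it to joins in \<open>P\<close> and
      \<open>Q\<close>, which remain least at every \<open>H\<close>.\<close>
    have "X \<in> dom (pjoin K)"
      using X assms(1,2) finite_subset[of X ?K] by (simp add: measured_lattice_def is_lattice_def nfin_iff)
    then obtain j where j: "pjoin K X = Some j" by blast
    have "pjoin P (f ` X) = Some (f j)" "pjoin Q (g ` X) = Some (g j)"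
      using hf hg j by (simp_all add: pl_hom_def)
    then show ?thesis
      using prelattice_join(4)[OF PK j] by (intro bexI[of _ j] allI impI conjI ballI)
        (auto intro: P.J_upper Q.J_upper P.J_least Q.J_least)
  qed
  have K_meet: "\<exists>j\<in>?K. \<forall>H. prime_ideal H \<longrightarrow>
      (\<forall>x\<in>X. ?leP H (f j) (f x) \<and> ?leQ H (g j) (g x)) \<and>
      (\<forall>b\<in>pcarrier P. (\<forall>x\<in>X. ?leP H b (f x)) \<longrightarrow> ?leP H b (f j)) \<and>
      (\<forall>b\<in>pcarrier Q. (\<forall>x\<in>X. ?leQ H b (g x)) \<longrightarrow> ?leQ H b (g j))" if X: "X \<subseteq> ?K" "X \<noteq> {}" for X
  proof -
    have "X \<in> dom (pmeet K)"
      using X assms(1,2) finite_subset[of X ?K] by (simp add: measured_lattice_def is_lattice_def nfin_iff)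
    then obtain j where j: "pmeet K X = Some j" by blast
    have "pmeet P (f ` X) = Some (f j)" "pmeet Q (g ` X) = Some (g j)"
      using hf hg j by (simp_all add: pl_hom_def)
    then show ?thesis
      using prelattice_meet(4)[OF PK j] by (intro bexI[of _ j] allI impI conjI ballI)
        (auto intro: P.dual.J_upper Q.dual.J_upper P.dual.J_least Q.dual.J_least)
  qed
  let ?C = "pcarrier P <+> pcarrier Q"
  let ?le = "\<lambda>H. amal_le ?K f g (?leP H) (?leQ H)"
  let ?J = "amal_op (pjoin P) (pjoin Q)" and ?M = "amal_op (pmeet P) (pmeet Q)"
  have "amalgam (pcarrier P) ?leP (pjoin P) (pcarrier Q) ?leQ (pjoin Q) ?K f g"
    by (intro amalgam.intro amalgam_axioms.intro P.uniform_family_axioms Q.uniform_family_axioms)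
      (fact assms(2) K_ne f_in g_in embed K_join K_meet)+
  then have u1: "uniform_family ?C ?le ?J" by (rule amalgam.uniform_family_amalgam)
  \<comment> \<open>The instance with all orderings reversed; by \<open>amal_le_dual\<close> its
    ordering is the converse of the one already obtained.\<close>
  have "amalgam (pcarrier P) (\<lambda>H x y. ?leP H y x) (pmeet P) (pcarrier Q) (\<lambda>H x y. ?leQ H y x) (pmeet Q) ?K f g"
    by (intro amalgam.intro amalgam_axioms.intro P.dual.uniform_family_axioms Q.dual.uniform_family_axioms)
      (fact assms(2) K_ne f_in g_in K_join K_meet | (rule embed; assumption))+
  then have "uniform_family ?C (\<lambda>H. amal_le ?K f g (\<lambda>x y. ?leP H y x) (\<lambda>x y. ?leQ H y x)) ?M"
    by (rule amalgam.uniform_family_amalgam)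
  then have u2: "uniform_family ?C (\<lambda>H x y. ?le H y x) ?M"
    by (simp only: amal_le_dual[of ?K f g "?leP _" "?leQ _"])
  interpret R: uniform_pair ?C ?le ?J ?M
    using u1 u2 by (rule uniform_pair.intro)
  have ne: "?C \<noteq> {}" using K_ne f_in by blast
  let ?f = "\<lambda>x. R.cls (Gen (Inl x))" and ?g = "\<lambda>x. R.cls (Gen (Inr x))"
  have "measured_hom P \<mu> R.L R.\<phi> ?f"
    by (rule R.Gen_measured_hom[OF ne mP]) (auto simp: amal_op_Inl)
  moreover have "measured_hom Q \<nu> R.L R.\<phi> ?g"
    by (rule R.Gen_measured_hom[OF ne mQ])
      (auto simp: amal_op_Inr[OF prelattice_join(3)[OF PQ]] amal_op_Inr[OF prelattice_meet(3)[OF PQ]])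
  moreover have "?f (f k) = ?g (g k)" if k: "k \<in> ?K" for k
  proof (rule R.cls_eqI)
    show "Gen (Inl (f k)) \<in> R.lterms" "Gen (Inr (g k)) \<in> R.lterms" using f_in[OF k] g_in[OF k] by auto
    fix H :: "'d \<Rightarrow> bool" assume H: "prime_ideal H"
    \<comment> \<open>Reflexivity on each side makes \<open>k\<close> itself the interpolant in both
      mixed comparisons.\<close>
    have "?leP H (f k) (f k)" "?leQ H (g k) (g k)"
      using P.le_refl[OF H f_in[OF k]] Q.le_refl[OF H g_in[OF k]] .
    then show "R.tle_at H (Gen (Inl (f k))) (Gen (Inr (g k))) \<and> R.tle_at H (Gen (Inr (g k))) (Gen (Inl (f k)))"
      using k by (auto simp: R.tle_Gen_Gen[OF H InlI[OF f_in[OF k]] InrI[OF g_in[OF k]]]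
          R.tle_Gen_Gen[OF H InrI[OF g_in[OF k]] InlI[OF f_in[OF k]]])
  qed
  moreover have "?f ` pcarrier P \<union> ?g ` pcarrier Q = (\<lambda>x. R.cls (Gen x)) ` ?C"
    by (auto simp: Plus_def)
  ultimately show ?thesis
    using R.L_measured[OF ne] R.L_proper[OF ne] R.L_span
    by (intro exI[of _ R.L] exI[of _ R.\<phi>] exI[of _ ?f] exI[of _ ?g]) simp
qed

end
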